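(* Let $F$ be a $p$-adic field, $D$ the non-split quaternion algebra over $F$, and $\omega:F^\times\to\mathbb{C}^\times$ a unitary character. Let $\pi_D$ be an irreducible tempered representation of $GL_2(D)$ with central character $\omega^2$, and let $\Pi_D$ be the normalized parabolic induction to $GL_3(D)$ of the representation $\pi_D\boxtimes\omega^{-1}$ of the Levi subgroup $GL_2(D)\times GL_1(D)$ (where $\omega^{-1}$ is viewed as a character of $GL_1(D)$ through the reduced norm). Then $$m(\pi_D,\omega)=m_{GR}(\Pi_D).$$
   Context: $F$ is a finite extension of $\mathbb{Q}_p$, $\psi$ a fixed nontrivial additive character of $F$, $\mathrm{Tr}_{D/F}$ the reduced trace. Generalized Shalika multiplicity: in $GL_2(D)$ let $H_0=\{\mathrm{diag}(\lambda,\lambda):\lambda\in D^\times\}$, $N=\{\begin{pmatrix}1&X\\&1\end{pmatrix}:X\in D\}$, $H=H_0\ltimes N$; $\omega$ is a character of $H$ via $H\to H_0\simeq D^\times$ and the reduced norm, and $\xi$ is the character of $H$ trivial on $H_0$ with $\xi\begin{pmatrix}1&X\\&1\end{pmatrix}=\psi(\mathrm{Tr}_{D/F}X)$. Then $m(\pi_D,\omega)=\dim\mathrm{Hom}_H(\pi_D,\omega\otimes\xi)$. Ginzburg-Rallis multiplicity (with trivial character) for $GL_3(D)$: let $U=\left\{u(X,Y,Z)=\begin{pmatrix}1&X&Z\\&1&Y\\&&1\end{pmatrix}:X,Y,Z\in D\right\}$, $R=\{\mathrm{diag}(h,h,h):h\in D^\times\}\ltimes U$, and let $\xi_R$ be the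 character of $R$ trivial on $\mathrm{diag}(h,h,h)$ with $\xi_R(u(X,Y,Z))=\psi(\mathrm{Tr}_{D/F}X+\mathrm{Tr}_{D/F}Y)$. Then $m_{GR}(\Pi_D)=\dim\mathrm{Hom}_R(\Pi_D,\xi_R)$. *)

theory Defs
  imports
    "HOL-Analysis.Analysis"
    "HOL-Algebra.Coset"
    "HOL-Library.Extended_Nat"
    "HOL-Library.Function_Algebras"
begin

section \<open>The field \<open>F\<close> and its characters\<close>

definition padic_abs_rat :: "nat \<Rightarrow> rat \<Rightarrow> real" where
  "padic_abs_rat p r = (if r = 0 then 0 else
     real p powi (int (multiplicity (int p) (snd (quotient_of r)))
                  - int (multiplicity (int p) (fst (quotient_of r)))))"

definition abs_dist :: "('f::field_char_0 \<Rightarrow> real) \<Rightarrow> 'f \<Rightarrow> 'f \<Rightarrow> real" where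
  "abs_dist absF x y = absF (x - y)"

definition field_top :: "('f::field_char_0 \<Rightarrow> real) \<Rightarrow> 'f topology" where
  "field_top absF = Metric_space.mtopology UNIV (abs_dist absF)"

definition Qp :: "('f::field_char_0 \<Rightarrow> real) \<Rightarrow> 'f set" where
  "Qp absF = field_top absF closure_of \<rat>"

text \<open>A finite extension of \<open>Q\<^sub>p\<close>, with the absolute value extending that of \<open>Q\<^sub>p\<close>
  (so \<open>p\<close> has absolute value \<open>1/p\<close>). The subfield \<open>Q\<^sub>p\<close> is the completion of the rationals for
  the \<open>p\<close>-adic absolute value, that is, their closure, which is required to be complete.\<close>

locale p_adic_field =
  fixes p :: nat and absF :: "'f::field_char_0 \<Rightarrow> real"
  assumes prime_p: "prime p"
    and abs_nonneg: "0 \<le> absF x"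
    and abs_eq_0: "absF x = 0 \<longleftrightarrow> x = 0"
    and abs_mult: "absF (x * y) = absF x * absF y"
    and abs_ultra: "absF (x + y) \<le> max (absF x) (absF y)"
    and abs_rat: "absF (of_rat r) = padic_abs_rat p r"
    and Qp_complete: "Metric_space.mcomplete (Qp absF) (abs_dist absF)"
    and finite_extension:
      "\<exists>B. finite B \<and> (\<forall>x. \<exists>c. (\<forall>b\<in>B. c b \<in> Qp absF) \<and> x = (\<Sum>b\<in>B. c b * b))"

text \<open>The value of a multiplicative character at \<open>0\<close> is irrelevant.\<close>

definition unitary_character :: "('f::field_char_0 \<Rightarrow> real) \<Rightarrow> ('f \<Rightarrow> complex) \<Rightarrow> bool" where
  "unitary_character absF \<omega> \<longleftrightarrow>
     (\<forall>x y. x \<noteq> 0 \<and> y \<noteq> 0 \<longrightarrow> \<omega> (x * y) = \<omega> x * \<omega> y) \<and>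
     (\<forall>x. x \<noteq> 0 \<longrightarrow> cmod (\<omega> x) = 1) \<and>
     continuous_map (subtopology (field_top absF) (- {0})) euclidean \<omega>"

definition nontrivial_additive_character ::
    "('f::field_char_0 \<Rightarrow> real) \<Rightarrow> ('f \<Rightarrow> complex) \<Rightarrow> bool" where
  "nontrivial_additive_character absF \<psi> \<longleftrightarrow>
     (\<forall>x y. \<psi> (x + y) = \<psi> x * \<psi> y) \<and> (\<forall>x. cmod (\<psi> x) = 1) \<and>
     continuous_map (field_top absF) euclidean \<psi> \<and> (\<exists>x. \<psi> x \<noteq> 1)"


section \<open>The quaternion algebra \<open>D\<close>\<close>

text \<open>The type \<open>'d\<close> carries the ring structure; the record adds the action of \<open>F\<close> and a pair
  of standard generators.\<close>

record ('f, 'd) quat =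
  qscale :: "'f \<Rightarrow> 'd \<Rightarrow> 'd"
  qi :: 'd
  qj :: 'd

definition qcomb :: "('f, 'd::ring_1) quat \<Rightarrow> 'f^4 \<Rightarrow> 'd" where
  "qcomb D c = qscale D (c$1) 1 + qscale D (c$2) (qi D) + qscale D (c$3) (qj D)
               + qscale D (c$4) (qi D * qj D)"

text \<open>The algebra \<open>(a,b/F)\<close> for some nonzero \<open>a\<close>, \<open>b\<close>. It is non-split because \<open>'d\<close> is a division
  ring.\<close>

locale nonsplit_quaternion_algebra =
  fixes D :: "('f::field_char_0, 'd::division_ring) quat"
  assumes scale_vs: "vector_space (qscale D)"
    and scale_mult_left: "qscale D c x * y = qscale D c (x * y)"
    and scale_mult_right: "x * qscale D c y = qscale D c (x * y)"
    and qi_square: "\<exists>a. a \<noteq> 0 \<and> qi D * qi D = qscale D a 1"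
    and qj_square: "\<exists>b. b \<noteq> 0 \<and> qj D * qj D = qscale D b 1"
    and qj_qi: "qj D * qi D = - (qi D * qj D)"
    and basis: "\<exists>!c. x = qcomb D c"

definition qcoord :: "('f, 'd::ring_1) quat \<Rightarrow> 'd \<Rightarrow> 'f^4" where
  "qcoord D x = (THE c. x = qcomb D c)"

definition qconj :: "('f, 'd::ring_1) quat \<Rightarrow> 'd \<Rightarrow> 'd" where
  "qconj D x = (let c = qcoord D x in
     qscale D (c$1) 1 - qscale D (c$2) (qi D) - qscale D (c$3) (qj D)
     - qscale D (c$4) (qi D * qj D))"

text \<open>The elements \<open>x + qconj x\<close> and \<open>x * qconj x\<close> lie in \<open>F \<cdot> 1\<close>, and their coordinate along
  \<open>1\<close> is the reduced trace, respectively the reduced norm.\<close>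

definition rtrace :: "('f, 'd::ring_1) quat \<Rightarrow> 'd \<Rightarrow> 'f" where
  "rtrace D x = qcoord D (x + qconj D x) $ 1"

definition rnorm :: "('f, 'd::ring_1) quat \<Rightarrow> 'd \<Rightarrow> 'f" where
  "rnorm D x = qcoord D (x * qconj D x) $ 1"

definition quat_top ::
    "('f::field_char_0 \<Rightarrow> real) \<Rightarrow> ('f, 'd::ring_1) quat \<Rightarrow> 'd topology" where
  "quat_top absF D = pullback_topology UNIV (\<lambda>x k. qcoord D x $ k)
     (product_topology (\<lambda>_. field_top absF) UNIV)"


section \<open>The groups \<open>GL\<^sub>n(D)\<close>\<close>

definition GL :: "('d::division_ring^'n^'n) monoid" where
  "GL = \<lparr>carrier = {A. invertible A}, monoid.mult = (**), one = mat 1\<rparr>"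

definition GL_top ::
    "('f::field_char_0 \<Rightarrow> real) \<Rightarrow> ('f, 'd::division_ring) quat \<Rightarrow> ('d^'n^'n) topology" where
  "GL_top absF D = pullback_topology {A. invertible A} (\<lambda>A (k, l). A $ k $ l)
     (product_topology (\<lambda>_. quat_top absF D) UNIV)"

text \<open>The centre of \<open>GL\<^sub>n(D)\<close>, identified with the nonzero elements of \<open>F\<close>.\<close>

definition central :: "('f, 'd::division_ring) quat \<Rightarrow> 'f \<Rightarrow> 'd^'n^'n" where
  "central D a = mat (qscale D a 1)"

definition GL_centre :: "('f::zero, 'd::division_ring) quat \<Rightarrow> ('d^'n^'n) set" where
  "GL_centre D = {central D a | a. a \<noteq> 0}"


section \<open>Complex representations of locally profinite groups\<close>

text \<open>The representation space \<open>rspace\<close> is a subspace of the complex vector space given by the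
  type \<open>'v\<close> and \<open>rscale\<close>.\<close>

record ('g, 'v) rep =
  rscale :: "complex \<Rightarrow> 'v \<Rightarrow> 'v"
  rspace :: "'v set"
  ract :: "'g \<Rightarrow> 'v \<Rightarrow> 'v"

definition representation :: "'g monoid \<Rightarrow> ('g, 'v::ab_group_add) rep \<Rightarrow> bool" where
  "representation G \<rho> \<longleftrightarrow>
     vector_space (rscale \<rho>) \<and> module.subspace (rscale \<rho>) (rspace \<rho>) \<and>
     (\<forall>g\<in>carrier G. \<forall>v\<in>rspace \<rho>. ract \<rho> g v \<in> rspace \<rho>) \<and>
     (\<forall>g\<in>carrier G. \<forall>v\<in>rspace \<rho>. \<forall>w\<in>rspace \<rho>. ract \<rho> g (v + w) = ract \<rho> g v + ract \<rho> g w) \<and>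
     (\<forall>g\<in>carrier G. \<forall>c. \<forall>v\<in>rspace \<rho>. ract \<rho> g (rscale \<rho> c v) = rscale \<rho> c (ract \<rho> g v)) \<and>
     (\<forall>v\<in>rspace \<rho>. ract \<rho> \<one>\<^bsub>G\<^esub> v = v) \<and>
     (\<forall>g\<in>carrier G. \<forall>h\<in>carrier G. \<forall>v\<in>rspace \<rho>. ract \<rho> (g \<otimes>\<^bsub>G\<^esub> h) v = ract \<rho> g (ract \<rho> h v))"

definition smooth_representation ::
    "'g monoid \<Rightarrow> 'g topology \<Rightarrow> ('g, 'v::ab_group_add) rep \<Rightarrow> bool" where
  "smooth_representation G T \<rho> \<longleftrightarrow> representation G \<rho> \<and>
     (\<forall>v\<in>rspace \<rho>. openin T {g \<in> carrier G. ract \<rho> g v = v})"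

definition irreducible_representation ::
    "'g monoid \<Rightarrow> 'g topology \<Rightarrow> ('g, 'v::ab_group_add) rep \<Rightarrow> bool" where
  "irreducible_representation G T \<rho> \<longleftrightarrow> smooth_representation G T \<rho> \<and> rspace \<rho> \<noteq> {0} \<and>
     (\<forall>W. module.subspace (rscale \<rho>) W \<and> W \<subseteq> rspace \<rho> \<and>
          (\<forall>g\<in>carrier G. \<forall>w\<in>W. ract \<rho> g w \<in> W) \<longrightarrow> W = {0} \<or> W = rspace \<rho>)"

text \<open>Linear forms on \<open>rspace\<close>, extended by \<open>0\<close> outside of it.\<close>

definition linear_forms :: "('g, 'v::ab_group_add) rep \<Rightarrow> ('v \<Rightarrow> complex) set" where
  "linear_forms \<rho> = {l.
     (\<forall>v\<in>rspace \<rho>. \<forall>w\<in>rspace \<rho>. l (v + w) = l v + l w) \<and>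
     (\<forall>c. \<forall>v\<in>rspace \<rho>. l (rscale \<rho> c v) = c * l v) \<and>
     (\<forall>v. v \<notin> rspace \<rho> \<longrightarrow> l v = 0)}"

definition contragredient ::
    "'g monoid \<Rightarrow> 'g topology \<Rightarrow> ('g, 'v::ab_group_add) rep \<Rightarrow> ('v \<Rightarrow> complex) set" where
  "contragredient G T \<rho> = {l \<in> linear_forms \<rho>.
     openin T {g \<in> carrier G. \<forall>v\<in>rspace \<rho>. l (ract \<rho> g v) = l v}}"

definition hom_space ::
    "'g set \<Rightarrow> ('g \<Rightarrow> complex) \<Rightarrow> ('g, 'v::ab_group_add) rep \<Rightarrow> ('v \<Rightarrow> complex) set" where
  "hom_space H \<theta> \<rho> = {l \<in> linear_forms \<rho>.
     \<forall>h\<in>H. \<forall>v\<in>rspace \<rho>. l (ract \<rho> h v) = \<theta> h * l v}"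

text \<open>Dimension of a subspace, with value \<open>\<infinity>\<close> instead of the library's \<open>0\<close> when it is infinite.\<close>

definition edim :: "(complex \<Rightarrow> 'a::ab_group_add \<Rightarrow> 'a) \<Rightarrow> 'a set \<Rightarrow> enat" where
  "edim s W = (if \<exists>B. finite B \<and> W \<subseteq> module.span s B then enat (vector_space.dim s W) else \<infinity>)"

definition multiplicity_of ::
    "'g set \<Rightarrow> ('g \<Rightarrow> complex) \<Rightarrow> ('g, 'v::ab_group_add) rep \<Rightarrow> enat" where
  "multiplicity_of H \<theta> \<rho> = edim (\<lambda>c l v. c * l v) (hom_space H \<theta> \<rho>)"


section \<open>Tempered representations\<close>

definition haar_measure :: "('g, 'b) monoid_scheme \<Rightarrow> 'g topology \<Rightarrow> 'g measure \<Rightarrow> bool" where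
  "haar_measure G T \<mu> \<longleftrightarrow>
     space \<mu> = carrier G \<and> sets \<mu> = sigma_sets (carrier G) {U. openin T U} \<and>
     (\<forall>g\<in>carrier G. \<forall>A\<in>sets \<mu>. emeasure \<mu> ((\<lambda>x. g \<otimes>\<^bsub>G\<^esub> x) ` A) = emeasure \<mu> A) \<and>
     (\<forall>K. compactin T K \<longrightarrow> emeasure \<mu> K < \<infinity>) \<and>
     (\<forall>U. openin T U \<and> U \<noteq> {} \<longrightarrow> 0 < emeasure \<mu> U)"

text \<open>For irreducible \<open>\<rho>\<close>: the central character is unitary and all matrix coefficients lie in
  \<open>L\<^sup>2\<^sup>+\<^sup>\<epsilon>(G/Z)\<close> for every \<open>\<epsilon> > 0\<close>. The absolute value of a coefficient is \<open>Z\<close>-invariant by the first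
  condition, so it may be evaluated at any element of a coset; \<open>T'\<close> is the quotient topology.\<close>

definition tempered ::
    "'g monoid \<Rightarrow> 'g topology \<Rightarrow> 'g set \<Rightarrow> ('g, 'v::ab_group_add) rep \<Rightarrow> bool" where
  "tempered G T Z \<rho> \<longleftrightarrow>
     (\<exists>\<theta>. \<forall>z\<in>Z. cmod (\<theta> z) = 1 \<and> (\<forall>v\<in>rspace \<rho>. ract \<rho> z v = rscale \<rho> (\<theta> z) v)) \<and>
     (\<exists>T' \<mu>. quotient_map T T' (\<lambda>g. Z #>\<^bsub>G\<^esub> g) \<and> haar_measure (G Mod Z) T' \<mu> \<and>
        (\<forall>v\<in>rspace \<rho>. \<forall>l\<in>contragredient G T \<rho>. \<forall>\<epsilon>>0.
           integrable \<mu> (\<lambda>C. cmod (l (ract \<rho> (SOME g. g \<in> C) v)) powr (2 + \<epsilon>))))"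


section \<open>Normalized parabolic induction\<close>

definition compact_open_subgroup :: "'g monoid \<Rightarrow> 'g topology \<Rightarrow> 'g set \<Rightarrow> 'g set \<Rightarrow> bool" where
  "compact_open_subgroup G T N U \<longleftrightarrow>
     subgroup U G \<and> U \<subseteq> N \<and> compactin T U \<and> openin (subtopology T N) U"

definition sub_index :: "'g monoid \<Rightarrow> 'g set \<Rightarrow> 'g set \<Rightarrow> nat" where
  "sub_index G A B = card ((\<lambda>x. B #>\<^bsub>G\<^esub> x) ` A)"

text \<open>The modulus character of a parabolic subgroup with unipotent radical \<open>N\<close>: the factor
  \<open>vol(p U p\<^sup>-\<^sup>1) / vol(U)\<close> by which conjugation by \<open>p\<close> scales Haar measure on \<open>N\<close>, written as a quotient
  of indices for a compact open subgroup \<open>U\<close> of \<open>N\<close> (it does not depend on \<open>U\<close>). It equals the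
  absolute value of the determinant of \<open>Ad p\<close> on the Lie algebra of \<open>N\<close>.\<close>

definition modulus :: "'g monoid \<Rightarrow> 'g topology \<Rightarrow> 'g set \<Rightarrow> 'g \<Rightarrow> real" where
  "modulus G T N p = (THE c. \<exists>U. compact_open_subgroup G T N U \<and>
     (let U' = (\<lambda>u. p \<otimes>\<^bsub>G\<^esub> u \<otimes>\<^bsub>G\<^esub> inv\<^bsub>G\<^esub> p) ` U in
        c = real (sub_index G U' (U \<inter> U')) / real (sub_index G U (U \<inter> U'))))"

text \<open>Right translation on the functions \<open>f\<close> on \<open>G\<close>, extended by \<open>0\<close> outside of \<open>carrier G\<close>, that are
  invariant on the right under an open subgroup and satisfy
  \<open>f(p g) = \<delta>(p)\<^sup>1\<^sup>/\<^sup>2 \<sigma>(p) f(g)\<close> for \<open>p \<in> P\<close>.\<close>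

definition normalized_induction ::
    "'g monoid \<Rightarrow> 'g topology \<Rightarrow> 'g set \<Rightarrow> 'g set \<Rightarrow> ('g, 'v::ab_group_add) rep
      \<Rightarrow> ('g, 'g \<Rightarrow> 'v) rep" where
  "normalized_induction G T P N \<sigma> = \<lparr>
     rscale = (\<lambda>c f x. rscale \<sigma> c (f x)),
     rspace = {f. (\<forall>g\<in>carrier G. f g \<in> rspace \<sigma>) \<and> (\<forall>g. g \<notin> carrier G \<longrightarrow> f g = 0) \<and>
       (\<forall>p\<in>P. \<forall>g\<in>carrier G.
          f (p \<otimes>\<^bsub>G\<^esub> g) = rscale \<sigma> (complex_of_real (sqrt (modulus G T N p))) (ract \<sigma> p (f g))) \<and>
       (\<exists>K. subgroup K G \<and> openin T K \<and> (\<forall>g\<in>carrier G. \<forall>k\<in>K. f (g \<otimes>\<^bsub>G\<^esub> k) = f g))},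
     ract = (\<lambda>g f x. if x \<in> carrier G then f (x \<otimes>\<^bsub>G\<^esub> g) else 0)\<rparr>"

text \<open>The standard upper triangular parabolic subgroup of \<open>GL\<^sub>3(D)\<close> with Levi subgroup
  \<open>GL\<^sub>2(D) \<times> GL\<^sub>1(D)\<close>; the projection to the Levi subgroup is \<open>g \<mapsto> (block2 g, g $ 3 $ 3)\<close>.\<close>

definition block2 :: "'d^3^3 \<Rightarrow> 'd::division_ring^2^2" where
  "block2 g = vector [vector [g$1$1, g$1$2], vector [g$2$1, g$2$2]]"

definition P21 :: "('d::division_ring^3^3) set" where
  "P21 = {g \<in> carrier GL. g$3$1 = 0 \<and> g$3$2 = 0}"

definition N21 :: "('d::division_ring^3^3) set" where
  "N21 = {g \<in> P21. block2 g = mat 1 \<and> g$3$3 = 1}"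

text \<open>The representation \<open>\<pi> \<boxtimes> \<theta>\<close> of the Levi subgroup, inflated to the parabolic subgroup.\<close>

definition levi_rep ::
    "('d::division_ring^2^2, 'v) rep \<Rightarrow> ('d \<Rightarrow> complex) \<Rightarrow> ('d^3^3, 'v) rep" where
  "levi_rep \<pi> \<theta> = \<lparr>rscale = rscale \<pi>, rspace = rspace \<pi>,
     ract = (\<lambda>g v. rscale \<pi> (\<theta> (g$3$3)) (ract \<pi> (block2 g) v))\<rparr>"

definition induced_GL3 ::
    "('f::field_char_0 \<Rightarrow> real) \<Rightarrow> ('f, 'd::division_ring) quat \<Rightarrow>
     ('d^2^2, 'v::ab_group_add) rep \<Rightarrow> ('d \<Rightarrow> complex) \<Rightarrow> ('d^3^3, 'd^3^3 \<Rightarrow> 'v) rep" where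
  "induced_GL3 absF D \<pi> \<theta> = normalized_induction GL (GL_top absF D) P21 N21 (levi_rep \<pi> \<theta>)"


section \<open>The two multiplicities\<close>

definition shalika_unip :: "'d::division_ring \<Rightarrow> 'd^2^2" where
  "shalika_unip X = vector [vector [1, X], vector [0, 1]]"

definition shalika_group :: "('d::division_ring^2^2) set" where
  "shalika_group = {mat d ** shalika_unip X | d X. d \<noteq> 0}"

text \<open>The character \<open>\<omega> \<otimes> \<xi>\<close>: the matrix \<open>diag(d,d) (1,X;0,1)\<close> has first row \<open>(d, dX)\<close>.\<close>

definition shalika_char ::
    "('f, 'd::division_ring) quat \<Rightarrow> ('f \<Rightarrow> complex) \<Rightarrow> ('f \<Rightarrow> complex) \<Rightarrow> 'd^2^2 \<Rightarrow> complex" where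
  "shalika_char D \<omega> \<psi> h = \<omega> (rnorm D (h$1$1)) * \<psi> (rtrace D (inverse (h$1$1) * h$1$2))"

definition shalika_mult ::
    "('f, 'd::division_ring) quat \<Rightarrow> ('f \<Rightarrow> complex) \<Rightarrow>
     ('d^2^2, 'v::ab_group_add) rep \<Rightarrow> ('f \<Rightarrow> complex) \<Rightarrow> enat" where
  "shalika_mult D \<psi> \<pi> \<omega> = multiplicity_of shalika_group (shalika_char D \<omega> \<psi>) \<pi>"

definition GR_unip :: "'d::division_ring \<Rightarrow> 'd \<Rightarrow> 'd \<Rightarrow> 'd^3^3" where
  "GR_unip X Y Z = vector [vector [1, X, Z], vector [0, 1, Y], vector [0, 0, 1]]"

definition GR_group :: "('d::division_ring^3^3) set" where
  "GR_group = {mat h ** GR_unip X Y Z | h X Y Z. h \<noteq> 0}"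

text \<open>The matrix \<open>diag(h,h,h) u(X,Y,Z)\<close> has the entries \<open>h\<close>, \<open>hX\<close> and \<open>hY\<close> at the places \<open>(1,1)\<close>,
  \<open>(1,2)\<close> and \<open>(2,3)\<close>.\<close>

definition GR_char ::
    "('f::plus, 'd::division_ring) quat \<Rightarrow> ('f \<Rightarrow> complex) \<Rightarrow> 'd^3^3 \<Rightarrow> complex" where
  "GR_char D \<psi> r = \<psi> (rtrace D (inverse (r$1$1) * r$1$2) + rtrace D (inverse (r$1$1) * r$2$3))"

definition GR_mult ::
    "('f::plus, 'd::division_ring) quat \<Rightarrow> ('f \<Rightarrow> complex) \<Rightarrow>
     ('d^3^3, 'v::ab_group_add) rep \<Rightarrow> enat" where
  "GR_mult D \<psi> \<rho> = multiplicity_of GR_group (GR_char D \<psi>) \<rho>"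

end

theory Submission
  imports Defs
begin

text \<open>
  Filter \<open>\<Pi>\<^sub>D\<close> by the orbits of \<open>R\<close> on \<open>P\GL\<^sub>3(D)\<close>, the space of lines spanned by the third row of a
  matrix: the open orbit \<open>[1:*:*]\<close>, the middle orbit \<open>[0:1:*]\<close> and the closed orbit \<open>[0:0:1]\<close>. On
  the last two, the stabilizers in \<open>U\<close> meet the unipotent radical of \<open>P\<close> (up to conjugation) in a
  group on which \<open>\<xi>\<^sub>R\<close> is nontrivial, while the inducing representation is trivial there. Hence
  applying operators \<open>u - 1\<close> with \<open>\<xi>\<^sub>R(u) \<noteq> 1\<close> moves every function into the subspace of those
  supported on the open orbit, and the equivariant forms on \<open>\<Pi>\<^sub>D\<close> are those on this subspace. Its
  elements are the compactly supported functions \<open>f(w u(X,0,Z))\<close> of \<open>(X,Z) \<in> D\<^sup>2\<close> with values in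
  \<open>\<pi>\<^sub>D\<close>, on which a form is an integral \<open>\<integral>\<integral> l(f(w u(X,0,Z))) \<psi>(- Tr X) dX dZ\<close> for a unique form \<open>l\<close>
  on \<open>\<pi>\<^sub>D\<close>. Equivariance under the stabilizer \<open>diag(h,h,h) u(0,Y,0)\<close> says that \<open>l\<close> is a generalized
  Shalika form.
\<close>

section \<open>The field \<open>F\<close>\<close>

text \<open>The square root \<open>\<nu>\<close> of |N| is a multiplicative ultrametric norm on
  \<open>D\<close>. Hence balls of positive radius are cosets of compact open additive groups, and
  integrals of locally constant functions with bounded support become finite sums over balls. As
  \<open>\<nu>\<close> is invariant under conjugation by \<open>h\<close>,
  \<open>diag(h,h,h)\<close> preserves these sums and has modulus 1.

  The permutation matrix \<open>wm\<close> carries the stabilizer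
  \<open>diag(h,h,h) u(0,Y,0)\<close> of the open orbit to \<open>diag(h,h,h) u(Y,0,0)\<close> in P.
  There the normalizing factor is 1, and the inducing representation is the inverse of \<omega>(N h)
  times the action of a Shalika element. This is why the inverse of \<omega> in the inducing datum
  turns invariance under \<open>diag(h,h,h)\<close> into the factor \<omega> for l.

  The smaller orbits are removed one at a time because they use different abelian normal subgroups
  of R: the \<open>u(0,Y,Z)\<close> for the closed orbit, the \<open>u(X,0,Z)\<close> for the middle
  one. The form l is read off by evaluating on functions supported on a product of two balls, whose
  radius \<open>r0\<close> makes the character \<psi>(Tr X) trivial on them.\<close>

lemma cmod_powers_near_one_imp_eq_one:
  fixes z :: complex
  assumes z: "\<And>n. cmod (z ^ n - 1) < 1/2"
  shows "z = 1"
proof (rule ccontr)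
  assume "z \<noteq> 1"
  hence pos: "cmod (z - 1) > 0" by simp
  \<comment> \<open>Squaring multiplies the distance to 1 by at least 3/2 as long as this distance
    is below 1/2, so the powers \<open>z ^ 2 ^ k\<close> of some \<open>z\<close> other than 1 would
    leave the disc.\<close>
  have step: "cmod (w\<^sup>2 - 1) \<ge> 3/2 * cmod (w - 1)" if "cmod (w - 1) < 1/2" for w :: complex
  proof -
    have "cmod (w + 1) \<ge> 2 - cmod (w - 1)"
      using norm_triangle_ineq4[of "w + 1" "w - 1"] by simp
    hence "cmod (w + 1) \<ge> 3/2" using that by linarith
    moreover have "w\<^sup>2 - 1 = (w + 1) * (w - 1)" by (simp add: algebra_simps power2_eq_square)
    ultimately show ?thesis using mult_right_mono[of "3/2" "cmod (w + 1)" "cmod (w - 1)"] by (simp add: norm_mult)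
  qed
  have grow: "cmod (z ^ (2 ^ k) - 1) \<ge> (3/2) ^ k * cmod (z - 1)" for k
  proof (induction k)
    case (Suc k)
    have "(z ^ 2 ^ k)\<^sup>2 = z ^ (2 ^ Suc k)" by (simp add: power_mult[symmetric] mult.commute)
    with step[OF z[of "2 ^ k"]] Suc show ?case by simp
  qed simp
  obtain k where "(3/2::real) ^ k > 1 / cmod (z - 1)"
    using real_arch_pow[of "3/2" "1 / cmod (z - 1)"] by auto
  hence "(3/2::real) ^ k * cmod (z - 1) > 1" using pos by (simp add: field_simps)
  with grow[of k] z[of "2 ^ k"] show False by simp
qed

context p_adic_field
begin

lemma absF_0 [simp]: "absF 0 = 0" by (simp add: abs_eq_0)

lemma absF_1 [simp]: "absF 1 = 1"
  using abs_mult[of 1 1] abs_eq_0[of 1] by simp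

lemma absF_minus [simp]: "absF (- x) = absF x"
proof -
  have "absF (- 1) * absF (- 1) = 1" using abs_mult[of "-1" "-1"] by simp
  hence "absF (- 1) = 1" using abs_nonneg[of "-1"] by (metis abs_square_eq_1 power2_eq_square abs_of_nonneg)
  thus ?thesis using abs_mult[of "-1" x] by simp
qed

lemma absF_minus_commute: "absF (x - y) = absF (y - x)"
  using absF_minus[of "x - y"] by simp

lemma absF_diff_le: "absF (x - y) \<le> max (absF x) (absF y)"
  using abs_ultra[of x "- y"] by simp

lemma absF_diff_trans: "absF (x - z) \<le> max (absF (x - y)) (absF (y - z))"
  using abs_ultra[of "x - y" "y - z"] by simp

lemma absF_pos: "x \<noteq> 0 \<Longrightarrow> 0 < absF x"
  using abs_nonneg[of x] abs_eq_0[of x] by linarith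

lemma absF_inverse: "absF (inverse x) = inverse (absF x)"
proof (cases "x = 0")
  case False
  hence "absF x * absF (inverse x) = 1" by (simp add: abs_mult[symmetric])
  thus ?thesis by (simp add: inverse_unique)
qed simp

lemma absF_divide: "absF (x / y) = absF x / absF y"
  by (simp add: divide_inverse abs_mult absF_inverse)

lemma absF_power: "absF (x ^ n) = absF x ^ n"
  by (induction n) (auto simp: abs_mult)

lemma absF_eq_if_near: "absF (x - y) < absF y \<Longrightarrow> absF x = absF y"
  using abs_ultra[of "x - y" y] absF_diff_trans[of y 0 x] absF_minus_commute[of y x] by auto

lemma absF_of_nat_le: "absF (of_nat n) \<le> 1"
proof (induction n)
  case (Suc n)
  have "absF (of_nat (Suc n)) \<le> max (absF 1) (absF (of_nat n))"
    by (simp only: of_nat_Suc abs_ultra)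
  with Suc show ?case by simp
qed simp

sublocale F: Metric_space UNIV "abs_dist absF"
proof
  fix x y z :: 'f
  show "0 \<le> abs_dist absF x y" by (simp add: abs_dist_def abs_nonneg)
  show "abs_dist absF x y = abs_dist absF y x" by (simp add: abs_dist_def absF_minus_commute)
  show "(abs_dist absF x y = 0) = (x = y)" by (simp add: abs_dist_def abs_eq_0)
  show "abs_dist absF x z \<le> abs_dist absF x y + abs_dist absF y z"
    unfolding abs_dist_def using absF_diff_trans[of x z y] abs_nonneg[of "x-y"] abs_nonneg[of "y-z"] by linarith
qed

lemma openin_field_top:
  "openin (field_top absF) U \<longleftrightarrow> (\<forall>x\<in>U. \<exists>e>0. \<forall>y. absF (y - x) < e \<longrightarrow> y \<in> U)"
  unfolding field_top_def F.openin_mtopology F.mball_def abs_dist_def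
  by (auto simp: absF_minus_commute subset_eq)

lemma topspace_field_top [simp]: "topspace (field_top absF) = UNIV"
  by (simp add: field_top_def)

lemma in_Qp_iff: "x \<in> Qp absF \<longleftrightarrow> (\<forall>e>0. \<exists>r. absF (x - of_rat r) < e)"
  unfolding Qp_def field_top_def F.metric_closure_of F.in_mball abs_dist_def Rats_def by auto

lemma of_rat_in_Qp: "of_rat r \<in> Qp absF"
  unfolding in_Qp_iff by (metis absF_0 diff_self)

lemma Qp_diff: assumes "x \<in> Qp absF" "y \<in> Qp absF" shows "x - y \<in> Qp absF"
  unfolding in_Qp_iff
proof safe
  fix e :: real assume "e > 0"
  then obtain r s where rs: "absF (x - of_rat r) < e" "absF (y - of_rat s) < e"
    using assms unfolding in_Qp_iff by blast
  have "absF (x - y - of_rat (r - s)) = absF ((x - of_rat r) - (y - of_rat s))"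
    by (simp add: of_rat_diff algebra_simps)
  also have "\<dots> < e" using absF_diff_le[of "x - of_rat r" "y - of_rat s"] rs by simp
  finally show "\<exists>r. absF (x - y - of_rat r) < e" by blast
qed

lemma Qp_0: "0 \<in> Qp absF" using of_rat_in_Qp[of 0] by simp
lemma Qp_1: "1 \<in> Qp absF" using of_rat_in_Qp[of 1] by simp

lemma Qp_add: assumes "x \<in> Qp absF" "y \<in> Qp absF" shows "x + y \<in> Qp absF"
  using Qp_diff[OF assms(1) Qp_diff[OF Qp_0 assms(2)]] by simp

lemma Qp_mult: assumes "x \<in> Qp absF" "y \<in> Qp absF" shows "x * y \<in> Qp absF"
  unfolding in_Qp_iff
proof safe
  fix e :: real assume e: "e > 0"
  obtain s where s: "absF (y - of_rat s) < e / (absF x + 1)"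
    using assms e abs_nonneg[of x] unfolding in_Qp_iff by (meson add_nonneg_pos divide_pos_pos zero_less_one)
  obtain r where r: "absF (x - of_rat r) < e / (absF (of_rat s) + 1)"
    using assms e abs_nonneg[of "of_rat s"] unfolding in_Qp_iff by (meson add_nonneg_pos divide_pos_pos zero_less_one)
  have *: "a * b < e" if "b < e / (a + 1)" "0 \<le> a" "0 \<le> b" for a b
    using that e by (simp add: field_simps)
  have "absF (x * (y - of_rat s)) < e"
    using *[OF s abs_nonneg abs_nonneg] by (simp add: abs_mult)
  moreover have "absF ((x - of_rat r) * of_rat s) < e"
    using *[OF r abs_nonneg abs_nonneg] by (simp add: abs_mult mult.commute)
  moreover have "x * y - of_rat (r * s) = x * (y - of_rat s) + (x - of_rat r) * of_rat s"
    by (simp add: of_rat_mult algebra_simps)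
  ultimately have "absF (x * y - of_rat (r * s)) < e"
    using abs_ultra[of "x * (y - of_rat s)" "(x - of_rat r) * of_rat s"] by simp
  thus "\<exists>r. absF (x * y - of_rat r) < e" by blast
qed

lemma Qp_inverse: assumes "x \<in> Qp absF" shows "inverse x \<in> Qp absF"
proof (cases "x = 0")
  case False
  show ?thesis unfolding in_Qp_iff
  proof safe
    fix e :: real assume e: "e > 0"
    \<comment> \<open>The first bound forces \<open>of_rat r\<close> to have the absolute value of
      \<open>x\<close>. The difference of the inverses then has a denominator of absolute value
      \<open>(absF x)\<close> squared, which the second bound compensates.\<close>
    let ?d = "min (absF x) (e * (absF x)\<^sup>2)"
    have "?d > 0" using e absF_pos[OF False] by simp
    then obtain r where r: "absF (x - of_rat r) < ?d" using assms unfolding in_Qp_iff by blast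
    hence ax: "absF (of_rat r) = absF x"
      using absF_eq_if_near[of "of_rat r" x] by (simp add: absF_minus_commute)
    hence r0: "of_rat r \<noteq> (0::'f)" using False abs_eq_0 by metis
    have "inverse x - of_rat (inverse r) = (of_rat r - x) / (x * of_rat r)"
      using False r0 by (simp only: of_rat_inverse of_rat_eq_0_iff) (simp add: field_simps)
    hence "absF (inverse x - of_rat (inverse r)) = absF (x - of_rat r) / (absF x)\<^sup>2"
      by (simp add: absF_divide abs_mult ax power2_eq_square absF_minus_commute)
    also have "\<dots> < e" using r absF_pos[OF False] by (simp add: pos_divide_less_eq)
    finally show "\<exists>r. absF (inverse x - of_rat r) < e" by blast
  qed
qed (simp add: Qp_0)

section \<open>Residues modulo powers of \<open>p\<close> and local compactness of
  \<open>F\<close>\<close>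

lemma absF_p: "absF (of_nat p) = 1 / real p"
proof -
  have p: "p > 1" using prime_p prime_gt_1_nat by blast
  have "absF (of_nat p) = padic_abs_rat p (of_nat p)" using abs_rat[of "of_nat p"] by simp
  moreover have "quotient_of (of_nat p) = (int p, 1)"
    using quotient_of_int[of "int p"] by (simp add: of_int_of_nat_eq)
  moreover have "multiplicity (int p) (int p) = 1"
    using p prime_p by (simp add: multiplicity_self)
  ultimately show ?thesis using p by (simp add: padic_abs_rat_def field_simps power_int_minus)
qed

lemma absF_of_int_le_p_power:
  assumes "int p ^ n dvd k" shows "absF (of_int k) \<le> (1 / real p) ^ n"
proof -
  obtain m where m: "k = int p ^ n * m" using assms by blast
  have "absF (of_int m) \<le> 1"
    by (cases m rule: int_cases2) (use absF_of_nat_le in auto)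
  thus ?thesis unfolding m by (simp add: abs_mult absF_power absF_p mult_left_le)
qed

text \<open>Bezout writes 1 as a combination of \<open>p\<close> and \<open>k\<close>. The multiple
  of \<open>p\<close> has absolute value below 1, so the multiple of \<open>k\<close> must have
  absolute value at least 1.\<close>

lemma absF_of_int_coprime:
  assumes "\<not> int p dvd k" shows "absF (of_int k) = 1"
proof -
  have "coprime (int p) k" using assms prime_p by (simp add: prime_imp_coprime)
  then obtain u v where "u * int p + v * k = 1"
    by (metis bezout_int coprime_imp_gcd_eq_1)
  hence "1 = of_int u * of_nat p + of_int v * (of_int k :: 'f)"
    by (metis of_int_1 of_int_add of_int_mult of_int_of_nat_eq)
  hence "1 \<le> max (absF (of_int u) * absF (of_nat p)) (absF (of_int v) * absF (of_int k))"
    using abs_ultra[of "of_int u * of_nat p" "of_int v * of_int k"] by (simp add: abs_mult)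
  moreover have le: "absF (of_int m) \<le> 1" for m using absF_of_int_le_p_power[of 0 m] by simp
  moreover have "absF (of_int u) * absF (of_nat p) < 1"
  proof -
    have "absF (of_nat p) < 1" using absF_p prime_gt_1_nat[OF prime_p] by simp
    thus ?thesis using le[of u] by (smt (verit) abs_nonneg mult_left_le_one_le)
  qed
  ultimately have "1 \<le> absF (of_int v) * absF (of_int k)" by simp
  also have "\<dots> \<le> absF (of_int k)" using le[of v] by (simp add: abs_nonneg mult_left_le_one_le)
  finally show ?thesis using le[of k] by simp
qed

text \<open>The denominator of an integral rational is prime to \<open>p\<close>, hence invertible
  modulo \<open>p ^ n\<close>, and the residue of the fraction is the approximating number. The
  bound \<open>m < p ^ n\<close> makes the residues a finite net.\<close>

lemma of_rat_near_nat:
  assumes "absF (of_rat r) \<le> 1"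
  shows "\<exists>m<p ^ n. absF (of_rat r - of_nat m) \<le> (1 / real p) ^ n"
proof -
  have p: "p > 1" using prime_p prime_gt_1_nat by blast
  obtain a b where ab: "quotient_of r = (a, b)" by force
  hence cop: "coprime a b" and bpos: "b > 0" and rab: "r = of_int a / of_int b"
    using quotient_of_coprime quotient_of_denom_pos quotient_of_div by auto
  have rF: "of_rat r = (of_int a / of_int b :: 'f)" using rab by (simp add: of_rat_divide)
  have nb: "\<not> int p dvd b"
  proof
    assume pb: "int p dvd b"
    hence "\<not> int p dvd a" using cop p coprime_common_divisor[of a b "int p"] by auto
    hence "absF (of_int a) = 1" by (rule absF_of_int_coprime)
    moreover have "absF (of_int b) < 1"
      using absF_of_int_le_p_power[of 1 b] pb p by (simp add: order_le_less_trans)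
    moreover have "absF (of_int b) > 0" using bpos by (intro absF_pos) simp
    ultimately have "absF (of_rat r) > 1" by (simp add: rF absF_divide)
    with assms show False by simp
  qed
  hence "coprime (int p ^ n) b" using prime_p by (simp add: prime_imp_coprime)
  then obtain u v where uv: "u * int p ^ n + v * b = 1"
    by (metis bezout_int coprime_imp_gcd_eq_1)
  define m where "m = (a * v) mod (int p ^ n)"
  have m: "0 \<le> m" "m < int p ^ n" using p by (auto simp: m_def)
  have "int p ^ n dvd (a * v - m)" by (simp add: m_def)
  hence "int p ^ n dvd (a * v - m) * b + a * u * int p ^ n" by simp
  moreover have "(a * v - m) * b + a * u * int p ^ n = a - m * b"
    using uv by (simp add: algebra_simps) (metis distrib_left mult.left_commute mult.right_neutral add.commute)
  ultimately have dv: "int p ^ n dvd a - m * b" by simp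
  have b1: "absF (of_int b) = 1" using nb by (rule absF_of_int_coprime)
  have "of_rat r - of_nat (nat m) = (of_int (a - m * b) / of_int b :: 'f)"
    using bpos m by (simp add: rF field_simps)
  hence "absF (of_rat r - of_nat (nat m)) \<le> (1 / real p) ^ n"
    using absF_of_int_le_p_power[OF dv] b1 by (simp add: absF_divide)
  moreover have "nat m < p ^ n" using m p by (simp add: nat_less_iff)
  ultimately show ?thesis by blast
qed

text \<open>Limits are required to lie in \<open>W\<close>, so the notion includes that
  \<open>W\<close> is closed in \<open>F\<close>. This is what lets the induction over generators of
  \<open>F\<close> proceed.\<close>

definition seq_compact_balls :: "'f set \<Rightarrow> bool" where
  "seq_compact_balls W \<longleftrightarrow> (\<forall>x R. (\<forall>n::nat. x n \<in> W \<and> absF (x n) \<le> R) \<longrightarrow>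
     (\<exists>a\<in>W. \<exists>s. strict_mono s \<and> (\<lambda>n. absF (x (s n) - a)) \<longlonglongrightarrow> 0))"

lemma seq_compact_ballsD:
  assumes "seq_compact_balls W" "\<And>n::nat. x n \<in> W" "\<And>n. absF (x n) \<le> R"
  shows "\<exists>a s. a \<in> W \<and> strict_mono s \<and> (\<lambda>n. absF (x (s n) - a)) \<longlonglongrightarrow> 0"
  using assms unfolding seq_compact_balls_def by blast

lemma Qp_Cauchy_convergent:
  assumes "\<And>n. x n \<in> Qp absF"
    and "\<And>e. e > 0 \<Longrightarrow> \<exists>N. \<forall>m\<ge>N. \<forall>n\<ge>N. absF (x m - x n) < e"
  shows "\<exists>a\<in>Qp absF. (\<lambda>n. absF (x n - a)) \<longlonglongrightarrow> 0"
proof -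
  interpret Q: Metric_space "Qp absF" "abs_dist absF" by (rule F.subspace) simp
  have "Q.MCauchy x" unfolding Q.MCauchy_def abs_dist_def using assms by blast
  then obtain a where "limitin Q.mtopology x a sequentially"
    using Qp_complete Q.mcomplete_def by blast
  thus ?thesis unfolding Q.limitin_metric_dist_null by (auto simp: abs_dist_def)
qed

text \<open>A power of \<open>p\<close> scales the sequence into the unit ball, which is totally
  bounded by the finite nets of residues. Completeness then gives a limit for the Cauchy
  subsequence.\<close>

lemma seq_compact_balls_Qp: "seq_compact_balls (Qp absF)"
  unfolding seq_compact_balls_def
proof (intro allI impI)
  fix x :: "nat \<Rightarrow> 'f" and R
  assume x: "\<forall>n. x n \<in> Qp absF \<and> absF (x n) \<le> R"
  have p: "p > 1" using prime_p prime_gt_1_nat by blast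
  have p0: "of_nat p \<noteq> (0::'f)" using p by simp
  obtain k where "real p ^ k > R" using real_arch_pow[of "real p" R] p by auto
  define y where "y n = of_nat p ^ k * x n" for n
  have y1: "absF (y n) \<le> 1" for n
  proof -
    have "absF (y n) = absF (x n) / real p ^ k" by (simp add: y_def abs_mult absF_power absF_p power_one_over)
    also have "\<dots> \<le> 1" using x \<open>real p ^ k > R\<close> p by (simp add: divide_le_eq_1) (meson less_eq_real_def order_trans)
    finally show ?thesis .
  qed
  have pQ: "of_nat p \<in> Qp absF" using of_rat_in_Qp[of "of_nat p"] by simp
  have "of_nat p ^ k \<in> Qp absF" by (induction k) (auto simp: Qp_1 Qp_mult pQ)
  hence yQ: "y n \<in> Qp absF" for n using x by (simp add: y_def Qp_mult)
  have near: "\<exists>m<p ^ n. absF (z - of_nat m) \<le> (1 / real p) ^ n" if z: "z \<in> Qp absF" "absF z \<le> 1" for z n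
  proof -
    have "(1 / real p) ^ n > 0" using p by simp
    then obtain r where r: "absF (z - of_rat r) < min 1 ((1 / real p) ^ n)"
      using z(1) unfolding in_Qp_iff by (metis min_less_iff_conj zero_less_one)
    have "absF (of_rat r) \<le> 1"
      using absF_diff_trans[of "of_rat r" 0 z] r z(2) absF_minus_commute[of "of_rat r" z] by auto
    then obtain m where m: "m < p ^ n" "absF (of_rat r - of_nat m) \<le> (1 / real p) ^ n"
      using of_rat_near_nat by blast
    have "absF (z - of_nat m) \<le> (1 / real p) ^ n"
      using absF_diff_trans[of z "of_nat m" "of_rat r"] r m by auto
    thus ?thesis using m(1) by blast
  qed
  define Z where "Z = {z \<in> Qp absF. absF z \<le> 1}"
  have natZ: "of_nat m \<in> Z" for m
    using of_rat_in_Qp[of "of_nat m"] by (simp add: Z_def absF_of_nat_le)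
  have "F.mtotally_bounded Z"
    unfolding F.mtotally_bounded_def
  proof safe
    fix e :: real assume e: "e > 0"
    obtain n where n: "(1 / real p) ^ n < e" using real_arch_pow_inv[of e "1 / real p"] e p by auto
    have "Z \<subseteq> (\<Union>m\<in>{..<p ^ n}. F.mball (of_nat m) e)"
    proof
      fix z assume "z \<in> Z"
      then obtain m where "m < p ^ n" "absF (z - of_nat m) \<le> (1 / real p) ^ n"
        using near unfolding Z_def by blast
      thus "z \<in> (\<Union>m\<in>{..<p ^ n}. F.mball (of_nat m) e)"
        using n absF_minus_commute[of z "of_nat m"] by (auto simp: abs_dist_def intro!: bexI[of _ m])
    qed
    thus "\<exists>K. finite K \<and> K \<subseteq> Z \<and> Z \<subseteq> (\<Union>x\<in>K. F.mball x e)"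
      using natZ by (intro exI[of _ "of_nat ` {..<p ^ n}"]) auto
  qed
  moreover have "range y \<subseteq> Z" using yQ y1 by (auto simp: Z_def)
  ultimately obtain s where s: "strict_mono s" "F.MCauchy (y \<circ> s)"
    unfolding F.mtotally_bounded_sequentially by blast
  hence "\<exists>a\<in>Qp absF. (\<lambda>n. absF ((y \<circ> s) n - a)) \<longlonglongrightarrow> 0"
    using yQ by (intro Qp_Cauchy_convergent) (auto simp: F.MCauchy_def abs_dist_def)
  then obtain a where a: "a \<in> Qp absF" "(\<lambda>n. absF (y (s n) - a)) \<longlonglongrightarrow> 0" by auto
  define b where "b = a / of_nat p ^ k"
  have "x n - b = (y n - a) / of_nat p ^ k" for n using p0 by (simp add: y_def b_def field_simps)
  hence "(\<lambda>n. absF (x (s n) - b)) = (\<lambda>n. absF (y (s n) - a) / absF (of_nat p ^ k))"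
    by (simp add: absF_divide)
  moreover have "(\<lambda>n. absF (y (s n) - a) / absF (of_nat p ^ k)) \<longlonglongrightarrow> 0"
    using tendsto_divide[OF a(2) tendsto_const, of "absF (of_nat p ^ k)"] p0 abs_eq_0 by auto
  moreover have "b \<in> Qp absF" unfolding b_def divide_inverse
    by (intro Qp_mult a Qp_inverse \<open>of_nat p ^ k \<in> Qp absF\<close>)
  ultimately show "\<exists>a\<in>Qp absF. \<exists>s. strict_mono s \<and> (\<lambda>n. absF (x (s n) - a)) \<longlonglongrightarrow> 0"
    using s(1) by (intro bexI[of _ b] exI[of _ s]) simp_all
qed

lemma absF_tendsto_bound:
  assumes "(\<lambda>n. absF (x n - a)) \<longlonglongrightarrow> 0" "\<And>n. absF (x n) \<le> R" shows "absF a \<le> R"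
proof (rule ccontr)
  assume "\<not> absF a \<le> R"
  hence R: "absF a > R" "absF a > 0" using assms(2)[of 0] abs_nonneg[of "x 0"] by auto
  hence "eventually (\<lambda>n. absF (x n - a) < absF a) sequentially" using order_tendstoD(2)[OF assms(1)] by blast
  then obtain n where "absF (x n - a) < absF a" by (auto simp: eventually_sequentially)
  hence "absF (x n) = absF a" by (rule absF_eq_if_near)
  with R assms(2)[of n] show False by simp
qed

lemma absF_tendsto_add:
  assumes "(\<lambda>n. absF (x n - a)) \<longlonglongrightarrow> 0" "(\<lambda>n. absF (y n - b)) \<longlonglongrightarrow> 0"
  shows "(\<lambda>n. absF (x n + y n - (a + b))) \<longlonglongrightarrow> 0"
proof (rule tendsto_sandwich[OF _ _ tendsto_const])
  show "\<forall>\<^sub>F n in sequentially. 0 \<le> absF (x n + y n - (a + b))" by (simp add: abs_nonneg)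
  show "\<forall>\<^sub>F n in sequentially. absF (x n + y n - (a + b)) \<le> max (absF (x n - a)) (absF (y n - b))"
    using abs_ultra[of "x _ - a" "y _ - b"] by (auto simp: algebra_simps)
  show "(\<lambda>n. max (absF (x n - a)) (absF (y n - b))) \<longlonglongrightarrow> 0"
    using tendsto_max[OF assms] by simp
qed

lemma absF_tendsto_mult:
  assumes "(\<lambda>n. absF (x n - a)) \<longlonglongrightarrow> 0" "(\<lambda>n. absF (y n - b)) \<longlonglongrightarrow> 0" "\<And>n. absF (x n) \<le> R"
  shows "(\<lambda>n. absF (x n * y n - a * b)) \<longlonglongrightarrow> 0"
proof (rule tendsto_sandwich[OF _ _ tendsto_const])
  let ?u = "\<lambda>n. max (R * absF (y n - b)) (absF (x n - a) * absF b)"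
  show "\<forall>\<^sub>F n in sequentially. 0 \<le> absF (x n * y n - a * b)" by (simp add: abs_nonneg)
  show "\<forall>\<^sub>F n in sequentially. absF (x n * y n - a * b) \<le> ?u n"
  proof (intro always_eventually allI)
    fix n
    have "x n * y n - a * b = x n * (y n - b) + (x n - a) * b" by (simp add: algebra_simps)
    hence "absF (x n * y n - a * b) \<le> max (absF (x n) * absF (y n - b)) (absF (x n - a) * absF b)"
      using abs_ultra by (metis abs_mult)
    also have "\<dots> \<le> ?u n" using assms(3)[of n] abs_nonneg[of "y n - b"]
      by (intro max.mono mult_right_mono) (auto simp: abs_nonneg)
    finally show "absF (x n * y n - a * b) \<le> ?u n" .
  qed
  show "?u \<longlonglongrightarrow> 0"
    using tendsto_max[OF tendsto_mult[OF tendsto_const assms(2), of R] tendsto_mult[OF assms(1) tendsto_const, of "absF b"]]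
    by simp
qed

text \<open>If \<open>b\<close> is not in \<open>W\<close>, it has a positive distance \<delta> from
  \<open>W\<close>, as \<open>W\<close> is closed. Then \<open>c * b + w\<close> has absolute value
  at least \<delta> times that of \<open>c\<close>, so a bounded sequence has bounded components and
  both can be made to converge.\<close>

lemma seq_compact_balls_extend:
  assumes W: "seq_compact_balls W" "0 \<in> W" "\<And>x y. x \<in> W \<Longrightarrow> y \<in> W \<Longrightarrow> x + y \<in> W"
    "\<And>c x. c \<in> Qp absF \<Longrightarrow> x \<in> W \<Longrightarrow> c * x \<in> W"
  shows "seq_compact_balls {c * b + w | c w. c \<in> Qp absF \<and> w \<in> W}"
proof (cases "b \<in> W")
  case True
  have "{c * b + w | c w. c \<in> Qp absF \<and> w \<in> W} = W"
  proof safe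
    fix w assume "w \<in> W"
    thus "\<exists>c w'. w = c * b + w' \<and> c \<in> Qp absF \<and> w' \<in> W" using Qp_0 by (metis add_0 mult_zero_left)
  qed (use True W in auto)
  with W(1) show ?thesis by simp
next
  case False
  have "\<exists>\<delta>>0. \<forall>w\<in>W. absF (b + w) \<ge> \<delta>"
  proof (rule ccontr)
    assume "\<not> ?thesis"
    hence small: "\<exists>w. w \<in> W \<and> absF (b + w) < e" if "e > 0" for e
      using that by (meson not_le)
    have "\<exists>w. w \<in> W \<and> absF (b + w) < inverse (real (Suc n))" for n by (rule small) simp
    then obtain w where w: "\<And>n. w n \<in> W" "\<And>n. absF (b + w n) < inverse (real (Suc n))" by metis
    have m1: "- 1 \<in> Qp absF" using Qp_diff[OF Qp_0 Qp_1] by simp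
    define v where "v n = - w n" for n
    have v: "v n \<in> W" for n using W(4)[OF m1 w(1)] by (simp add: v_def)
    have vb: "absF (v n - b) < inverse (real (Suc n))" for n
      using w(2)[of n] absF_minus_commute[of "- w n" b] by (simp add: v_def)
    have "absF (v n) \<le> max 1 (absF b)" for n
    proof -
      have "inverse (real (Suc n)) \<le> 1" by (simp add: field_simps)
      thus ?thesis using vb[of n] abs_ultra[of "v n - b" b] by auto
    qed
    from seq_compact_ballsD[of W v, OF W(1) v this] obtain a s
      where a: "a \<in> W" "strict_mono s" "(\<lambda>n. absF (v (s n) - a)) \<longlonglongrightarrow> 0" by blast
    have "absF (b - a) \<le> 0"
    proof (rule field_le_epsilon)
      fix e :: real assume e: "e > 0"
      have "eventually (\<lambda>n. absF (v (s n) - a) < e) sequentially" using order_tendstoD(2)[OF a(3)] e by blast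
      moreover have "eventually (\<lambda>n. inverse (real (Suc n)) < e) sequentially"
        using order_tendstoD(2)[OF LIMSEQ_inverse_real_of_nat] e by blast
      ultimately have "eventually (\<lambda>n. absF (v (s n) - a) < e \<and> inverse (real (Suc n)) < e) sequentially"
        by (rule eventually_conj)
      then obtain n where n: "absF (v (s n) - a) < e" "inverse (real (Suc n)) < e"
        by (auto simp: eventually_sequentially)
      have "s n \<ge> n" using a(2) by (rule seq_suble)
      hence "inverse (real (Suc (s n))) \<le> inverse (real (Suc n))" by (simp add: field_simps)
      hence "absF (v (s n) - b) < e" using vb[of "s n"] n(2) by linarith
      thus "absF (b - a) \<le> 0 + e"
        using absF_diff_trans[of b a "v (s n)"] n(1) by (simp add: absF_minus_commute)
    qed
    hence "b = a" using abs_eq_0[of "b - a"] abs_nonneg[of "b - a"] by simp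
    with a(1) False show False by simp
  qed
  then obtain \<delta> where \<delta>: "\<delta> > 0" "\<And>w. w \<in> W \<Longrightarrow> absF (b + w) \<ge> \<delta>" by blast
  have lower: "absF c * \<delta> \<le> absF (c * b + w)" if "c \<in> Qp absF" "w \<in> W" for c w
  proof (cases "c = 0")
    case False
    have "c * b + w = c * (b + inverse c * w)" using False by (simp add: algebra_simps)
    thus ?thesis using \<delta>(2)[OF W(4)[OF Qp_inverse[OF that(1)] that(2)]]
      by (simp add: abs_mult mult_left_mono abs_nonneg)
  qed (simp add: abs_nonneg)
  show ?thesis unfolding seq_compact_balls_def
  proof (intro allI impI)
    fix x :: "nat \<Rightarrow> 'f" and R
    assume x: "\<forall>n. x n \<in> {c * b + w | c w. c \<in> Qp absF \<and> w \<in> W} \<and> absF (x n) \<le> R"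
    then obtain c w where cw: "\<And>n. x n = c n * b + w n" "\<And>n. c n \<in> Qp absF" "\<And>n. w n \<in> W"
      by simp metis
    have cR: "absF (c n) \<le> R / \<delta>" for n
      using lower[OF cw(2,3), of n n] x cw(1) \<delta>(1) by (simp add: pos_le_divide_eq) (meson order_trans)
    from seq_compact_ballsD[of "Qp absF" c, OF seq_compact_balls_Qp cw(2) cR] obtain c' s
      where s: "c' \<in> Qp absF" "strict_mono s" "(\<lambda>n. absF (c (s n) - c')) \<longlonglongrightarrow> 0" by blast
    have "absF (w n) \<le> max R (R / \<delta> * absF b)" for n
    proof -
      have "w n = x n - c n * b" using cw(1) by simp
      hence "absF (w n) \<le> max (absF (x n)) (absF (c n) * absF b)" using absF_diff_le by (metis abs_mult)
      also have "\<dots> \<le> max R (R / \<delta> * absF b)" using x cR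
        by (intro max.mono mult_right_mono) (auto simp: abs_nonneg)
      finally show ?thesis .
    qed
    from seq_compact_ballsD[of W "\<lambda>n. w (s n)", OF W(1) cw(3) this] obtain w' t
      where t: "w' \<in> W" "strict_mono t" "(\<lambda>n. absF (w (s (t n)) - w')) \<longlonglongrightarrow> 0" by blast
    have "(\<lambda>n. absF (c (s (t n)) - c')) \<longlonglongrightarrow> 0"
      using LIMSEQ_subseq_LIMSEQ[OF s(3) t(2)] by (simp add: o_def)
    hence "(\<lambda>n. absF (c (s (t n)) * b - c' * b)) \<longlonglongrightarrow> 0"
      by (rule absF_tendsto_mult[where y = "\<lambda>_. b" and b = b]) (use cR in auto)
    from absF_tendsto_add[OF this t(3)]
    have "(\<lambda>n. absF (x ((s \<circ> t) n) - (c' * b + w'))) \<longlonglongrightarrow> 0" by (simp add: cw(1))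
    moreover have "strict_mono (s \<circ> t)" using s(2) t(2) by (rule strict_mono_o)
    ultimately show "\<exists>a\<in>{c * b + w |c w. c \<in> Qp absF \<and> w \<in> W}. \<exists>s. strict_mono s \<and> (\<lambda>n. absF (x (s n) - a)) \<longlonglongrightarrow> 0"
      using s(1) t(1) by blast
  qed
qed

text \<open>Induction over a finite set generating \<open>F\<close> over its closed subfield
  \<open>Qp absF\<close>. Linear dependence among generators is harmless: a dependent one falls
  under the case \<open>b \<in> W\<close> of the extension lemma.\<close>

lemma bounded_imp_convergent_subsequence:
  assumes "\<And>n::nat. absF (x n) \<le> R"
  shows "\<exists>a s. strict_mono s \<and> (\<lambda>n. absF (x (s n) - a)) \<longlonglongrightarrow> 0"
proof -
  define span where "span B = {\<Sum>b\<in>B. c b * b | c. \<forall>b\<in>B. c b \<in> Qp absF}" for B :: "'f set"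
  have "seq_compact_balls (span B) \<and> 0 \<in> span B" if "finite B" for B
    using that
  proof induction
    case empty
    have "span {} = {0}" by (simp add: span_def)
    moreover have "seq_compact_balls {0}" unfolding seq_compact_balls_def
      by (auto intro: exI[of _ id] simp: strict_mono_def)
    ultimately show ?case by simp
  next
    case (insert b B)
    have "span (insert b B) = {c * b + w | c w. c \<in> Qp absF \<and> w \<in> span B}" (is "_ = ?R")
    proof safe
      fix x assume "x \<in> span (insert b B)"
      then obtain c where "\<forall>b\<in>insert b B. c b \<in> Qp absF" "x = (\<Sum>b\<in>insert b B. c b * b)"
        unfolding span_def by blast
      thus "\<exists>c w. x = c * b + w \<and> c \<in> Qp absF \<and> w \<in> span B"
        using insert by (auto simp: span_def)
    next
      fix c w assume c: "c \<in> Qp absF" and "w \<in> span B"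
      then obtain c' where c': "\<forall>b\<in>B. c' b \<in> Qp absF" "w = (\<Sum>b\<in>B. c' b * b)" unfolding span_def by blast
      have "(\<Sum>b'\<in>B. (c'(b := c)) b' * b') = w" unfolding c'(2)
        by (rule sum.cong) (use insert in auto)
      thus "c * b + w \<in> span (insert b B)" unfolding span_def using insert c c'(1)
        by (intro CollectI exI[of _ "c'(b := c)"]) auto
    qed
    moreover have "seq_compact_balls ?R"
    proof (rule seq_compact_balls_extend)
      show "seq_compact_balls (span B)" "0 \<in> span B" using insert by auto
      show "x + y \<in> span B" if "x \<in> span B" "y \<in> span B" for x y
      proof -
        from that obtain c d where "\<forall>b\<in>B. c b \<in> Qp absF" "x = (\<Sum>b\<in>B. c b * b)"
          "\<forall>b\<in>B. d b \<in> Qp absF" "y = (\<Sum>b\<in>B. d b * b)" unfolding span_def by blast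
        thus ?thesis unfolding span_def
          by (intro CollectI exI[of _ "\<lambda>b. c b + d b"]) (auto simp: Qp_add sum.distrib distrib_right)
      qed
      show "c * x \<in> span B" if "c \<in> Qp absF" "x \<in> span B" for c x
      proof -
        from that obtain d where "\<forall>b\<in>B. d b \<in> Qp absF" "x = (\<Sum>b\<in>B. d b * b)" unfolding span_def by blast
        thus ?thesis unfolding span_def using that(1)
          by (intro CollectI exI[of _ "\<lambda>b. c * d b"]) (auto simp: Qp_mult sum_distrib_left mult.assoc)
      qed
    qed
    moreover have "0 \<in> ?R" using insert Qp_0 by force
    ultimately show ?case by simp
  qed
  moreover obtain B where B: "finite B" "\<forall>x. \<exists>c. (\<forall>b\<in>B. c b \<in> Qp absF) \<and> x = (\<Sum>b\<in>B. c b * b)"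
    using finite_extension by blast
  moreover have "x n \<in> span B" for n using B(2) unfolding span_def by blast
  ultimately show ?thesis using seq_compact_ballsD[of "span B" x R] assms by metis
qed

lemma compactin_absF_ball: "compactin (field_top absF) {x. absF x \<le> R}"
  unfolding field_top_def F.compactin_sequentially
proof (intro conjI allI impI)
  fix \<sigma> :: "nat \<Rightarrow> 'f" assume "range \<sigma> \<subseteq> {x. absF x \<le> R}"
  hence R: "absF (\<sigma> n) \<le> R" for n by auto
  obtain a s where a: "strict_mono s" "(\<lambda>n. absF (\<sigma> (s n) - a)) \<longlonglongrightarrow> 0"
    using bounded_imp_convergent_subsequence R by blast
  moreover have "absF a \<le> R" using absF_tendsto_bound[OF a(2)] R by blast
  ultimately show "\<exists>l r. l \<in> {x. absF x \<le> R} \<and> strict_mono r \<and> limitin F.mtopology (\<sigma> \<circ> r) l sequentially"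
    unfolding F.limitin_metric_dist_null by (intro exI[of _ a] exI[of _ s]) (auto simp: abs_dist_def)
qed simp

section \<open>Characters of \<open>F\<close> are locally trivial\<close>

lemma additive_character_trivial_near_0:
  assumes "nontrivial_additive_character absF \<psi>"
  shows "\<exists>e>0. \<forall>x. absF x \<le> e \<longrightarrow> \<psi> x = 1"
proof -
  from assms have add: "\<psi> (x + y) = \<psi> x * \<psi> y" and one: "cmod (\<psi> x) = 1"
    and cont: "continuous_map (field_top absF) euclidean \<psi>" for x y
    unfolding nontrivial_additive_character_def by auto
  have \<psi>0: "\<psi> 0 = 1" using add[of 0 0] one[of 0] by (metis add_0 mult_cancel_right1 norm_zero zero_neq_one)
  have "openin (field_top absF) {x \<in> topspace (field_top absF). \<psi> x \<in> ball 1 (1/2)}"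
    using cont by (rule openin_continuous_map_preimage) simp
  hence "\<exists>e>0. \<forall>y. absF (y - 0) < e \<longrightarrow> y \<in> {x \<in> topspace (field_top absF). \<psi> x \<in> ball 1 (1/2)}"
    unfolding openin_field_top by (rule bspec) (simp add: \<psi>0)
  then obtain e where e: "e > 0" "\<And>x. absF x < e \<Longrightarrow> dist 1 (\<psi> x) < 1/2" by auto
  show ?thesis
  proof (intro exI[of _ "e/2"] conjI allI impI)
    fix x assume x: "absF x \<le> e/2"
    \<comment> \<open>Integers have absolute value at most 1, so all multiples of \<open>x\<close>
      stay in the ball and all powers of \<open>\<psi> x\<close> stay near 1. The circle has no
      small subgroups.\<close>
    have pw: "\<psi> x ^ n = \<psi> (of_nat n * x)" for n
      by (induction n) (auto simp: \<psi>0 add distrib_right)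
    show "\<psi> x = 1"
    proof (rule cmod_powers_near_one_imp_eq_one)
      fix n
      have "absF (of_nat n * x) \<le> absF x"
        using absF_of_nat_le[of n] by (simp add: abs_mult abs_nonneg mult_left_le_one_le)
      thus "cmod (\<psi> x ^ n - 1) < 1/2" using x e by (simp add: pw dist_norm norm_minus_commute)
    qed
  qed (use e in simp)
qed

lemma unitary_character_trivial_near_1:
  assumes "unitary_character absF \<omega>"
  shows "\<exists>e>0. \<forall>x. absF (x - 1) \<le> e \<longrightarrow> \<omega> x = 1"
proof -
  from assms have mult: "x \<noteq> 0 \<Longrightarrow> y \<noteq> 0 \<Longrightarrow> \<omega> (x * y) = \<omega> x * \<omega> y" and one: "x \<noteq> 0 \<Longrightarrow> cmod (\<omega> x) = 1"
    and cont: "continuous_map (subtopology (field_top absF) (- {0})) euclidean \<omega>" for x y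
    unfolding unitary_character_def by auto
  have \<omega>1: "\<omega> 1 = 1" using mult[of 1 1] one[of 1] by (metis mult_1 mult_cancel_right1 norm_zero zero_neq_one)
  have "openin (subtopology (field_top absF) (- {0}))
      {x \<in> topspace (subtopology (field_top absF) (- {0})). \<omega> x \<in> ball 1 (1/2)}"
    using cont by (rule openin_continuous_map_preimage) simp
  then obtain T where T: "openin (field_top absF) T" "{x. x \<noteq> 0 \<and> \<omega> x \<in> ball 1 (1/2)} = T \<inter> - {0}"
    unfolding openin_subtopology by auto
  have "1 \<in> T" using T(2) \<omega>1 by (metis (mono_tags, lifting) IntD1 centre_in_ball mem_Collect_eq half_gt_zero_iff zero_less_one zero_neq_one)
  then obtain e where e: "e > 0" "\<And>x. absF (x - 1) < e \<Longrightarrow> x \<in> T"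
    using T(1) unfolding openin_field_top by blast
  \<comment> \<open>A radius below 1 makes the ball around 1 consist of elements of absolute value
    1, so it is closed under powers; a radius below \<open>e\<close> keeps it inside
    \<open>T\<close>.\<close>
  define d where "d = min (e/2) (1/2)"
  show ?thesis
  proof (intro exI[of _ d] conjI allI impI)
    fix x assume x: "absF (x - 1) \<le> d"
    have unit: "absF y = 1" if "absF (y - 1) \<le> d" for y
      using absF_eq_if_near[of y 1] that by (simp add: d_def)
    hence nz: "y \<noteq> 0" if "absF (y - 1) \<le> d" for y using that by fastforce
    have pn: "absF (x ^ n - 1) \<le> d" for n
    proof (induction n)
      case (Suc n)
      have "x ^ Suc n - 1 = x * (x ^ n - 1) + (x - 1)" by (simp add: algebra_simps)
      hence "absF (x ^ Suc n - 1) \<le> max (absF (x * (x ^ n - 1))) (absF (x - 1))" using abs_ultra by metis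
      thus ?case using Suc x unit[OF x] by (simp add: abs_mult)
    qed (use e in \<open>auto simp: d_def\<close>)
    have pw: "\<omega> x ^ n = \<omega> (x ^ n)" for n
      using mult[OF nz[OF x] nz[OF pn]] by (induction n) (auto simp: \<omega>1)
    show "\<omega> x = 1"
    proof (rule cmod_powers_near_one_imp_eq_one)
      fix n
      have "absF (x ^ n - 1) < e" using pn[of n] e by (auto simp: d_def min_def split: if_splits)
      hence "x ^ n \<in> T" by (rule e)
      hence "\<omega> (x ^ n) \<in> ball 1 (1/2)" using T(2) nz[OF pn] by blast
      thus "cmod (\<omega> x ^ n - 1) < 1/2" by (simp add: pw dist_norm norm_minus_commute)
    qed
  qed (use e in \<open>simp add: d_def\<close>)
qed

end

section \<open>The norm of the quaternion algebra\<close>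

lemma compactin_pullback_topology:
  assumes "S \<subseteq> A" "compactin T (f ` S)"
  shows "compactin (pullback_topology A f T) S"
  unfolding compactin_def
proof safe
  fix x assume "x \<in> S"
  thus "x \<in> topspace (pullback_topology A f T)"
    using assms compactin_subset_topspace[OF assms(2)] by (auto simp: topspace_pullback_topology)
next
  fix \<U> assume U: "\<forall>U\<in>\<U>. openin (pullback_topology A f T) U" and cover: "S \<subseteq> \<Union>\<U>"
  then obtain V where V: "\<And>U. U \<in> \<U> \<Longrightarrow> openin T (V U) \<and> U = f -` V U \<inter> A"
    unfolding openin_pullback_topology by metis
  have "f ` S \<subseteq> \<Union>(V ` \<U>)"
  proof clarify
    fix x assume "x \<in> S"
    then obtain U where "U \<in> \<U>" "x \<in> U" using cover by blast
    thus "f x \<in> \<Union>(V ` \<U>)" using V[of U] by blast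
  qed
  then obtain \<F> where F: "finite \<F>" "\<F> \<subseteq> V ` \<U>" "f ` S \<subseteq> \<Union>\<F>"
    using assms(2) V unfolding compactin_def by (metis (mono_tags, lifting) image_iff)
  then obtain \<G> where G: "\<G> \<subseteq> \<U>" "finite \<G>" "\<F> = V ` \<G>"
    using finite_subset_image by metis
  have "S \<subseteq> \<Union>\<G>"
  proof
    fix x assume x: "x \<in> S"
    then obtain U where "U \<in> \<G>" "f x \<in> V U" using F(3) G(3) by blast
    thus "x \<in> \<Union>\<G>" using V[of U] G(1) x assms(1) by blast
  qed
  thus "\<exists>\<F>. finite \<F> \<and> \<F> \<subseteq> \<U> \<and> S \<subseteq> \<Union>\<F>" using G by blast
qed

section \<open>Coordinates, conjugation, reduced trace and reduced norm\<close>

context nonsplit_quaternion_algebra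
begin

definition emb :: "'f \<Rightarrow> 'd" where "emb c = qscale D c 1"

abbreviation cr :: "'d \<Rightarrow> 4 \<Rightarrow> 'f" where "cr x k \<equiv> qcoord D x $ k"

text \<open>The record does not store the constants of the quaternion algebra
  \<open>(a,b/F)\<close>; \<open>sqi\<close> and \<open>sqj\<close> are choices of \<open>a\<close>
  and \<open>b\<close>.\<close>

definition sqi :: 'f where "sqi = (SOME a. a \<noteq> 0 \<and> qi D * qi D = qscale D a 1)"
definition sqj :: 'f where "sqj = (SOME b. b \<noteq> 0 \<and> qj D * qj D = qscale D b 1)"

lemma qi_sq: "sqi \<noteq> 0" "qi D * qi D = emb sqi"
  using someI_ex[OF qi_square] by (auto simp: sqi_def emb_def)
lemma qj_sq: "sqj \<noteq> 0" "qj D * qj D = emb sqj"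
  using someI_ex[OF qj_square] by (auto simp: sqj_def emb_def)

lemma qscale_eq: "qscale D c x = emb c * x"
  by (simp add: emb_def scale_mult_left)

lemma emb_central: "x * emb c = emb c * x"
  by (simp add: emb_def scale_mult_left scale_mult_right)

lemma emb_0 [simp]: "emb 0 = 0" and emb_1 [simp]: "emb 1 = 1"
  and emb_add: "emb (c + d) = emb c + emb d" and emb_mult: "emb (c * d) = emb c * emb d"
  and emb_minus: "emb (- c) = - emb c" and emb_diff: "emb (c - d) = emb c - emb d"
proof -
  interpret vector_space "qscale D" by (rule scale_vs)
  show "emb 0 = 0" "emb 1 = 1" "emb (c + d) = emb c + emb d" "emb (- c) = - emb c" "emb (c - d) = emb c - emb d"
    by (simp_all add: emb_def scale_left_distrib scale_left_diff_distrib)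
  show "emb (c * d) = emb c * emb d" by (simp add: emb_def scale_mult_left)
qed

definition elt :: "'f \<Rightarrow> 'f \<Rightarrow> 'f \<Rightarrow> 'f \<Rightarrow> 'd" where
  "elt c1 c2 c3 c4 = emb c1 + emb c2 * qi D + emb c3 * qj D + emb c4 * (qi D * qj D)"

lemma qcomb_eq: "qcomb D c = elt (c$1) (c$2) (c$3) (c$4)"
  unfolding qcomb_def elt_def qscale_eq by simp

lemma qcomb_qcoord [simp]: "qcomb D (qcoord D x) = x"
  unfolding qcoord_def using theI'[OF basis[of x]] by simp

lemma qcoord_qcomb [simp]: "qcoord D (qcomb D c) = c"
  unfolding qcoord_def using basis by (intro the1_equality) auto

lemma elt_cr [simp]: "elt (cr x 1) (cr x 2) (cr x 3) (cr x 4) = x"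
  using qcomb_eq[of "qcoord D x"] by simp

lemma cr_elt [simp]: "cr (elt c1 c2 c3 c4) 1 = c1" "cr (elt c1 c2 c3 c4) 2 = c2"
  "cr (elt c1 c2 c3 c4) 3 = c3" "cr (elt c1 c2 c3 c4) 4 = c4"
proof -
  define c :: "'f^4" where "c = (\<chi> k. if k = 1 then c1 else if k = 2 then c2 else if k = 3 then c3 else c4)"
  have "elt c1 c2 c3 c4 = qcomb D c" by (simp add: qcomb_eq c_def)
  hence "qcoord D (elt c1 c2 c3 c4) = c" by simp
  thus "cr (elt c1 c2 c3 c4) 1 = c1" "cr (elt c1 c2 c3 c4) 2 = c2"
    "cr (elt c1 c2 c3 c4) 3 = c3" "cr (elt c1 c2 c3 c4) 4 = c4" by (simp_all add: c_def)
qed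

lemma cr_eqI:
  assumes "cr x 1 = cr y 1" "cr x 2 = cr y 2" "cr x 3 = cr y 3" "cr x 4 = cr y 4"
  shows "x = y"
  using elt_cr[of x] elt_cr[of y] assms by metis

lemma elt_add: "elt a b c d + elt a' b' c' d' = elt (a + a') (b + b') (c + c') (d + d')"
  by (simp add: elt_def emb_add algebra_simps)

lemma elt_uminus: "- elt a b c d = elt (- a) (- b) (- c) (- d)"
  by (simp add: elt_def emb_minus algebra_simps)

text \<open>The multiplication table in the basis 1, i, j, ij. Through it the identities for
  conjugation, trace and norm become polynomial identities in the coordinates.\<close>

lemma elt_mult:
  "elt c1 c2 c3 c4 * elt d1 d2 d3 d4 =
     elt (c1 * d1 + sqi * c2 * d2 + sqj * c3 * d3 - sqi * sqj * c4 * d4)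
         (c1 * d2 + c2 * d1 - sqj * c3 * d4 + sqj * c4 * d3)
         (c1 * d3 + c3 * d1 + sqi * c2 * d4 - sqi * c4 * d2)
         (c1 * d4 + c4 * d1 + c2 * d3 - c3 * d2)"
proof -
  have L: "qi D * (qi D * x) = emb sqi * x" "qj D * (qj D * x) = emb sqj * x"
    "qj D * (qi D * x) = - (qi D * (qj D * x))"
    "qi D * (emb c * x) = emb c * (qi D * x)" "qj D * (emb c * x) = emb c * (qj D * x)"
    "emb c * (emb d * x) = emb (c * d) * x" "emb c * emb d = emb (c * d)"
    "qi D * emb c = emb c * qi D" "qj D * emb c = emb c * qj D" for x c d
  proof -
    show "qi D * (qi D * x) = emb sqi * x" "qj D * (qj D * x) = emb sqj * x"
      "qj D * (qi D * x) = - (qi D * (qj D * x))" "emb c * (emb d * x) = emb (c * d) * x"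
      by (simp_all add: mult.assoc[symmetric] qi_sq qj_sq qj_qi emb_mult)
    show "qi D * (emb c * x) = emb c * (qi D * x)" "qj D * (emb c * x) = emb c * (qj D * x)"
      by (simp_all only: mult.assoc[symmetric] emb_central)
    show "emb c * emb d = emb (c * d)" "qi D * emb c = emb c * qi D" "qj D * emb c = emb c * qj D"
      by (rule emb_mult[symmetric] emb_central)+
  qed
  show ?thesis
    unfolding elt_def
    by (simp only: distrib_left distrib_right right_diff_distrib left_diff_distrib emb_add emb_diff
        mult.assoc L qi_sq qj_sq qj_qi mult_minus_right mult_minus_left emb_minus)
       (simp only: ac_simps diff_conv_add_uminus minus_add_distrib minus_minus)
qed

lemma cr_add: "cr (x + y) k = cr x k + cr y k"
proof -
  have "x + y = elt (cr x 1 + cr y 1) (cr x 2 + cr y 2) (cr x 3 + cr y 3) (cr x 4 + cr y 4)"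
    using elt_add elt_cr by metis
  thus ?thesis using exhaust_4[of k] by (auto simp: cr_elt)
qed

lemma cr_uminus: "cr (- x) k = - cr x k"
proof -
  have "- x = elt (- cr x 1) (- cr x 2) (- cr x 3) (- cr x 4)"
    using elt_uminus elt_cr by metis
  thus ?thesis using exhaust_4[of k] by (auto simp: cr_elt)
qed

lemma cr_diff: "cr (x - y) k = cr x k - cr y k"
  using cr_add[of x "- y" k] by (simp add: cr_uminus)

lemma cr_emb: "cr (emb c) 1 = c" "cr (emb c) 2 = 0" "cr (emb c) 3 = 0" "cr (emb c) 4 = 0"
proof -
  have "emb c = elt c 0 0 0" by (simp add: elt_def)
  thus "cr (emb c) 1 = c" "cr (emb c) 2 = 0" "cr (emb c) 3 = 0" "cr (emb c) 4 = 0" by simp_all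
qed

lemma cr_mult:
  "cr (x * y) 1 = cr x 1 * cr y 1 + sqi * cr x 2 * cr y 2 + sqj * cr x 3 * cr y 3 - sqi * sqj * cr x 4 * cr y 4"
  "cr (x * y) 2 = cr x 1 * cr y 2 + cr x 2 * cr y 1 - sqj * cr x 3 * cr y 4 + sqj * cr x 4 * cr y 3"
  "cr (x * y) 3 = cr x 1 * cr y 3 + cr x 3 * cr y 1 + sqi * cr x 2 * cr y 4 - sqi * cr x 4 * cr y 2"
  "cr (x * y) 4 = cr x 1 * cr y 4 + cr x 4 * cr y 1 + cr x 2 * cr y 3 - cr x 3 * cr y 2"
  using elt_mult[of "cr x 1" "cr x 2" "cr x 3" "cr x 4" "cr y 1" "cr y 2" "cr y 3" "cr y 4"]
  by simp_all

lemma cr_emb_mult: "cr (emb c * x) k = c * cr x k"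
  using exhaust_4[of k] by (auto simp: cr_mult cr_emb)

lemma cr_conj: "cr (qconj D x) 1 = cr x 1" "cr (qconj D x) 2 = - cr x 2"
  "cr (qconj D x) 3 = - cr x 3" "cr (qconj D x) 4 = - cr x 4"
proof -
  have "qconj D x = elt (cr x 1) (- cr x 2) (- cr x 3) (- cr x 4)"
    by (simp add: qconj_def Let_def elt_def qscale_eq emb_minus)
  thus "cr (qconj D x) 1 = cr x 1" "cr (qconj D x) 2 = - cr x 2"
    "cr (qconj D x) 3 = - cr x 3" "cr (qconj D x) 4 = - cr x 4" by simp_all
qed

lemma rtrace_eq: "rtrace D x = 2 * cr x 1"
  by (simp add: rtrace_def cr_add cr_conj)

lemma rnorm_eq: "rnorm D x = (cr x 1)\<^sup>2 - sqi * (cr x 2)\<^sup>2 - sqj * (cr x 3)\<^sup>2 + sqi * sqj * (cr x 4)\<^sup>2"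
  by (simp add: rnorm_def cr_mult cr_conj power2_eq_square algebra_simps)

lemma mult_qconj: "x * qconj D x = emb (rnorm D x)"
  by (rule cr_eqI) (simp_all add: cr_mult cr_conj cr_emb rnorm_eq power2_eq_square algebra_simps)

lemma qconj_mult: "qconj D (x * y) = qconj D y * qconj D x"
  by (rule cr_eqI) (simp_all add: cr_mult cr_conj algebra_simps)

lemma emb_inject: "emb c = emb d \<longleftrightarrow> c = d"
  using cr_emb(1) by metis

lemma rnorm_mult: "rnorm D (x * y) = rnorm D x * rnorm D y"
proof -
  have "emb (rnorm D (x * y)) = x * (y * qconj D y) * qconj D x"
    by (simp add: mult_qconj[symmetric] qconj_mult mult.assoc)
  also have "\<dots> = emb (rnorm D y) * (x * qconj D x)"
    unfolding mult_qconj emb_central[of x] mult.assoc ..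
  finally show ?thesis by (simp add: mult_qconj emb_mult[symmetric] emb_inject mult.commute)
qed

lemma rnorm_1 [simp]: "rnorm D 1 = 1"
  using cr_emb[of 1] by (simp add: rnorm_eq)

lemma qconj_eq_0: "qconj D x = 0 \<longleftrightarrow> x = 0"
proof -
  have "qconj D (qconj D x) = x" by (rule cr_eqI) (simp_all add: cr_conj)
  moreover have "qconj D 0 = 0" using cr_emb[of 0] by (intro cr_eqI) (simp_all add: cr_conj)
  ultimately show ?thesis by metis
qed

text \<open>\<open>x\<close> times its conjugate is the reduced norm, and \<open>D\<close> has no
  zero divisors. This anisotropy is where the division property of \<open>D\<close> enters the
  analysis.\<close>

lemma rnorm_eq_0: "rnorm D x = 0 \<longleftrightarrow> x = 0"
  using mult_qconj[of x] qconj_eq_0[of x] emb_inject[of "rnorm D x" 0] by auto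

lemma rtrace_add: "rtrace D (x + y) = rtrace D x + rtrace D y"
  by (simp add: rtrace_eq cr_add distrib_left)

lemma rtrace_commute: "rtrace D (x * y) = rtrace D (y * x)"
  by (simp add: rtrace_eq cr_mult mult.commute mult.left_commute)

lemma rtrace_conj: "h \<noteq> 0 \<Longrightarrow> rtrace D (h * x * inverse h) = rtrace D x"
  using rtrace_commute[of "h * x" "inverse h"] by (simp add: mult.assoc[symmetric])

lemma rnorm_emb: "rnorm D (emb c) = c\<^sup>2"
  by (simp add: rnorm_eq cr_emb)

end

section \<open>The ultrametric norm of \<open>D\<close>\<close>

locale p_adic_quaternion = p_adic_field prm absF + nonsplit_quaternion_algebra D
  for prm :: nat and absF :: "'f::field_char_0 \<Rightarrow> real" and D :: "('f, 'd::division_ring) quat"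
begin

text \<open>This norm describes the coordinate topology and is visibly ultrametric, but in general
  it is not multiplicative. It serves to transfer compactness and continuity to
  \<open>\<nu>\<close>.\<close>

definition max_norm :: "'d \<Rightarrow> real" where "max_norm x = Max (range (\<lambda>k. absF (cr x k)))"

lemma absF_cr_le_max_norm: "absF (cr x k) \<le> max_norm x"
  unfolding max_norm_def by (intro Max_ge) auto

lemma max_norm_le_iff: "max_norm x \<le> r \<longleftrightarrow> (\<forall>k. absF (cr x k) \<le> r)"
  unfolding max_norm_def by (subst Max_le_iff) auto

lemma max_norm_attained: "\<exists>k. max_norm x = absF (cr x k)"
proof -
  have "max_norm x \<in> range (\<lambda>k. absF (cr x k))" unfolding max_norm_def by (intro Max_in) auto
  thus ?thesis by auto
qed

lemma max_norm_nonneg: "0 \<le> max_norm x"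
  using absF_cr_le_max_norm[of x 1] abs_nonneg[of "cr x 1"] by linarith

lemma max_norm_add_le: "max_norm (x + y) \<le> max (max_norm x) (max_norm y)"
  unfolding max_norm_le_iff cr_add
  using abs_ultra absF_cr_le_max_norm by (meson max.mono order_trans)

text \<open>The square root makes \<open>\<nu>\<close> extend the absolute value of
  \<open>F\<close>, because the reduced norm of a scalar is its square. Multiplicativity is
  immediate; the ultrametric inequality has to be proved.\<close>

definition \<nu> :: "'d \<Rightarrow> real" where "\<nu> x = sqrt (absF (rnorm D x))"

lemma nu_sq: "(\<nu> x)\<^sup>2 = absF (rnorm D x)" by (simp add: \<nu>_def abs_nonneg)

lemma nu_nonneg [simp]: "0 \<le> \<nu> x" by (simp add: \<nu>_def abs_nonneg)

lemma nu_mult: "\<nu> (x * y) = \<nu> x * \<nu> y"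
  by (simp add: \<nu>_def rnorm_mult abs_mult real_sqrt_mult)

lemma nu_eq_0 [simp]: "\<nu> x = 0 \<longleftrightarrow> x = 0"
  by (simp add: \<nu>_def abs_eq_0 rnorm_eq_0)

lemma nu_0 [simp]: "\<nu> 0 = 0" by (simp only: nu_eq_0)

lemma nu_1 [simp]: "\<nu> 1 = 1" by (simp add: \<nu>_def)

lemma nu_pos: "x \<noteq> 0 \<Longrightarrow> 0 < \<nu> x"
  using nu_nonneg[of x] nu_eq_0[of x] by linarith

lemma nu_minus [simp]: "\<nu> (- x) = \<nu> x"
proof -
  have "rnorm D (- x) = rnorm D x" by (simp add: rnorm_eq cr_uminus)
  thus ?thesis by (simp add: \<nu>_def)
qed

lemma nu_minus_commute: "\<nu> (x - y) = \<nu> (y - x)"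
  using nu_minus[of "x - y"] by simp

lemma nu_inverse: "\<nu> (inverse x) = inverse (\<nu> x)"
proof (cases "x = 0")
  case False
  hence "\<nu> x * \<nu> (inverse x) = 1" by (simp add: nu_mult[symmetric])
  thus ?thesis by (simp add: inverse_unique)
qed simp

lemma nu_power: "\<nu> (x ^ n) = \<nu> x ^ n"
  by (induction n) (auto simp: nu_mult)

lemma nu_le_max_norm: "\<exists>M>0. \<forall>x. (\<nu> x)\<^sup>2 \<le> M * (max_norm x)\<^sup>2"
proof -
  define M where "M = max 1 (max (absF sqi) (max (absF sqj) (absF (sqi * sqj))))"
  have "(\<nu> x)\<^sup>2 \<le> M * (max_norm x)\<^sup>2" for x
  proof -
    have sq: "absF (c * (cr x k)\<^sup>2) \<le> M * (max_norm x)\<^sup>2" if "absF c \<le> M" for c k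
    proof -
      have "(absF (cr x k))\<^sup>2 \<le> (max_norm x)\<^sup>2" by (intro power_mono absF_cr_le_max_norm abs_nonneg)
      thus ?thesis unfolding abs_mult absF_power using that
        by (intro mult_mono) (auto simp: abs_nonneg intro: order_trans[OF abs_nonneg])
    qed
    have "absF (1 * (cr x 1)\<^sup>2 - sqi * (cr x 2)\<^sup>2 - sqj * (cr x 3)\<^sup>2 + sqi * sqj * (cr x 4)\<^sup>2) \<le> M * (max_norm x)\<^sup>2"
      by (intro order_trans[OF abs_ultra] order_trans[OF absF_diff_le] max.boundedI sq) (auto simp: M_def)
    thus ?thesis by (simp add: nu_sq rnorm_eq)
  qed
  moreover have "M > 0" by (simp add: M_def)
  ultimately show ?thesis by blast
qed

lemma exists_coords_convergent_subsequence:
  assumes "\<And>n::nat. max_norm (x n) \<le> R"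
  shows "\<exists>s a. strict_mono s \<and> (\<forall>k. (\<lambda>n. absF (cr (x (s n)) k - cr a k)) \<longlonglongrightarrow> 0)"
proof -
  have R: "absF (cr (x n) k) \<le> R" for n k using assms absF_cr_le_max_norm order_trans by blast
  have sub: "(\<lambda>n. absF (f (s n) - a)) \<longlonglongrightarrow> 0"
    if "(\<lambda>n. absF (f n - a)) \<longlonglongrightarrow> 0" "strict_mono s" for f a s
    using LIMSEQ_subseq_LIMSEQ[OF that] by (simp add: o_def)
  obtain a1 s1 where 1: "strict_mono s1" "(\<lambda>n. absF (cr (x (s1 n)) 1 - a1)) \<longlonglongrightarrow> 0"
    using bounded_imp_convergent_subsequence[of "\<lambda>n. cr (x n) 1" R] R by blast
  obtain a2 s2 where 2: "strict_mono s2" "(\<lambda>n. absF (cr (x (s1 (s2 n))) 2 - a2)) \<longlonglongrightarrow> 0"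
    using bounded_imp_convergent_subsequence[of "\<lambda>n. cr (x (s1 n)) 2" R] R by blast
  obtain a3 s3 where 3: "strict_mono s3" "(\<lambda>n. absF (cr (x (s1 (s2 (s3 n)))) 3 - a3)) \<longlonglongrightarrow> 0"
    using bounded_imp_convergent_subsequence[of "\<lambda>n. cr (x (s1 (s2 n))) 3" R] R by blast
  obtain a4 s4 where 4: "strict_mono s4" "(\<lambda>n. absF (cr (x (s1 (s2 (s3 (s4 n))))) 4 - a4)) \<longlonglongrightarrow> 0"
    using bounded_imp_convergent_subsequence[of "\<lambda>n. cr (x (s1 (s2 (s3 n)))) 4" R] R by blast
  define s where "s = s1 \<circ> (s2 \<circ> (s3 \<circ> s4))"
  have "strict_mono s" unfolding s_def by (intro strict_mono_o 1 2 3 4)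
  moreover have "(\<lambda>n. absF (cr (x (s n)) k - cr (elt a1 a2 a3 a4) k)) \<longlonglongrightarrow> 0" for k
    using exhaust_4[of k] sub[OF 1(2), of "\<lambda>n. s2 (s3 (s4 n))"] sub[OF 2(2), of "\<lambda>n. s3 (s4 n)"]
      sub[OF 3(2) 4(1)] 4(2) strict_mono_o[OF 2(1) strict_mono_o[OF 3(1) 4(1)]] strict_mono_o[OF 3(1) 4(1)]
    by (auto simp: s_def o_def)
  ultimately show ?thesis by blast
qed

text \<open>The reduced norm is anisotropic, so it is bounded below on the compact sphere \<open>max_norm x = 1\<close>.\<close>

lemma max_norm_le_nu: "\<exists>c>0. \<forall>x. c * (max_norm x)\<^sup>2 \<le> (\<nu> x)\<^sup>2"
proof (rule ccontr)
  assume neg: "\<not> ?thesis"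
  have "\<exists>x. inverse (real (Suc n)) * (max_norm x)\<^sup>2 > (\<nu> x)\<^sup>2" for n
    using neg by (meson inverse_positive_iff_positive not_le of_nat_0_less_iff zero_less_Suc)
  then obtain x where x: "\<And>n. inverse (real (Suc n)) * (max_norm (x n))\<^sup>2 > (\<nu> (x n))\<^sup>2" by metis
  have "\<forall>n. \<exists>k. max_norm (x n) = absF (cr (x n) k)" using max_norm_attained by blast
  then obtain k where k: "\<And>n. max_norm (x n) = absF (cr (x n) (k n))" by metis
  have nz: "max_norm (x n) \<noteq> 0" for n using x[of n] by (metis mult_zero_right not_less power_zero_numeral zero_le_power2)
  \<comment> \<open>Dividing by a coordinate of largest absolute value makes one coordinate equal to
    1, with an index that may vary with \<open>n\<close>. A limit 0 is then impossible, since it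
    would make all four coordinates eventually smaller than 1.\<close>
  define t where "t n = inverse (cr (x n) (k n))" for n
  have t: "absF (t n) = inverse (max_norm (x n))" "t n \<noteq> 0" for n
    using nz k abs_eq_0 by (auto simp: t_def absF_inverse)
  define y where "y n = emb (t n) * x n" for n
  have "\<exists>k. cr (y n) k = 1" for n
    using nz[of n] k[of n] abs_eq_0[of "cr (x n) (k n)"]
    by (intro exI[of _ "k n"]) (auto simp: y_def cr_emb_mult t_def)
  then obtain k' where k': "\<And>n. cr (y n) (k' n) = 1" by metis
  have y1: "max_norm (y n) \<le> 1" for n
    unfolding max_norm_le_iff
    using absF_cr_le_max_norm[of "x n"] nz[of n] max_norm_nonneg[of "x n"]
    by (auto simp: y_def cr_emb_mult abs_mult t field_simps)
  have yN: "absF (rnorm D (y n)) < inverse (real (Suc n))" for n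
  proof -
    have "absF (rnorm D (y n)) = (\<nu> (x n))\<^sup>2 / (max_norm (x n))\<^sup>2"
      by (simp add: y_def rnorm_mult rnorm_emb abs_mult absF_power t nu_sq power_inverse field_simps)
    also have "\<dots> < inverse (real (Suc n))"
      using x[of n] nz[of n] by (subst pos_divide_less_eq) (auto simp: zero_less_power2)
    finally show ?thesis .
  qed
  obtain s a where s: "strict_mono s" "\<And>k. (\<lambda>n. absF (cr (y (s n)) k - cr a k)) \<longlonglongrightarrow> 0"
    using exists_coords_convergent_subsequence[of y 1, OF y1] by blast
  have b: "absF (cr (y (s n)) k) \<le> 1" for n k using y1 absF_cr_le_max_norm order_trans by blast
  have sq: "(\<lambda>n. absF (c * (cr (y (s n)) k)\<^sup>2 - c * (cr a k)\<^sup>2)) \<longlonglongrightarrow> 0" for c k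
  proof -
    have "(\<lambda>n. absF ((cr (y (s n)) k * cr (y (s n)) k) - (cr a k * cr a k))) \<longlonglongrightarrow> 0"
      by (rule absF_tendsto_mult[OF s(2) s(2) b])
    moreover have "absF (c * (cr (y (s n)) k)\<^sup>2 - c * (cr a k)\<^sup>2) =
        absF c * absF ((cr (y (s n)) k * cr (y (s n)) k) - (cr a k * cr a k))" for n
      by (simp add: abs_mult[symmetric] power2_eq_square algebra_simps)
    ultimately show ?thesis using tendsto_mult[OF tendsto_const, of _ 0 sequentially "absF c"] by simp
  qed
  have "(\<lambda>n. absF ((1 * (cr (y (s n)) 1)\<^sup>2 + (- sqi) * (cr (y (s n)) 2)\<^sup>2) +
      ((- sqj) * (cr (y (s n)) 3)\<^sup>2 + sqi * sqj * (cr (y (s n)) 4)\<^sup>2) -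
      ((1 * (cr a 1)\<^sup>2 + (- sqi) * (cr a 2)\<^sup>2) + ((- sqj) * (cr a 3)\<^sup>2 + sqi * sqj * (cr a 4)\<^sup>2)))) \<longlonglongrightarrow> 0"
    by (intro absF_tendsto_add sq)
  hence lim: "(\<lambda>n. absF (rnorm D (y (s n)) - rnorm D a)) \<longlonglongrightarrow> 0"
    by (simp add: rnorm_eq algebra_simps)
  have "(\<lambda>n. absF (rnorm D (y (s n)))) \<longlonglongrightarrow> 0"
  proof (rule tendsto_sandwich[OF _ _ tendsto_const])
    show "\<forall>\<^sub>F n in sequentially. absF (rnorm D (y (s n))) \<le> inverse (real (Suc n))"
    proof (intro always_eventually allI)
      fix n
      have "s n \<ge> n" using s(1) by (rule seq_suble)
      hence "inverse (real (Suc (s n))) \<le> inverse (real (Suc n))" by (simp add: field_simps)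
      thus "absF (rnorm D (y (s n))) \<le> inverse (real (Suc n))" using yN[of "s n"] by linarith
    qed
  qed (auto simp: abs_nonneg LIMSEQ_inverse_real_of_nat simp del: of_nat_Suc)
  hence "(\<lambda>n. max (absF (rnorm D (y (s n)) - rnorm D a)) (absF (rnorm D (y (s n))))) \<longlonglongrightarrow> 0"
    using tendsto_max[OF lim, of _ 0] by simp
  moreover have "absF (rnorm D a) \<le> max (absF (rnorm D (y (s n)) - rnorm D a)) (absF (rnorm D (y (s n))))" for n
    using absF_diff_le[of "rnorm D (y (s n))" "rnorm D (y (s n)) - rnorm D a"] by simp
  ultimately have "absF (rnorm D a) \<le> 0"
    by (intro LIMSEQ_le_const) auto
  hence "a = 0" using abs_nonneg[of "rnorm D a"] abs_eq_0 rnorm_eq_0 by (metis order_antisym)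
  hence ca: "cr a k = 0" for k using cr_emb[of 0] exhaust_4[of k] by auto
  have "\<forall>\<^sub>F n in sequentially. absF (cr (y (s n)) k) < 1" for k
    using order_tendstoD(2)[OF s(2)[of k], of 1] by (simp add: ca)
  hence "\<forall>\<^sub>F n in sequentially. \<forall>k. absF (cr (y (s n)) k) < 1" by (simp add: eventually_all_finite)
  then obtain n where "\<forall>k. absF (cr (y (s n)) k) < 1" by (auto simp: eventually_sequentially)
  with k'[of "s n"] absF_1 show False by (metis less_irrefl)
qed

text \<open>If \<open>\<nu> x \<le> 1\<close> then the powers of \<open>x\<close>, hence also those of \<open>x + 1\<close>, stay in a bounded
  additive subgroup, which forces \<open>\<nu> (x + 1) \<le> 1\<close>.\<close>

lemma nu_add_1_le:
  assumes "\<nu> x \<le> 1" shows "\<nu> (x + 1) \<le> 1"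
proof (rule ccontr)
  assume "\<not> ?thesis"
  hence gt: "\<nu> (x + 1) > 1" by simp
  obtain c where c: "c > 0" "\<And>x. c * (max_norm x)\<^sup>2 \<le> (\<nu> x)\<^sup>2" using max_norm_le_nu by blast
  obtain M where M: "M > 0" "\<And>x. (\<nu> x)\<^sup>2 \<le> M * (max_norm x)\<^sup>2" using nu_le_max_norm by blast
  define B where "B = sqrt (1 / c)"
  have xB: "max_norm (x ^ m) \<le> B" for m
  proof -
    have "c * (max_norm (x ^ m))\<^sup>2 \<le> 1" using c(2)[of "x ^ m"] assms
      by (simp add: nu_power power_le_one order_trans)
    hence "(max_norm (x ^ m))\<^sup>2 \<le> 1 / c" using c(1) by (simp add: field_simps)
    thus ?thesis unfolding B_def by (rule real_le_rsqrt)
  qed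
  \<comment> \<open>\<open>G\<close> is closed under addition, because \<open>max_norm\<close> is
    ultrametric, and under right multiplication by \<open>x\<close>. Hence it is stable under right
    multiplication by \<open>x + 1\<close>.\<close>
  define G where "G = {y. \<forall>m. max_norm (y * x ^ m) \<le> B}"
  have "(x + 1) ^ n \<in> G" for n
  proof (induction n)
    case 0 show ?case using xB by (simp add: G_def)
  next
    case (Suc n)
    have "max_norm ((x + 1) ^ Suc n * x ^ m) \<le> B" for m
    proof -
      have "(x + 1) ^ Suc n * x ^ m = (x + 1) ^ n * x ^ Suc m + (x + 1) ^ n * x ^ m"
        by (subst power_Suc2) (simp add: algebra_simps)
      moreover have "max_norm ((x + 1) ^ n * x ^ Suc m) \<le> B" "max_norm ((x + 1) ^ n * x ^ m) \<le> B"
        using Suc unfolding G_def by blast+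
      ultimately show ?thesis using max_norm_add_le[of "(x + 1) ^ n * x ^ Suc m" "(x + 1) ^ n * x ^ m"] by simp
    qed
    thus ?case by (simp add: G_def)
  qed
  hence mB: "max_norm ((x + 1) ^ n) \<le> B" for n unfolding G_def by (metis (mono_tags) mem_Collect_eq mult.right_neutral power_0)
  have bound: "((\<nu> (x + 1))\<^sup>2) ^ n \<le> M * B\<^sup>2" for n
  proof -
    have "((\<nu> (x + 1))\<^sup>2) ^ n = (\<nu> ((x + 1) ^ n))\<^sup>2" by (simp add: nu_power power_mult[symmetric] mult.commute)
    also have "\<dots> \<le> M * (max_norm ((x + 1) ^ n))\<^sup>2" by (rule M)
    also have "\<dots> \<le> M * B\<^sup>2" using M(1) mB max_norm_nonneg by (intro mult_left_mono power_mono) auto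
    finally show ?thesis .
  qed
  have "(\<nu> (x + 1))\<^sup>2 > 1" using gt by (simp add: one_less_power)
  then obtain n where "((\<nu> (x + 1))\<^sup>2) ^ n > M * B\<^sup>2" using real_arch_pow by blast
  with bound[of n] show False by simp
qed

text \<open>By multiplicativity, division by the element of larger norm reduces the inequality to
  \<open>nu_add_1_le\<close>.\<close>

lemma nu_ultra: "\<nu> (x + y) \<le> max (\<nu> x) (\<nu> y)"
proof -
  have *: "\<nu> (x + y) \<le> \<nu> y" if "\<nu> x \<le> \<nu> y" for x y
  proof (cases "y = 0")
    case False
    have "\<nu> (x * inverse y) \<le> 1" using that nu_pos[OF False]
      by (simp only: nu_mult nu_inverse) (simp add: field_simps)
    hence "\<nu> (x * inverse y + 1) \<le> 1" by (rule nu_add_1_le)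
    moreover have "x + y = (x * inverse y + 1) * y" using False by (simp add: algebra_simps)
    ultimately show ?thesis by (simp add: nu_mult mult_left_le_one_le)
  qed (use that in simp)
  show ?thesis using *[of x y] *[of y x] by (cases "\<nu> x \<le> \<nu> y") (auto simp: add.commute)
qed

lemma nu_diff_le: "\<nu> (x - y) \<le> max (\<nu> x) (\<nu> y)"
  using nu_ultra[of x "- y"] by simp

lemma nu_diff_trans: "\<nu> (x - z) \<le> max (\<nu> (x - y)) (\<nu> (y - z))"
  using nu_ultra[of "x - y" "y - z"] by simp

lemma nu_sum_le:
  assumes "\<And>i. i \<in> I \<Longrightarrow> \<nu> (f i) \<le> b" "0 \<le> b"
  shows "\<nu> (sum f I) \<le> b"
  using assms
proof (induction I rule: infinite_finite_induct)
  case (insert i I)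
  have "\<nu> (f i + sum f I) \<le> max (\<nu> (f i)) (\<nu> (sum f I))" by (rule nu_ultra)
  also have "\<dots> \<le> b" using insert by simp
  finally show ?case using insert by simp
qed auto

lemma nu_conj: "h \<noteq> 0 \<Longrightarrow> \<nu> (h * x * inverse h) = \<nu> x"
  by (simp add: nu_mult nu_inverse)

lemma max_norm_le_nu_linear: "\<exists>c>0. \<forall>x. max_norm x \<le> c * \<nu> x"
proof -
  obtain c where c: "c > 0" "\<And>x. c * (max_norm x)\<^sup>2 \<le> (\<nu> x)\<^sup>2" using max_norm_le_nu by blast
  have "max_norm x \<le> sqrt (1 / c) * \<nu> x" for x
  proof -
    have "(max_norm x)\<^sup>2 \<le> 1 / c * (\<nu> x)\<^sup>2" using c(1) c(2)[of x] by (simp add: field_simps)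
    hence "max_norm x \<le> sqrt (1 / c * (\<nu> x)\<^sup>2)" by (rule real_le_rsqrt)
    thus ?thesis by (simp only: real_sqrt_mult) simp
  qed
  moreover have "sqrt (1 / c) > 0" using c(1) by simp
  ultimately show ?thesis by blast
qed

lemma nu_le_max_norm_linear: "\<exists>c>0. \<forall>x. \<nu> x \<le> c * max_norm x"
proof -
  obtain c where c: "c > 0" "\<And>x. (\<nu> x)\<^sup>2 \<le> c * (max_norm x)\<^sup>2" using nu_le_max_norm by blast
  have "\<nu> x \<le> sqrt c * max_norm x" for x
  proof -
    have "\<nu> x \<le> sqrt (c * (max_norm x)\<^sup>2)" using c(2)[of x] by (rule real_le_rsqrt)
    thus ?thesis by (simp only: real_sqrt_mult) (simp add: max_norm_nonneg)
  qed
  moreover have "sqrt c > 0" using c(1) by simp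
  ultimately show ?thesis by blast
qed

text \<open>Each of \<open>\<nu>\<close> and \<open>max_norm\<close> is bounded by a multiple of the
  other, so the balls of \<open>\<nu>\<close> form a base of the coordinate topology.\<close>

lemma openin_quat_top:
  "openin (quat_top absF D) U \<longleftrightarrow> (\<forall>x\<in>U. \<exists>e>0. \<forall>y. \<nu> (y - x) < e \<longrightarrow> y \<in> U)"
proof
  let ?f = "\<lambda>x k. cr x k"
  assume "openin (quat_top absF D) U"
  then obtain W where W: "openin (product_topology (\<lambda>_. field_top absF) UNIV) W" "U = ?f -` W"
    unfolding quat_top_def openin_pullback_topology by auto
  show "\<forall>x\<in>U. \<exists>e>0. \<forall>y. \<nu> (y - x) < e \<longrightarrow> y \<in> U"
  proof
    fix x assume "x \<in> U"
    hence "?f x \<in> W" using W(2) by simp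
    then obtain X where X: "\<And>k. openin (field_top absF) (X k)" "?f x \<in> PiE UNIV X" "PiE UNIV X \<subseteq> W"
      using W(1) unfolding openin_product_topology_alt by (metis UNIV_I)
    have "\<exists>e>0. \<forall>y. absF (y - cr x k) < e \<longrightarrow> y \<in> X k" for k
      using X(1)[of k] X(2) unfolding openin_field_top by (auto simp: PiE_UNIV_domain)
    then obtain e where e: "\<And>k. e k > 0" "\<And>k y. absF (y - cr x k) < e k \<Longrightarrow> y \<in> X k" by metis
    define d where "d = Min (range e)"
    have d: "d > 0" "\<And>k. d \<le> e k" using e(1) by (auto simp: d_def)
    obtain c where c: "c > 0" "\<And>x. max_norm x \<le> c * \<nu> x" using max_norm_le_nu_linear by blast
    show "\<exists>e>0. \<forall>y. \<nu> (y - x) < e \<longrightarrow> y \<in> U"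
    proof (intro exI[of _ "d / c"] conjI allI impI)
      fix y assume "\<nu> (y - x) < d / c"
      hence "max_norm (y - x) < d" using c by (simp add: pos_less_divide_eq mult.commute) (meson order_le_less_trans)
      hence "absF (cr y k - cr x k) < e k" for k
        using absF_cr_le_max_norm[of "y - x" k] d(2)[of k] by (simp add: cr_diff)
      hence "?f y \<in> PiE UNIV X" using e(2) by (auto simp: PiE_UNIV_domain)
      thus "y \<in> U" using X(3) W(2) by auto
    qed (use c d in simp)
  qed
next
  let ?f = "\<lambda>x k. cr x k"
  assume *: "\<forall>x\<in>U. \<exists>e>0. \<forall>y. \<nu> (y - x) < e \<longrightarrow> y \<in> U"
  have inj: "x = y" if "?f x = ?f y" for x y using that by (intro cr_eqI) (auto dest: fun_cong)
  have "openin (product_topology (\<lambda>_. field_top absF) UNIV) (?f ` U)"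
    unfolding openin_product_topology_alt
  proof safe
    fix x assume "x \<in> U"
    then obtain e where e: "e > 0" "\<And>y. \<nu> (y - x) < e \<Longrightarrow> y \<in> U" using * by blast
    obtain c where c: "c > 0" "\<And>x. \<nu> x \<le> c * max_norm x" using nu_le_max_norm_linear by blast
    define X where "X k = {t. absF (t - cr x k) < e / c}" for k
    have "openin (field_top absF) (X k)" for k
      unfolding openin_field_top X_def
    proof safe
      fix t assume t: "absF (t - cr x k) < e / c"
      show "\<exists>d>0. \<forall>y. absF (y - t) < d \<longrightarrow> y \<in> {t. absF (t - cr x k) < e / c}"
      proof (intro exI[of _ "e / c"] conjI allI impI)
        fix y assume "absF (y - t) < e / c"
        thus "y \<in> {t. absF (t - cr x k) < e / c}" using absF_diff_trans[of y "cr x k" t] t by auto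
      qed (use e c in simp)
    qed
    moreover have "?f x \<in> PiE UNIV X" using e c by (auto simp: X_def PiE_UNIV_domain)
    moreover have "PiE UNIV X \<subseteq> ?f ` U"
    proof
      fix g assume g: "g \<in> PiE UNIV X"
      define y where "y = elt (g 1) (g 2) (g 3) (g 4)"
      have gy: "g = ?f y"
      proof
        fix k :: 4 show "g k = cr y k" using exhaust_4[of k] by (auto simp: y_def)
      qed
      have "absF (cr (y - x) k) < e / c" for k
        using g unfolding gy by (auto simp: X_def PiE_UNIV_domain cr_diff)
      hence "max_norm (y - x) < e / c" using max_norm_attained[of "y - x"] by metis
      hence "c * max_norm (y - x) < e" using c(1) by (simp add: pos_less_divide_eq mult.commute)
      hence "y \<in> U" using e(2)[of y] c(2)[of "y - x"] by simp
      thus "g \<in> ?f ` U" using gy by blast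
    qed
    ultimately show "\<exists>Ua. finite {i \<in> UNIV. Ua i \<noteq> topspace (field_top absF)} \<and>
        (\<forall>i\<in>UNIV. openin (field_top absF) (Ua i)) \<and> ?f x \<in> PiE UNIV Ua \<and> PiE UNIV Ua \<subseteq> ?f ` U"
      by (intro exI[of _ X]) auto
  qed
  moreover have "U = ?f -` (?f ` U)" using inj by blast
  ultimately show "openin (quat_top absF D) U"
    unfolding quat_top_def openin_pullback_topology by auto
qed

lemma topspace_quat_top [simp]: "topspace (quat_top absF D) = UNIV"
proof -
  have "openin (quat_top absF D) UNIV" unfolding openin_quat_top by (auto intro: zero_less_one)
  thus ?thesis by (meson openin_subset top.extremum_unique)
qed

text \<open>For nonnegative radius these balls are the cosets of the additive group
  \<open>cb r 0\<close>; two of them with the same radius are equal or disjoint.\<close>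

definition cb :: "real \<Rightarrow> 'd \<Rightarrow> 'd set" where "cb r x = {y. \<nu> (y - x) \<le> r}"

lemma openin_cb: "r > 0 \<Longrightarrow> openin (quat_top absF D) (cb r x)"
  unfolding openin_quat_top cb_def
proof safe
  fix y assume r: "r > 0" and y: "\<nu> (y - x) \<le> r"
  show "\<exists>e>0. \<forall>z. \<nu> (z - y) < e \<longrightarrow> z \<in> {y. \<nu> (y - x) \<le> r}"
    using r y nu_diff_trans by (intro exI[of _ r]) (smt (verit) max_def mem_Collect_eq)
qed

text \<open>The ball is a closed subset of a product of four compact balls of \<open>F\<close>. It
  is closed because \<open>\<nu>\<close> is locally constant away from 0.\<close>

lemma compactin_cb: "compactin (quat_top absF D) (cb r 0)"
proof -
  obtain c where c: "c > 0" "\<And>x. max_norm x \<le> c * \<nu> x" using max_norm_le_nu_linear by blast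
  define B where "B = {x. max_norm x \<le> c * r}"
  have "compactin (quat_top absF D) B"
    unfolding quat_top_def
  proof (rule compactin_pullback_topology)
    have "(\<lambda>x k. cr x k) ` B = PiE UNIV (\<lambda>_. {t. absF t \<le> c * r})"
    proof safe
      fix g :: "4 \<Rightarrow> 'f" assume g: "g \<in> (\<Pi>\<^sub>E _\<in>UNIV. {t. absF t \<le> c * r})"
      define y where "y = elt (g 1) (g 2) (g 3) (g 4)"
      have gy: "g = (\<lambda>k. cr y k)"
      proof
        fix k :: 4 show "g k = cr y k" using exhaust_4[of k] by (auto simp: y_def)
      qed
      have "y \<in> B" using g unfolding gy B_def max_norm_le_iff by (auto simp: PiE_UNIV_domain)
      thus "g \<in> (\<lambda>x k. cr x k) ` B" using gy by blast
    qed (auto simp: B_def max_norm_le_iff PiE_UNIV_domain)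
    thus "compactin (product_topology (\<lambda>_. field_top absF) UNIV) ((\<lambda>x k. cr x k) ` B)"
      by (simp add: compactin_PiE compactin_absF_ball)
  qed simp
  moreover have "cb r 0 \<subseteq> B"
    using c by (auto simp: cb_def B_def) (smt (verit) mult_left_mono)
  moreover have "closedin (quat_top absF D) (cb r 0)"
  proof -
    have "openin (quat_top absF D) {x. r < \<nu> x}"
      unfolding openin_quat_top
    proof
      fix x assume x: "x \<in> {x. r < \<nu> x}"
      show "\<exists>e>0. \<forall>y. \<nu> (y - x) < e \<longrightarrow> y \<in> {x. r < \<nu> x}"
      proof (cases "x = 0")
        \<comment> \<open>This occurs only for negative \<open>r\<close>, when every element lies in
          the complement.\<close>
        case True
        hence "r < \<nu> y" for y using x order.strict_trans2[OF _ nu_nonneg[of y], of r] by auto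
        thus ?thesis by (intro exI[of _ 1]) auto
      next
        case False
        show ?thesis
        proof (intro exI[of _ "\<nu> x"] conjI allI impI)
          fix y assume "\<nu> (y - x) < \<nu> x"
          hence "\<nu> x \<le> \<nu> y" using nu_diff_le[of y "y - x"] by auto
          thus "y \<in> {x. r < \<nu> x}" using x by simp
        qed (use False nu_pos in simp)
      qed
    qed
    moreover have "topspace (quat_top absF D) - cb r 0 = {x. r < \<nu> x}" by (auto simp: cb_def)
    ultimately show ?thesis by (simp add: closedin_def)
  qed
  ultimately show ?thesis by (rule closed_compactin)
qed

lemma finite_cover_cb:
  assumes "r > 0"
  shows "\<exists>S. finite S \<and> cb R 0 \<subseteq> (\<Union>x\<in>S. cb r x)"
proof -
  have "cb R 0 \<subseteq> \<Union>(range (cb r))"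
  proof
    fix x have "x \<in> cb r x" using assms by (simp add: cb_def)
    thus "x \<in> \<Union>(range (cb r))" by blast
  qed
  moreover have "\<forall>U\<in>range (cb r). openin (quat_top absF D) U" using openin_cb[OF assms] by blast
  ultimately have "\<exists>\<F>. finite \<F> \<and> \<F> \<subseteq> range (cb r) \<and> cb R 0 \<subseteq> \<Union>\<F>"
    using compactin_cb[of R] unfolding compactin_def by meson
  then obtain \<F> where F: "finite \<F>" "\<F> \<subseteq> range (cb r)" "cb R 0 \<subseteq> \<Union>\<F>" by blast
  then obtain S where "finite S" "\<F> = cb r ` S" using finite_subset_image by metis
  thus ?thesis using F by blast
qed

lemma rtrace_bound: "\<exists>c>0. \<forall>x. absF (rtrace D x) \<le> c * \<nu> x"
proof -
  obtain c where c: "c > 0" "\<And>x. max_norm x \<le> c * \<nu> x" using max_norm_le_nu_linear by blast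
  have "absF (rtrace D x) \<le> c * \<nu> x" for x
  proof -
    have "absF 2 \<le> 1" using absF_of_nat_le[of 2] by simp
    hence "absF (rtrace D x) \<le> absF (cr x 1)" by (simp add: rtrace_eq abs_mult mult_left_le_one_le abs_nonneg)
    thus ?thesis using absF_cr_le_max_norm[of x 1] c(2)[of x] by linarith
  qed
  thus ?thesis using c(1) by blast
qed

lemma trace_character_trivial_near_0:
  assumes "nontrivial_additive_character absF \<psi>"
  shows "\<exists>e>0. \<forall>x. \<nu> x \<le> e \<longrightarrow> \<psi> (rtrace D x) = 1"
proof -
  obtain e where e: "e > 0" "\<And>x. absF x \<le> e \<Longrightarrow> \<psi> x = 1"
    using additive_character_trivial_near_0[OF assms] by blast
  obtain c where c: "c > 0" "\<And>x. absF (rtrace D x) \<le> c * \<nu> x" using rtrace_bound by blast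
  show ?thesis
  proof (intro exI[of _ "e / c"] conjI allI impI)
    fix x assume "\<nu> x \<le> e / c"
    hence "c * \<nu> x \<le> e" using c(1) by (simp add: pos_le_divide_eq mult.commute)
    thus "\<psi> (rtrace D x) = 1" using e(2) c(2)[of x] by simp
  qed (use e c in simp)
qed

lemma trace_character_nontrivial:
  assumes "nontrivial_additive_character absF \<psi>"
  shows "\<exists>x. \<psi> (rtrace D x) \<noteq> 1"
proof -
  obtain t where t: "\<psi> t \<noteq> 1" using assms unfolding nontrivial_additive_character_def by blast
  have "rtrace D (emb (t / 2)) = t" by (simp add: rtrace_eq cr_emb)
  thus ?thesis using t by metis
qed

lemma norm_character_trivial_near_1:
  assumes "unitary_character absF \<omega>"
  shows "\<exists>e>0. \<forall>x. \<nu> (x - 1) \<le> e \<longrightarrow> \<omega> (rnorm D x) = 1"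
proof -
  obtain e where e: "e > 0" "\<And>x. absF (x - 1) \<le> e \<Longrightarrow> \<omega> x = 1"
    using unitary_character_trivial_near_1[OF assms] by blast
  obtain c where c: "c > 0" "\<And>x. absF (rtrace D x) \<le> c * \<nu> x" using rtrace_bound by blast
  \<comment> \<open>The reduced norm of \<open>1 + y\<close> is 1 plus the trace and the norm of
    \<open>y\<close>. The bound \<open>e / c\<close> controls the trace; the bounds 1 and
    \<open>e\<close> together control the norm, whose absolute value is the square of
    \<open>\<nu> y\<close>.\<close>
  show ?thesis
  proof (intro exI[of _ "min (e / c) (min 1 e)"] conjI allI impI)
    fix x assume x: "\<nu> (x - 1) \<le> min (e / c) (min 1 e)"
    define y where "y = x - 1"
    have "rnorm D (y + 1) = 1 + rtrace D y + rnorm D y"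
      using cr_emb[of 1] by (simp add: rnorm_eq rtrace_eq cr_add power2_eq_square algebra_simps)
    hence "rnorm D x - 1 = rtrace D y + rnorm D y" by (simp add: y_def)
    moreover have "absF (rtrace D y) \<le> e"
      using c(2)[of y] x c(1) by (simp add: y_def pos_le_divide_eq mult.commute)
    moreover have "absF (rnorm D y) \<le> e"
    proof -
      have "(\<nu> y)\<^sup>2 \<le> 1 * e" unfolding power2_eq_square using x by (intro mult_mono) (auto simp: y_def)
      thus ?thesis by (simp add: nu_sq)
    qed
    ultimately show "\<omega> (rnorm D x) = 1" using abs_ultra[of "rtrace D y" "rnorm D y"] by (intro e(2)) auto
  qed (use e c in simp)
qed

end

section \<open>The topological group \<open>GL\<^sub>n(D)\<close>\<close>

lemma (in group) r_coset_eqI: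
  assumes "subgroup H G" "x \<in> carrier G" "y \<in> H #> x" shows "H #> y = H #> x"
  using repr_independence[OF assms(3,2,1)] by simp

lemma (in group) r_coset_eqD:
  assumes "subgroup H G" "x \<in> carrier G" "y \<in> carrier G" "H #> x = H #> y"
  shows "x \<otimes> inv y \<in> H"
proof -
  have "x \<in> H #> y" using rcos_self[OF assms(2,1)] assms(4) by simp
  then obtain h where "h \<in> H" "x = h \<otimes> y" unfolding r_coset_def by blast
  thus ?thesis using assms subgroup.mem_carrier[OF assms(1)] by (simp add: m_assoc)
qed

text \<open>With \<open>t X\<close> a representative of the coset \<open>X\<close> of
  \<open>B\<close>, pairs of a coset of \<open>B\<close> in \<open>A\<close> and a coset of
  \<open>C\<close> in \<open>B\<close> correspond to the cosets of \<open>C\<close> in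
  \<open>A\<close>. The bijection also covers infinite index, where \<open>card\<close> is
  0.\<close>

lemma sub_index_mult:
  fixes G :: "'a monoid" (structure)
  assumes G: "group G" and A: "subgroup A G" and B: "subgroup B G" and C: "subgroup C G" and CB: "C \<subseteq> B" and BA: "B \<subseteq> A"
  shows "sub_index G A C = sub_index G A B * sub_index G B C"
proof -
  interpret group G by (rule G)
  have cA: "a \<in> carrier G" if "a \<in> A" for a by (rule subgroup.mem_carrier[OF A that])
  have cB: "a \<in> carrier G" if "a \<in> B" for a using that BA cA by blast
  have cC: "a \<in> carrier G" if "a \<in> C" for a using that CB cB by blast
  have Cg: "C \<subseteq> carrier G" and Bg: "B \<subseteq> carrier G" using cC cB by auto
  let ?AB = "(\<lambda>x. B #> x) ` A" and ?BC = "(\<lambda>x. C #> x) ` B" and ?AC = "(\<lambda>x. C #> x) ` A"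
  define t where "t X = (SOME x. x \<in> A \<and> B #> x = X)" for X
  have t: "t X \<in> A" "B #> t X = X" if "X \<in> ?AB" for X
  proof -
    have "\<exists>x. x \<in> A \<and> B #> x = X" using that by blast
    hence "t X \<in> A \<and> B #> t X = X" unfolding t_def by (rule someI_ex)
    thus "t X \<in> A" "B #> t X = X" by auto
  qed
  have "bij_betw (\<lambda>(X, Y). Y #> t X) (?AB \<times> ?BC) ?AC"
    unfolding bij_betw_def
  proof
    show "inj_on (\<lambda>(X, Y). Y #> t X) (?AB \<times> ?BC)"
    proof (rule inj_onI, clarify)
      fix x b x' b' assume x: "x \<in> A" and b: "b \<in> B" and x': "x' \<in> A" and b': "b' \<in> B"
        and eq: "C #> b #> t (B #> x) = C #> b' #> t (B #> x')"
      let ?t = "t (B #> x)" and ?t' = "t (B #> x')"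
      have tA: "?t \<in> A" "?t' \<in> A" "B #> ?t = B #> x" "B #> ?t' = B #> x'" using t x x' by auto
      have "C #> (b \<otimes> ?t) = C #> (b' \<otimes> ?t')"
        using eq coset_mult_assoc[OF Cg cB cA] b b' tA by simp
      hence mem: "(b \<otimes> ?t) \<otimes> inv (b' \<otimes> ?t') \<in> C"
        by (intro r_coset_eqD[OF C]) (use cA cB b b' tA in auto)
      hence "(b \<otimes> ?t) \<otimes> inv (b' \<otimes> ?t') \<in> B" using CB by blast
      hence "inv b \<otimes> ((b \<otimes> ?t) \<otimes> inv (b' \<otimes> ?t')) \<otimes> b' \<in> B"
        using b b' B by (meson subgroup.m_closed subgroup.m_inv_closed)
      moreover have "inv b \<otimes> ((b \<otimes> ?t) \<otimes> inv (b' \<otimes> ?t')) \<otimes> b' = ?t \<otimes> inv ?t'"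
        using cA[OF tA(1)] cA[OF tA(2)] cB[OF b] cB[OF b']
        by (simp add: m_assoc inv_mult_group) (simp add: m_assoc[symmetric])
      ultimately have tt: "?t \<otimes> inv ?t' \<in> B" by simp
      have "?t \<in> B #> ?t'"
        using rcosI[OF tt Bg cA[OF tA(2)]] cA[OF tA(1)] cA[OF tA(2)] by (simp add: m_assoc)
      hence "B #> ?t = B #> ?t'" by (rule r_coset_eqI[OF B cA[OF tA(2)]])
      hence BX: "B #> x = B #> x'" using tA by simp
      hence teq: "?t = ?t'" by simp
      have "b \<otimes> inv b' = (b \<otimes> ?t) \<otimes> inv (b' \<otimes> ?t')"
        using cA[OF tA(2)] cB[OF b] cB[OF b'] teq
        by (simp add: m_assoc inv_mult_group) (simp add: m_assoc[symmetric])
      hence "b \<otimes> inv b' \<in> C" using mem by simp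
      hence "b \<in> C #> b'"
        using rcosI[OF _ Cg cB[OF b'], of "b \<otimes> inv b'"] cB[OF b] cB[OF b'] by (simp add: m_assoc)
      hence "C #> b = C #> b'" by (rule r_coset_eqI[OF C cB[OF b']])
      with BX show "B #> x = B #> x' \<and> C #> b = C #> b'" by simp
    qed
    show "(\<lambda>(X, Y). Y #> t X) ` (?AB \<times> ?BC) = ?AC"
    proof (intro equalityI subsetI)
      fix Z assume "Z \<in> (\<lambda>(X, Y). Y #> t X) ` (?AB \<times> ?BC)"
      then obtain X b where X: "X \<in> ?AB" "b \<in> B" "Z = C #> b #> t X" by auto
      hence "Z = C #> (b \<otimes> t X)" using coset_mult_assoc[OF Cg cB cA] t by simp
      moreover have "b \<otimes> t X \<in> A" using X t BA A by (meson subgroup.m_closed subsetD)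
      ultimately show "Z \<in> ?AC" by blast
    next
      fix Z assume "Z \<in> ?AC"
      then obtain a where a: "a \<in> A" "Z = C #> a" by blast
      let ?t = "t (B #> a)"
      have tA: "?t \<in> A" "B #> ?t = B #> a" using t a by auto
      have "a \<otimes> inv ?t \<in> B" using r_coset_eqD[OF B, of a ?t] a tA cA by simp
      moreover have "Z = C #> (a \<otimes> inv ?t) #> ?t"
        using coset_mult_assoc[OF Cg, of "a \<otimes> inv ?t" ?t] cA[OF a(1)] cA[OF tA(1)] a by (simp add: m_assoc)
      ultimately show "Z \<in> (\<lambda>(X, Y). Y #> t X) ` (?AB \<times> ?BC)" using a(1) by force
    qed
  qed
  hence "card (?AB \<times> ?BC) = card ?AC" by (rule bij_betw_same_card)
  thus ?thesis by (simp add: sub_index_def card_cartesian_product)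
qed

lemma sub_index_conj:
  fixes G :: "'a monoid" (structure)
  assumes G: "group G" and A: "A \<subseteq> carrier G" and B: "subgroup B G" and p: "p \<in> carrier G"
  defines "c \<equiv> (\<lambda>u. p \<otimes> u \<otimes> inv p)"
  shows "sub_index G (c ` A) (c ` B) = sub_index G A B"
proof -
  interpret group G by (rule G)
  have Bg: "B \<subseteq> carrier G" using B by (rule subgroup.subset)
  have inj: "inj_on c (carrier G)" 
  proof (rule inj_on_inverseI)
    fix x assume "x \<in> carrier G"
    thus "inv p \<otimes> c x \<otimes> p = x" unfolding c_def using p
      by (simp add: m_assoc) (simp add: m_assoc[symmetric])
  qed
  have cm: "c (x \<otimes> y) = c x \<otimes> c y" if "x \<in> carrier G" "y \<in> carrier G" for x y
    unfolding c_def using that p by (simp add: m_assoc) (simp add: m_assoc[symmetric])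
  have "c ` B #> c x = c ` (B #> x)" if "x \<in> carrier G" for x
  proof -
    have "c b \<otimes> c x = c (b \<otimes> x)" if "b \<in> B" for b using cm that Bg \<open>x \<in> carrier G\<close> by auto
    hence "(\<Union>h\<in>B. {c h \<otimes> c x}) = (\<Union>h\<in>B. {c (h \<otimes> x)})" by simp
    thus ?thesis unfolding r_coset_def by (simp add: image_UN)
  qed
  hence "(\<lambda>x. c ` B #> c x) ` A = (\<lambda>x. c ` (B #> x)) ` A"
    using A by (intro image_cong) auto
  hence eq: "(\<lambda>x. c ` B #> x) ` c ` A = (`) c ` ((\<lambda>x. B #> x) ` A)"
    unfolding image_image .
  have "inj_on ((`) c) ((\<lambda>x. B #> x) ` A)"
  proof (rule inj_onI)
    fix X Y assume XY: "X \<in> (\<lambda>x. B #> x) ` A" "Y \<in> (\<lambda>x. B #> x) ` A" and eq: "c ` X = c ` Y"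
    have cos: "B #> x \<subseteq> carrier G" if "x \<in> A" for x using r_coset_subset_G[OF Bg] that A by auto
    have "X \<subseteq> carrier G" "Y \<subseteq> carrier G" using XY cos by auto
    thus "X = Y" using inj_on_image_eq_iff[OF inj] eq by simp
  qed
  thus ?thesis unfolding sub_index_def eq by (rule card_image)
qed

section \<open>The group \<open>GL\<close> and its congruence subgroups\<close>

lemma in_carrier_GL [simp]: "A \<in> carrier GL \<longleftrightarrow> invertible A"
  and mult_GL [simp]: "A \<otimes>\<^bsub>GL\<^esub> B = A ** B" and one_GL [simp]: "\<one>\<^bsub>GL\<^esub> = mat 1"
  by (simp_all add: GL_def)

lemma invertible_matrix_mult:
  fixes A B :: "'a::semiring_1^'n^'n"
  assumes "invertible A" "invertible B" shows "invertible (A ** B)"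
proof -
  obtain A' B' where "A ** A' = mat 1" "A' ** A = mat 1" "B ** B' = mat 1" "B' ** B = mat 1"
    using assms unfolding invertible_def by blast
  hence "(A ** B) ** (B' ** A') = mat 1" "(B' ** A') ** (A ** B) = mat 1"
    by (metis matrix_mul_assoc matrix_mul_lid)+
  thus ?thesis unfolding invertible_def by blast
qed

lemma group_GL: "group (GL :: ('a::division_ring^'n^'n) monoid)"
proof (rule groupI)
  fix A :: "'a^'n^'n" assume "A \<in> carrier GL"
  then obtain A' where A': "A ** A' = mat 1" "A' ** A = mat 1" unfolding in_carrier_GL invertible_def by blast
  hence "invertible A'" unfolding invertible_def by blast
  thus "\<exists>B\<in>carrier GL. B \<otimes>\<^bsub>GL\<^esub> A = \<one>\<^bsub>GL\<^esub>" using A' by auto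
next
  have "mat 1 ** mat 1 = (mat 1 :: 'a^'n^'n)" by simp
  thus "\<one>\<^bsub>GL\<^esub> \<in> carrier (GL :: ('a^'n^'n) monoid)" by (auto simp: invertible_def)
qed (auto simp: matrix_mul_assoc intro: invertible_matrix_mult)

interpretation GL: group "GL :: ('a::division_ring^'n^'n) monoid" by (rule group_GL)

lemma GL_inv_eqI:
  fixes A B :: "'a::division_ring^'n^'n"
  assumes "A ** B = mat 1" "B ** A = mat 1"
  shows "invertible A" "inv\<^bsub>GL\<^esub> A = B"
proof -
  show A: "invertible A" using assms unfolding invertible_def by blast
  have "invertible B" using assms unfolding invertible_def by blast
  thus "inv\<^bsub>GL\<^esub> A = B" using GL.inv_equality[of B A] A assms by simp
qed

lemma GL_inv [simp]:
  fixes A :: "'a::division_ring^'n^'n"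
  assumes "invertible A"
  shows "A ** inv\<^bsub>GL\<^esub> A = mat 1" "inv\<^bsub>GL\<^esub> A ** A = mat 1" "invertible (inv\<^bsub>GL\<^esub> A)"
  using GL.r_inv[of A] GL.l_inv[of A] GL.inv_closed[of A] assms by simp_all

lemma matrix_diff_mult: "(A - C) ** B = A ** B - C ** (B :: 'a::ring_1^'n^'m)"
  by (simp add: vec_eq_iff matrix_matrix_mult_def left_diff_distrib sum_subtractf)

lemma matrix_mult_diff: "B ** (A - C) = B ** A - B ** (C :: 'a::ring_1^'n^'m)"
  by (simp add: vec_eq_iff matrix_matrix_mult_def right_diff_distrib sum_subtractf)

lemma matrix_minus_one_mult: "(A - mat 1) ** B = A ** B - (B :: 'a::ring_1^'n^'n)"
  by (simp add: matrix_diff_mult)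

context p_adic_quaternion
begin

definition mat_le :: "'d^'n^'n \<Rightarrow> real \<Rightarrow> bool" where
  "mat_le A r \<longleftrightarrow> (\<forall>i j. \<nu> (A $ i $ j) \<le> r)"

lemma mat_le_exists: "\<exists>r>0. mat_le A r"
proof -
  define r where "r = Max (range (\<lambda>(i, j). \<nu> (A $ i $ j)))"
  have "\<nu> (A $ i $ j) \<le> r" for i j
    unfolding r_def by (intro Max_ge) (auto intro!: image_eqI[of _ _ "(i, j)"])
  hence "mat_le A (max r 1)" unfolding mat_le_def by (simp add: le_max_iff_disj)
  thus ?thesis by (intro exI[of _ "max r 1"]) auto
qed

lemma mat_le_mono: "mat_le A r \<Longrightarrow> r \<le> s \<Longrightarrow> mat_le A s"
  unfolding mat_le_def by (meson order_trans)

lemma mat_le_nonneg: "mat_le A r \<Longrightarrow> 0 \<le> r"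
  unfolding mat_le_def using nu_nonneg order_trans by blast

lemma mat_le_mult: "mat_le A r \<Longrightarrow> mat_le B s \<Longrightarrow> mat_le (A ** B) (r * s)"
proof -
  assume A: "mat_le A r" and B: "mat_le B s"
  have rs: "0 \<le> r" "0 \<le> s" using mat_le_nonneg A B by auto
  have "\<nu> (A $ i $ k * B $ k $ j) \<le> r * s" for i j k
    unfolding nu_mult using A B rs unfolding mat_le_def by (intro mult_mono) auto
  thus ?thesis unfolding mat_le_def matrix_matrix_mult_def using rs by (auto intro!: nu_sum_le)
qed

lemma mat_le_add: "mat_le A r \<Longrightarrow> mat_le B s \<Longrightarrow> mat_le (A + B) (max r s)"
  unfolding mat_le_def vector_add_component by (intro allI order_trans[OF nu_ultra] max.mono) auto

lemma mat_le_diff: "mat_le A r \<Longrightarrow> mat_le B s \<Longrightarrow> mat_le (A - B) (max r s)"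
  unfolding mat_le_def vector_minus_component by (intro allI order_trans[OF nu_diff_le] max.mono) auto

lemma mat_le_minus_commute: "mat_le (A - B) r = mat_le (B - A) r"
  unfolding mat_le_def by (simp add: nu_minus_commute)

lemma mat_le_one: "mat_le (mat 1) 1"
  unfolding mat_le_def mat_def by auto

text \<open>There are finitely many entries, so one radius serves for all of them. Only the entries
  of the matrix itself are controlled here; inverses near the identity are controlled in
  \<open>Kc_inv\<close>.\<close>

lemma openin_GL_top:
  fixes U :: "('d^'n^'n) set"
  shows "openin (GL_top absF D) U \<longleftrightarrow> U \<subseteq> {g. invertible g} \<and>
    (\<forall>g\<in>U. \<exists>e>0. \<forall>h. invertible h \<and> mat_le (h - g) e \<longrightarrow> h \<in> U)"
proof
  let ?f = "\<lambda>A (k, l). A $ k $ l"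
  assume "openin (GL_top absF D) U"
  then obtain W where W: "openin (product_topology (\<lambda>_. quat_top absF D) UNIV) W" "U = ?f -` W \<inter> {A. invertible A}"
    unfolding GL_top_def openin_pullback_topology by blast
  have "\<exists>e>0. \<forall>h. invertible h \<and> mat_le (h - g) e \<longrightarrow> h \<in> U" if "g \<in> U" for g
  proof -
    have "?f g \<in> W" using W(2) that by simp
    hence "\<exists>X. finite {k \<in> UNIV. X k \<noteq> topspace (quat_top absF D)} \<and>
        (\<forall>k\<in>UNIV. openin (quat_top absF D) (X k)) \<and> ?f g \<in> PiE UNIV X \<and> PiE UNIV X \<subseteq> W"
      using W(1) unfolding openin_product_topology_alt by simp
    then obtain X where X0: "\<forall>k\<in>UNIV. openin (quat_top absF D) (X k)" and X: "?f g \<in> PiE UNIV X" "PiE UNIV X \<subseteq> W"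
      by (elim exE conjE) (rule that)
    have "?f g k \<in> X k" for k using X(1) by (rule PiE_mem) simp
    hence "\<exists>e>0. \<forall>y. \<nu> (y - ?f g k) < e \<longrightarrow> y \<in> X k" for k
      using X0 unfolding openin_quat_top by blast
    then obtain e where e: "\<And>k. e k > 0" "\<And>k y. \<nu> (y - ?f g k) < e k \<Longrightarrow> y \<in> X k" by metis
    define d where "d = Min (range e)"
    have d: "d > 0" "\<And>k. d \<le> e k" using e(1) by (auto simp: d_def)
    have "h \<in> U" if h: "invertible h" "mat_le (h - g) (d / 2)" for h
    proof -
      have "?f h k \<in> X k" for k
      proof (rule e(2))
        obtain i j where k: "k = (i, j)" by force
        have "\<nu> (h $ i $ j - g $ i $ j) \<le> d / 2" using h(2) unfolding mat_le_def by simp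
        thus "\<nu> (?f h k - ?f g k) < e k" using d(1) d(2)[of k] k by simp
      qed
      hence "?f h \<in> PiE UNIV X" unfolding PiE_UNIV_domain by blast
      thus ?thesis using X(2) W(2) h(1) by blast
    qed
    thus ?thesis using d(1) by (intro exI[of _ "d / 2"]) auto
  qed
  thus "U \<subseteq> {g. invertible g} \<and> (\<forall>g\<in>U. \<exists>e>0. \<forall>h. invertible h \<and> mat_le (h - g) e \<longrightarrow> h \<in> U)"
    using W(2) by auto
next
  let ?f = "\<lambda>A (k, l). A $ k $ l"
  assume *: "U \<subseteq> {g. invertible g} \<and> (\<forall>g\<in>U. \<exists>e>0. \<forall>h. invertible h \<and> mat_le (h - g) e \<longrightarrow> h \<in> U)"
  hence "\<exists>e. \<forall>g\<in>U. e g > 0 \<and> (\<forall>h. invertible h \<and> mat_le (h - g) (e g) \<longrightarrow> h \<in> U)"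
    by (intro bchoice) auto
  then obtain e where e0: "\<forall>g\<in>U. e g > 0 \<and> (\<forall>h. invertible h \<and> mat_le (h - g) (e g) \<longrightarrow> h \<in> U)"
    by (rule exE)
  have e: "\<And>g. g \<in> U \<Longrightarrow> e g > 0"
    "\<And>g h. g \<in> U \<Longrightarrow> invertible h \<Longrightarrow> mat_le (h - g) (e g) \<Longrightarrow> h \<in> U" using e0 by auto
  define W where "W = (\<Union>g\<in>U. PiE UNIV (\<lambda>k. cb (e g) (?f g k)))"
  have "openin (product_topology (\<lambda>_. quat_top absF D) UNIV) W"
    unfolding W_def using openin_cb e(1) by (intro openin_Union) (auto simp: openin_PiE)
  moreover have "U = ?f -` W \<inter> {A. invertible A}"
  proof (intro equalityI subsetI)
    fix g assume g: "g \<in> U"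
    hence "?f g \<in> PiE UNIV (\<lambda>k. cb (e g) (?f g k))" using e(1)[OF g] by (auto simp: cb_def PiE_UNIV_domain)
    thus "g \<in> ?f -` W \<inter> {A. invertible A}" using g * unfolding W_def by blast
  next
    fix h assume h: "h \<in> ?f -` W \<inter> {A. invertible A}"
    then obtain g where g: "g \<in> U" "?f h \<in> PiE UNIV (\<lambda>k. cb (e g) (?f g k))" unfolding W_def by blast
    have "\<nu> (h $ i $ j - g $ i $ j) \<le> e g" for i j
      using g(2) by (auto simp: PiE_UNIV_domain cb_def Pi_iff dest!: spec[of _ "(i, j)"])
    hence "mat_le (h - g) (e g)" unfolding mat_le_def by simp
    thus "h \<in> U" using e(2) g(1) h by blast
  qed
  ultimately show "openin (GL_top absF D) U"
    unfolding GL_top_def openin_pullback_topology by blast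
qed

text \<open>The principal congruence subgroup of level \<open>r\<close>; it is a group for
  \<open>0 < r < 1\<close>.\<close>

definition Kc :: "real \<Rightarrow> ('d^'n^'n) set" where
  "Kc r = {g. invertible g \<and> mat_le (g - mat 1) r}"

lemma Kc_mat_le: assumes "g \<in> Kc r" "r < 1" shows "mat_le g 1"
proof -
  have "g = (g - mat 1) + mat 1" by simp
  thus ?thesis using mat_le_add[of "g - mat 1" r "mat 1" 1] mat_le_one assms by (simp add: Kc_def max_def)
qed

lemma Kc_inv:
  assumes g: "g \<in> Kc r" and r: "r < 1" shows "inv\<^bsub>GL\<^esub> g \<in> Kc r"
proof -
  let ?h = "inv\<^bsub>GL\<^esub> g"
  have inv: "invertible g" using g by (simp add: Kc_def)
  have eq: "mat 1 - ?h = (g - mat 1) ** ?h" using inv by (simp add: matrix_minus_one_mult)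
  define m where "m = Max (range (\<lambda>(i, j). \<nu> (?h $ i $ j)))"
  have mle: "mat_le ?h m"
    unfolding m_def mat_le_def by (intro allI Max_ge) (auto intro!: image_eqI[where x = "(_, _)"])
  have "m \<in> range (\<lambda>(i, j). \<nu> (?h $ i $ j))" unfolding m_def by (intro Max_in) auto
  then obtain i j where ij: "m = \<nu> (?h $ i $ j)" by auto
  have rg: "mat_le (g - mat 1) r" using g by (simp add: Kc_def)
  have le: "mat_le (mat 1 - ?h) (r * m)" unfolding eq by (rule mat_le_mult[OF rg mle])
  have "?h = mat 1 - (mat 1 - ?h)" by simp
  hence "mat_le ?h (max 1 (r * m))" using mat_le_diff[OF mat_le_one le] by simp
  hence "m \<le> max 1 (r * m)" unfolding ij mat_le_def by blast
  moreover have "r * m < m" if "m > 1" using that r by simp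
  ultimately have "m \<le> 1" by (smt (verit))
  hence "r * m \<le> r" using mat_le_nonneg[OF rg] by (simp add: mult_left_le)
  thus ?thesis using le mat_le_mono inv by (auto simp: Kc_def mat_le_minus_commute)
qed

lemma Kc_mult:
  assumes "g \<in> Kc r" "h \<in> Kc r" "r < 1" shows "g ** h \<in> Kc r"
proof -
  have eq: "g ** h - mat 1 = (g - mat 1) ** h + (h - mat 1)" by (simp add: matrix_minus_one_mult)
  have "mat_le ((g - mat 1) ** h) (r * 1)"
    using assms Kc_mat_le by (intro mat_le_mult) (auto simp: Kc_def)
  hence "mat_le (g ** h - mat 1) r"
    unfolding eq using mat_le_add[of "(g - mat 1) ** h" r "h - mat 1" r] assms by (simp add: Kc_def)
  thus ?thesis using assms by (auto simp: Kc_def intro: invertible_matrix_mult)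
qed

lemma one_in_Kc: "0 \<le> r \<Longrightarrow> mat 1 \<in> Kc r"
  using GL.one_closed by (simp add: Kc_def mat_le_def)

lemma subgroup_Kc:
  assumes "0 < r" "r < 1" shows "subgroup (Kc r) GL"
proof (rule GL.subgroupI)
  show "Kc r \<subseteq> carrier GL" by (auto simp: Kc_def)
  show "Kc r \<noteq> ({} :: ('d^'n^'n) set)" using one_in_Kc[of r] assms by auto
qed (use assms in \<open>auto simp: Kc_inv Kc_mult\<close>)

lemma openin_Kc:
  assumes "0 < r" shows "openin (GL_top absF D) (Kc r)"
  unfolding openin_GL_top
proof (intro conjI ballI)
  fix g :: "'d^'n^'n" assume g: "g \<in> Kc r"
  have "h \<in> Kc r" if "invertible h" "mat_le (h - g) r" for h
  proof -
    have "h - mat 1 = (h - g) + (g - mat 1)" by simp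
    thus ?thesis using mat_le_add[OF that(2), of "g - mat 1" r] g that by (simp add: Kc_def)
  qed
  thus "\<exists>e>0. \<forall>h. invertible h \<and> mat_le (h - g) e \<longrightarrow> h \<in> Kc r" using assms by blast
qed (auto simp: Kc_def)

lemma open_contains_Kc:
  assumes "openin (GL_top absF D) U" "mat 1 \<in> U"
  shows "\<exists>r>0. r < 1 \<and> Kc r \<subseteq> U"
proof -
  obtain e where e: "e > 0" "\<And>h. invertible h \<and> mat_le (h - mat 1) e \<Longrightarrow> h \<in> U"
    using assms unfolding openin_GL_top by blast
  have "Kc (min e (1/2)) \<subseteq> U" using e(2) mat_le_mono[OF _ min.cobounded1] by (fastforce simp: Kc_def)
  thus ?thesis using e(1) by (intro exI[of _ "min e (1/2)"]) auto
qed

lemma Kc_mono: "r \<le> s \<Longrightarrow> Kc r \<subseteq> Kc s"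
  by (auto simp: Kc_def intro: mat_le_mono)

lemma Kc_conj:
  assumes "mat_le a M" "mat_le (inv\<^bsub>GL\<^esub> a) M'" "invertible a" "g \<in> Kc r"
  shows "a ** g ** inv\<^bsub>GL\<^esub> a \<in> Kc (M * r * M')"
proof -
  have "a ** (g - mat 1) ** inv\<^bsub>GL\<^esub> a = a ** g ** inv\<^bsub>GL\<^esub> a - mat 1"
  proof -
    show ?thesis using assms(3) by (simp add: matrix_mult_diff matrix_diff_mult)
  qed
  moreover have "mat_le (a ** (g - mat 1) ** inv\<^bsub>GL\<^esub> a) (M * r * M')"
    using assms by (intro mat_le_mult) (auto simp: Kc_def)
  ultimately show ?thesis using assms by (auto simp: Kc_def intro!: invertible_matrix_mult)
qed

end

section \<open>The parabolic subgroup and its modulus character\<close>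

lemma GR_unip_nth [simp]:
  "GR_unip X Y Z $ 1 $ 1 = 1" "GR_unip X Y Z $ 1 $ 2 = X" "GR_unip X Y Z $ 1 $ 3 = Z"
  "GR_unip X Y Z $ 2 $ 1 = 0" "GR_unip X Y Z $ 2 $ 2 = 1" "GR_unip X Y Z $ 2 $ 3 = Y"
  "GR_unip X Y Z $ 3 $ 1 = 0" "GR_unip X Y Z $ 3 $ 2 = 0" "GR_unip X Y Z $ 3 $ 3 = 1"
  by (simp_all add: GR_unip_def)

lemma mat_nth: "mat h $ i $ j = (if i = j then h else 0)"
  by (simp add: mat_def)

lemma mult3_nth: "((A::'a::semiring_1^3^3) ** B) $ i $ j = A $ i $ 1 * B $ 1 $ j + A $ i $ 2 * B $ 2 $ j + A $ i $ 3 * B $ 3 $ j"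
  by (simp add: matrix_matrix_mult_def sum_3)

lemma mult2_nth: "((A::'a::semiring_1^2^2) ** B) $ i $ j = A $ i $ 1 * B $ 1 $ j + A $ i $ 2 * B $ 2 $ j"
  by (simp add: matrix_matrix_mult_def sum_2)

lemma eq3_iff: "(A::'a^3^3) = B \<longleftrightarrow>
    A $ 1 $ 1 = B $ 1 $ 1 \<and> A $ 1 $ 2 = B $ 1 $ 2 \<and> A $ 1 $ 3 = B $ 1 $ 3 \<and>
    A $ 2 $ 1 = B $ 2 $ 1 \<and> A $ 2 $ 2 = B $ 2 $ 2 \<and> A $ 2 $ 3 = B $ 2 $ 3 \<and>
    A $ 3 $ 1 = B $ 3 $ 1 \<and> A $ 3 $ 2 = B $ 3 $ 2 \<and> A $ 3 $ 3 = B $ 3 $ 3"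
  by (simp add: vec_eq_iff forall_3)

lemma eq2_iff: "(A::'a^2^2) = B \<longleftrightarrow>
    A $ 1 $ 1 = B $ 1 $ 1 \<and> A $ 1 $ 2 = B $ 1 $ 2 \<and> A $ 2 $ 1 = B $ 2 $ 1 \<and> A $ 2 $ 2 = B $ 2 $ 2"
  by (simp add: vec_eq_iff forall_2)

lemma GR_unip_mult: "GR_unip X Y Z ** GR_unip X' Y' Z' = GR_unip (X + X') (Y + Y') (Z + Z' + X * Y')"
  by (simp add: eq3_iff mult3_nth add_ac)

lemma GR_unip_0: "GR_unip 0 0 0 = mat 1"
  by (simp add: eq3_iff mat_nth)

lemma GR_unip_eq_iff: "GR_unip X Y Z = GR_unip X' Y' Z' \<longleftrightarrow> X = X' \<and> Y = Y' \<and> Z = Z'"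
  by (auto simp: eq3_iff)

lemma GR_unip_inv:
  "invertible (GR_unip X Y Z)" "inv\<^bsub>GL\<^esub> (GR_unip X Y Z) = GR_unip (- X) (- Y) (X * Y - Z)"
  using GL_inv_eqI[of "GR_unip X Y Z" "GR_unip (- X) (- Y) (X * Y - Z)"] by (simp_all add: GR_unip_mult GR_unip_0)

lemma mat_mult_mat: "mat h ** mat k = (mat (h * k) :: 'a::semiring_1^'n^'n)"
proof -
  have "(\<Sum>l\<in>UNIV. (if i = l then h else 0) * (if l = j then k else 0)) = (if i = j then h * k else 0)" for i j :: 'n
  proof -
    have "(\<Sum>l\<in>UNIV. (if i = l then h else 0) * (if l = j then k else 0)) =
        (\<Sum>l\<in>UNIV. if i = l then h * (if l = j then k else 0) else 0)"
      by (rule sum.cong) auto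
    thus ?thesis by simp
  qed
  thus ?thesis by (simp add: vec_eq_iff matrix_matrix_mult_def mat_def)
qed

lemma mat_inv:
  fixes h :: "'a::division_ring"
  assumes "h \<noteq> 0"
  shows "invertible (mat h :: 'a^'n^'n)" "inv\<^bsub>GL\<^esub> (mat h :: 'a^'n^'n) = mat (inverse h)"
  using GL_inv_eqI[of "mat h" "mat (inverse h)"] by (simp_all add: mat_mult_mat assms)

lemma mat_mult_GR_unip:
  "h \<noteq> 0 \<Longrightarrow> mat h ** GR_unip X Y Z =
     GR_unip (h * X * inverse h) (h * Y * inverse h) (h * Z * inverse h) ** mat h"
  by (simp add: eq3_iff mult3_nth mat_nth mult.assoc)

text \<open>The third rows \<open>(1,0,0)\<close> of \<open>wm\<close> and \<open>(0,1,0)\<close> of \<open>wm2\<close> represent the open and the middle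
  orbit.\<close>

definition wm :: "'d::division_ring^3^3" where
  "wm = vector [vector [0, 1, 0], vector [0, 0, 1], vector [1, 0, 0]]"

definition wmi :: "'d::division_ring^3^3" where
  "wmi = vector [vector [0, 0, 1], vector [1, 0, 0], vector [0, 1, 0]]"

definition wm2 :: "'d::division_ring^3^3" where
  "wm2 = vector [vector [1, 0, 0], vector [0, 0, 1], vector [0, 1, 0]]"

lemma wm_nth [simp]:
  "wm $ 1 $ 1 = 0" "wm $ 1 $ 2 = 1" "wm $ 1 $ 3 = 0" "wm $ 2 $ 1 = 0" "wm $ 2 $ 2 = 0" "wm $ 2 $ 3 = 1"
  "wm $ 3 $ 1 = 1" "wm $ 3 $ 2 = 0" "wm $ 3 $ 3 = 0"
  by (simp_all add: wm_def)

lemma wmi_nth [simp]: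
  "wmi $ 1 $ 1 = 0" "wmi $ 1 $ 2 = 0" "wmi $ 1 $ 3 = 1" "wmi $ 2 $ 1 = 1" "wmi $ 2 $ 2 = 0" "wmi $ 2 $ 3 = 0"
  "wmi $ 3 $ 1 = 0" "wmi $ 3 $ 2 = 1" "wmi $ 3 $ 3 = 0"
  by (simp_all add: wmi_def)

lemma wm2_nth [simp]:
  "wm2 $ 1 $ 1 = 1" "wm2 $ 1 $ 2 = 0" "wm2 $ 1 $ 3 = 0" "wm2 $ 2 $ 1 = 0" "wm2 $ 2 $ 2 = 0" "wm2 $ 2 $ 3 = 1"
  "wm2 $ 3 $ 1 = 0" "wm2 $ 3 $ 2 = 1" "wm2 $ 3 $ 3 = 0"
  by (simp_all add: wm2_def)

lemma wm_wmi [simp]: "wm ** wmi = mat 1" "wmi ** wm = mat 1" "wm2 ** wm2 = mat 1"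
  by (simp_all add: eq3_iff mult3_nth mat_nth)

lemma invertible_wm [simp]: "invertible wm" "invertible wmi" "invertible wm2"
  using GL_inv_eqI wm_wmi by blast+

lemma inv_wm [simp]: "inv\<^bsub>GL\<^esub> wm = wmi"
  using GL_inv_eqI wm_wmi by blast

text \<open>The part \<open>u(0,Y,0)\<close> of the stabilizer of the open base point becomes an
  element of the Levi subgroup whose upper left block is the Shalika unipotent.\<close>

lemma wm_GR_unip: "wm ** GR_unip 0 Y 0 = GR_unip Y 0 0 ** wm"
  by (simp add: eq3_iff mult3_nth)

lemma wm_mat: "wm ** mat h = mat h ** wm"
  by (simp add: eq3_iff mult3_nth mat_nth)

text \<open>The entry \<open>X\<close>, on which the character of R depends, lands in the corner,
  that is, in the unipotent radical of P, where the inducing representation is trivial.\<close>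

lemma wm2_GR_unip: "wm2 ** GR_unip X 0 Z = GR_unip Z 0 X ** wm2"
  by (simp add: eq3_iff mult3_nth)

lemma P21_iff: "g \<in> P21 \<longleftrightarrow> invertible g \<and> g $ 3 $ 1 = 0 \<and> g $ 3 $ 2 = 0"
  by (simp add: P21_def)

lemma P21_33:
  assumes "g \<in> P21" shows "g $ 3 $ 3 \<noteq> 0" "g $ 3 $ 3 * (inv\<^bsub>GL\<^esub> g) $ 3 $ 3 = 1"
proof -
  have "(g ** inv\<^bsub>GL\<^esub> g) $ 3 $ 3 = 1" using assms by (simp add: P21_iff mat_nth)
  thus "g $ 3 $ 3 * (inv\<^bsub>GL\<^esub> g) $ 3 $ 3 = 1" using assms by (simp add: mult3_nth P21_iff)
  thus "g $ 3 $ 3 \<noteq> 0" by auto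
qed

lemma P21_inv: assumes "g \<in> P21" shows "inv\<^bsub>GL\<^esub> g \<in> P21"
proof -
  have "(g ** inv\<^bsub>GL\<^esub> g) $ 3 $ 1 = 0" "(g ** inv\<^bsub>GL\<^esub> g) $ 3 $ 2 = 0" using assms by (simp_all add: P21_iff mat_nth)
  hence "g $ 3 $ 3 * (inv\<^bsub>GL\<^esub> g) $ 3 $ 1 = 0" "g $ 3 $ 3 * (inv\<^bsub>GL\<^esub> g) $ 3 $ 2 = 0"
    using assms by (simp_all add: mult3_nth P21_iff)
  thus ?thesis using assms P21_33[OF assms] by (simp add: P21_iff)
qed

lemma P21_mult: "g \<in> P21 \<Longrightarrow> h \<in> P21 \<Longrightarrow> g ** h \<in> P21"
  by (simp add: P21_iff mult3_nth invertible_matrix_mult)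

lemma P21_one: "mat 1 \<in> P21"
  using GL.one_closed by (simp add: P21_iff mat_nth)

lemma P21_GR_unip: "GR_unip X Y Z \<in> P21"
  by (simp add: P21_iff GR_unip_inv)

lemma P21_mat: "h \<noteq> 0 \<Longrightarrow> mat h \<in> P21"
  by (simp add: P21_iff mat_nth mat_inv)

lemma block2_nth [simp]:
  "block2 g $ 1 $ 1 = g $ 1 $ 1" "block2 g $ 1 $ 2 = g $ 1 $ 2" "block2 g $ 2 $ 1 = g $ 2 $ 1" "block2 g $ 2 $ 2 = g $ 2 $ 2"
  by (simp_all add: block2_def)

lemma block2_mult: "h \<in> P21 \<Longrightarrow> block2 (g ** h) = block2 g ** block2 h"
  by (simp add: eq2_iff mult2_nth mult3_nth P21_iff)

lemma P21_mult_33: "g \<in> P21 \<Longrightarrow> (g ** h) $ 3 $ 3 = g $ 3 $ 3 * h $ 3 $ 3"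
  by (simp add: mult3_nth P21_iff)

lemma block2_one: "block2 (mat 1) = mat 1" and block2_mat: "block2 (mat h) = mat h"
  and block2_GR_unip: "block2 (GR_unip X Y Z) = shalika_unip X"
  by (simp_all add: eq2_iff mat_nth shalika_unip_def)

lemma invertible_block2: assumes "g \<in> P21" shows "invertible (block2 g)"
proof -
  have "block2 g ** block2 (inv\<^bsub>GL\<^esub> g) = mat 1" "block2 (inv\<^bsub>GL\<^esub> g) ** block2 g = mat 1"
    using assms P21_inv[OF assms] by (simp_all add: block2_mult[symmetric] block2_one P21_iff)
  thus ?thesis unfolding invertible_def by blast
qed

lemma N21_eq: "N21 = {GR_unip 0 Y Z | Y Z. True}"
proof (intro equalityI subsetI)
  fix g :: "'a^3^3" assume "g \<in> N21"
  hence "g = GR_unip 0 (g $ 2 $ 3) (g $ 1 $ 3)"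
    by (simp add: N21_def P21_iff eq3_iff eq2_iff mat_nth)
  thus "g \<in> {GR_unip 0 Y Z | Y Z. True}" by blast
qed (auto simp: N21_def P21_GR_unip eq2_iff mat_nth)

text \<open>The group \<open>N21\<close> consists of columns \<open>(Z, Y)\<close>, on which
  \<open>g\<close> acts by its upper left block from the left and by the inverse of
  \<open>g$3$3\<close> from the right. Multiplying by \<open>g\<close> avoids writing out its
  inverse.\<close>

lemma P21_conj_N21:
  assumes "g \<in> P21"
  shows "g ** GR_unip 0 Y Z ** inv\<^bsub>GL\<^esub> g =
    GR_unip 0 ((g$2$1 * Z + g$2$2 * Y) * inverse (g$3$3)) ((g$1$1 * Z + g$1$2 * Y) * inverse (g$3$3))"
    (is "_ = ?u")
proof -
  have "g ** GR_unip 0 Y Z = ?u ** g"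
    using assms P21_33(1)[OF assms] by (simp add: eq3_iff mult3_nth P21_iff mult.assoc)
  hence "g ** GR_unip 0 Y Z ** inv\<^bsub>GL\<^esub> g = ?u ** (g ** inv\<^bsub>GL\<^esub> g)" by (simp add: matrix_mul_assoc)
  thus ?thesis using assms by (simp add: P21_iff)
qed

lemma open_cell_decomp:
  assumes "invertible g" "g $ 3 $ 1 \<noteq> 0"
  shows "\<exists>p\<in>P21. g = p ** wm ** GR_unip (inverse (g$3$1) * g$3$2) 0 (inverse (g$3$1) * g$3$3)"
proof -
  define u where "u = GR_unip (inverse (g$3$1) * g$3$2) 0 (inverse (g$3$1) * g$3$3)"
  define v where "v = GR_unip (- (inverse (g$3$1) * g$3$2)) 0 (- (inverse (g$3$1) * g$3$3))"
  have vu: "v ** u = mat 1" by (simp add: u_def v_def GR_unip_mult GR_unip_0)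
  define p where "p = g ** v ** wmi"
  have "p ** wm ** u = g ** v ** (wmi ** wm) ** u" by (simp only: p_def matrix_mul_assoc)
  also have "\<dots> = g ** (v ** u)" by (simp only: wm_wmi matrix_mul_rid matrix_mul_assoc)
  finally have "g = p ** wm ** u" using vu by simp
  moreover have "p \<in> P21"
    using assms by (simp add: P21_iff p_def mult3_nth v_def invertible_matrix_mult GR_unip_inv mult.assoc[symmetric])
  ultimately show ?thesis unfolding u_def by blast
qed

lemma middle_cell_decomp:
  assumes "invertible g" "g $ 3 $ 1 = 0" "g $ 3 $ 2 \<noteq> 0"
  shows "\<exists>p\<in>P21. \<exists>z. g = p ** wm2 ** GR_unip 0 z 0"
proof -
  define z where "z = inverse (g$3$2) * g$3$3"
  have vu: "GR_unip 0 (- z) 0 ** GR_unip 0 z 0 = mat 1" by (simp add: GR_unip_mult GR_unip_0)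
  define p where "p = g ** GR_unip 0 (- z) 0 ** wm2"
  have "p ** wm2 ** GR_unip 0 z 0 = g ** GR_unip 0 (- z) 0 ** (wm2 ** wm2) ** GR_unip 0 z 0"
    by (simp only: p_def matrix_mul_assoc)
  also have "\<dots> = g ** (GR_unip 0 (- z) 0 ** GR_unip 0 z 0)" by (simp only: wm_wmi matrix_mul_rid matrix_mul_assoc)
  finally have "g = p ** wm2 ** GR_unip 0 z 0" using vu by simp
  moreover have "p \<in> P21"
    using assms by (simp add: P21_iff p_def mult3_nth z_def invertible_matrix_mult GR_unip_inv mult.assoc[symmetric])
  ultimately show ?thesis by blast
qed

section \<open>Volumes of subgroups of the unipotent radical and the modulus character\<close>

context p_adic_quaternion
begin

definition box :: "real \<Rightarrow> real \<Rightarrow> ('d^3^3) set" where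
  "box r s = {GR_unip 0 Y Z | Y Z. \<nu> Z \<le> r \<and> \<nu> Y \<le> s}"

lemma GR_unip_in_box: "GR_unip 0 Y Z \<in> box r s \<longleftrightarrow> \<nu> Z \<le> r \<and> \<nu> Y \<le> s"
  by (auto simp: box_def GR_unip_eq_iff)

lemma box_mono: "r \<le> r' \<Longrightarrow> s \<le> s' \<Longrightarrow> box r s \<subseteq> box r' s'"
  unfolding box_def by force

lemma box_subset_N21: "box r s \<subseteq> N21"
  by (auto simp: box_def N21_eq)

lemma subgroup_box:
  assumes "0 \<le> r" "0 \<le> s" shows "subgroup (box r s) GL"
proof (rule GL.subgroupI)
  show "box r s \<subseteq> carrier GL" by (auto simp: box_def GR_unip_inv)
  have "GR_unip 0 0 0 \<in> box r s" using assms by (simp add: GR_unip_in_box)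
  thus "box r s \<noteq> {}" by blast
  show "inv\<^bsub>GL\<^esub> a \<in> box r s" if "a \<in> box r s" for a
    using that by (auto simp: box_def GR_unip_inv GR_unip_eq_iff)
  show "a \<otimes>\<^bsub>GL\<^esub> b \<in> box r s" if "a \<in> box r s" "b \<in> box r s" for a b
  proof -
    obtain Y Z Y' Z' where "a = GR_unip 0 Y Z" "b = GR_unip 0 Y' Z'" "\<nu> Z \<le> r" "\<nu> Y \<le> s" "\<nu> Z' \<le> r" "\<nu> Y' \<le> s"
      using \<open>a \<in> box r s\<close> \<open>b \<in> box r s\<close> unfolding box_def by blast
    thus ?thesis using nu_ultra[of Z Z'] nu_ultra[of Y Y'] by (auto simp: GR_unip_mult GR_unip_in_box)
  qed
qed

text \<open>The coset of \<open>GR_unip 0 Y Z\<close> depends only on the balls of radius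
  \<open>e\<close> that contain \<open>Y\<close> and \<open>Z\<close>, and finitely many such balls
  cover the ball of radius \<open>R\<close>.\<close>

lemma finite_box_cosets:
  assumes "e > 0" shows "finite ((\<lambda>x. box e e #>\<^bsub>GL\<^esub> x) ` box R R)"
proof -
  obtain S where S: "finite S" "cb R 0 \<subseteq> (\<Union>x\<in>S. cb e x)" using finite_cover_cb[OF assms] by blast
  have "(\<lambda>x. box e e #>\<^bsub>GL\<^esub> x) ` box R R \<subseteq> (\<lambda>(s, t). box e e #>\<^bsub>GL\<^esub> GR_unip 0 s t) ` (S \<times> S)"
  proof clarify
    fix x assume "x \<in> box R R"
    then obtain Y Z where x: "x = GR_unip 0 Y Z" "\<nu> Z \<le> R" "\<nu> Y \<le> R" unfolding box_def by blast
    have "Y \<in> cb R 0" "Z \<in> cb R 0" using x by (simp_all add: cb_def)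
    then obtain s t where st: "s \<in> S" "t \<in> S" "\<nu> (Y - s) \<le> e" "\<nu> (Z - t) \<le> e" using S(2) unfolding cb_def by blast
    have "GR_unip 0 (Y - s) (Z - t) \<in> box e e" using st by (simp add: GR_unip_in_box)
    moreover have "x = GR_unip 0 (Y - s) (Z - t) \<otimes>\<^bsub>GL\<^esub> GR_unip 0 s t" by (simp add: x GR_unip_mult)
    ultimately have "x \<in> box e e #>\<^bsub>GL\<^esub> GR_unip 0 s t" unfolding r_coset_def by blast
    hence "box e e #>\<^bsub>GL\<^esub> x = box e e #>\<^bsub>GL\<^esub> GR_unip 0 s t"
      using assms by (intro GL.r_coset_eqI subgroup_box) (auto simp: GR_unip_inv)
    thus "box e e #>\<^bsub>GL\<^esub> x \<in> (\<lambda>(s, t). box e e #>\<^bsub>GL\<^esub> GR_unip 0 s t) ` (S \<times> S)" using st by auto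
  qed
  thus ?thesis using S(1) by (meson finite_SigmaI finite_imageI finite_subset)
qed

text \<open>All compact open subgroups of \<open>N21\<close> are \<open>sandwiched\<close>. For such subgroups \<open>gen_index A B\<close> is the
  ratio of the volumes of \<open>A\<close> and \<open>B\<close>.\<close>

definition sandwiched :: "('d^3^3) set \<Rightarrow> bool" where
  "sandwiched U \<longleftrightarrow> subgroup U GL \<and> (\<exists>e>0. \<exists>R. box e e \<subseteq> U \<and> U \<subseteq> box R R)"

lemma sandwiched_box: "r > 0 \<Longrightarrow> s > 0 \<Longrightarrow> sandwiched (box r s)"
  unfolding sandwiched_def
  by (intro conjI subgroup_box exI[of _ "min r s"] exI[of _ "max r s"] box_mono) auto

lemma sandwiched_common:
  assumes "sandwiched A" "sandwiched B" "sandwiched C"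
  shows "\<exists>e>0. box e e \<subseteq> A \<and> box e e \<subseteq> B \<and> box e e \<subseteq> C"
proof -
  obtain a b c where "a > 0" "b > 0" "c > 0" "box a a \<subseteq> A" "box b b \<subseteq> B" "box c c \<subseteq> C"
    using assms unfolding sandwiched_def by blast
  moreover have "box (min a (min b c)) (min a (min b c)) \<subseteq> box a a"
    "box (min a (min b c)) (min a (min b c)) \<subseteq> box b b" "box (min a (min b c)) (min a (min b c)) \<subseteq> box c c"
    by (rule box_mono; simp)+
  ultimately show ?thesis by (intro exI[of _ "min a (min b c)"]) auto
qed

lemma sub_index_box_pos:
  assumes "sandwiched A" "e > 0" shows "sub_index GL A (box e e) > 0"
proof -
  obtain R where "A \<subseteq> box R R" using assms(1) unfolding sandwiched_def by blast
  hence "finite ((\<lambda>x. box e e #>\<^bsub>GL\<^esub> x) ` A)" using finite_box_cosets[OF assms(2), of R] by (meson finite_subset image_mono)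
  moreover have "A \<noteq> {}" using assms(1) unfolding sandwiched_def by (metis empty_iff subgroup.one_closed)
  ultimately show ?thesis unfolding sub_index_def by (simp add: card_gt_0_iff)
qed

definition gen_index :: "('d^3^3) set \<Rightarrow> ('d^3^3) set \<Rightarrow> real" where
  "gen_index A B = real (sub_index GL A (B \<inter> A)) / real (sub_index GL B (B \<inter> A))"

text \<open>Both indices over \<open>B \<inter> A\<close> are compared with indices over a small
  common box. The index of this box in \<open>B \<inter> A\<close> is a common factor; it is nonzero
  because all indices involved are finite.\<close>

lemma gen_index_eq:
  assumes A: "sandwiched A" and B: "sandwiched B" and e: "e > 0" "box e e \<subseteq> A" "box e e \<subseteq> B"
  shows "gen_index A B = real (sub_index GL A (box e e)) / real (sub_index GL B (box e e))"
proof -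
  have s: "subgroup A GL" "subgroup B GL" "subgroup (box e e) GL" "subgroup (B \<inter> A) GL"
    using A B e subgroup_box GL.subgroups_Inter_pair unfolding sandwiched_def by auto
  have 1: "sub_index GL A (box e e) = sub_index GL A (B \<inter> A) * sub_index GL (B \<inter> A) (box e e)"
    using e s by (intro sub_index_mult group_GL) auto
  have 2: "sub_index GL B (box e e) = sub_index GL B (B \<inter> A) * sub_index GL (B \<inter> A) (box e e)"
    using e s by (intro sub_index_mult group_GL) auto
  have "sub_index GL A (box e e) > 0" using A e(1) by (rule sub_index_box_pos)
  hence "sub_index GL (B \<inter> A) (box e e) > 0" unfolding 1 by simp
  thus ?thesis unfolding gen_index_def 1 2 by simp
qed

lemma gen_index_pos: assumes "sandwiched A" "sandwiched B" shows "gen_index A B > 0"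
proof -
  obtain e where "e > 0" "box e e \<subseteq> A" "box e e \<subseteq> B" using sandwiched_common[OF assms assms(2)] by blast
  thus ?thesis using gen_index_eq[OF assms] sub_index_box_pos assms by simp
qed

lemma gen_index_trans:
  assumes "sandwiched A" "sandwiched B" "sandwiched C"
  shows "gen_index A B * gen_index B C = gen_index A C"
proof -
  obtain e where e: "e > 0" "box e e \<subseteq> A" "box e e \<subseteq> B" "box e e \<subseteq> C" using sandwiched_common[OF assms] by blast
  have "sub_index GL B (box e e) > 0" using sub_index_box_pos assms e by blast
  thus ?thesis using gen_index_eq[of A B e] gen_index_eq[of B C e] gen_index_eq[of A C e] assms e by simp
qed

lemma gen_index_self: "sandwiched A \<Longrightarrow> gen_index A A = 1"
  using gen_index_trans[of A A A] gen_index_pos[of A A] by simp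

definition cj :: "'d^3^3 \<Rightarrow> 'd^3^3 \<Rightarrow> 'd^3^3" where
  "cj p u = p ** u ** inv\<^bsub>GL\<^esub> p"

lemma cj_box: assumes "p \<in> P21" shows "\<exists>M>0. \<forall>r. cj p ` box r r \<subseteq> box (M * r) (M * r)"
proof -
  obtain m where m: "m > 0" "mat_le p m" using mat_le_exists by blast
  define M where "M = m * inverse (\<nu> (p$3$3))"
  have d: "\<nu> (p$3$3) > 0" using P21_33(1)[OF assms] by (rule nu_pos)
  have "cj p ` box r r \<subseteq> box (M * r) (M * r)" for r
  proof clarify
    fix u assume "u \<in> box r r"
    then obtain Y Z where u: "u = GR_unip 0 Y Z" "\<nu> Z \<le> r" "\<nu> Y \<le> r" unfolding box_def by blast
    have r0: "0 \<le> r" using u nu_nonneg order_trans by blast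
    have "\<nu> ((a * Z + b * Y) * inverse (p$3$3)) \<le> M * r" if "\<nu> a \<le> m" "\<nu> b \<le> m" for a b
    proof -
      have "\<nu> (a * Z) \<le> m * r" "\<nu> (b * Y) \<le> m * r"
        unfolding nu_mult using that u m(1) by (auto intro!: mult_mono)
      hence "\<nu> (a * Z + b * Y) \<le> m * r" using nu_ultra[of "a * Z" "b * Y"] by simp
      hence "\<nu> (a * Z + b * Y) * inverse (\<nu> (p$3$3)) \<le> m * r * inverse (\<nu> (p$3$3))"
        by (rule mult_right_mono) simp
      thus ?thesis by (simp only: nu_mult nu_inverse M_def mult_ac)
    qed
    thus "cj p u \<in> box (M * r) (M * r)" using m(2)
      unfolding cj_def u P21_conj_N21[OF assms] GR_unip_in_box mat_le_def by blast
  qed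
  moreover have "M > 0" using m d by (simp add: M_def)
  ultimately show ?thesis by blast
qed

lemma cj_cj: "invertible p \<Longrightarrow> invertible q \<Longrightarrow> cj p (cj q u) = cj (p ** q) u"
  using GL.inv_mult_group[of p q] by (simp add: cj_def matrix_mul_assoc)

lemma cj_inv: "invertible p \<Longrightarrow> cj p (cj (inv\<^bsub>GL\<^esub> p) u) = u"
  using GL.inv_one by (simp add: cj_cj) (simp add: cj_def GL_inv_eqI(2)[of "mat 1" "mat 1"])

lemma subgroup_cj:
  assumes "invertible p" "subgroup U GL" shows "subgroup (cj p ` U) GL"
proof -
  have "cj p \<in> hom GL GL"
  proof (rule homI)
    fix x y :: "'d^3^3" assume "x \<in> carrier GL" "y \<in> carrier GL"
    have "cj p x ** cj p y = p ** x ** (inv\<^bsub>GL\<^esub> p ** p) ** y ** inv\<^bsub>GL\<^esub> p"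
      by (simp only: cj_def matrix_mul_assoc)
    thus "cj p (x \<otimes>\<^bsub>GL\<^esub> y) = cj p x \<otimes>\<^bsub>GL\<^esub> cj p y" using assms(1) by (simp add: cj_def matrix_mul_assoc)
  qed (use assms(1) in \<open>auto simp: cj_def intro!: invertible_matrix_mult\<close>)
  then interpret group_hom GL GL "cj p" by unfold_locales
  show ?thesis using assms(2) by (rule subgroup_img_is_subgroup)
qed

lemma sandwiched_cj:
  assumes p: "p \<in> P21" and U: "sandwiched U" shows "sandwiched (cj p ` U)"
proof -
  have inv: "invertible p" using p by (simp add: P21_iff)
  obtain e R where eR: "e > 0" "box e e \<subseteq> U" "U \<subseteq> box R R" using U unfolding sandwiched_def by blast
  obtain M where M: "\<And>r. cj p ` box r r \<subseteq> box (M * r) (M * r)" using cj_box[OF p] by blast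
  obtain M' where M': "M' > 0" "\<And>r. cj (inv\<^bsub>GL\<^esub> p) ` box r r \<subseteq> box (M' * r) (M' * r)"
    using cj_box[OF P21_inv[OF p]] by blast
  have "box (e / M') (e / M') \<subseteq> cj p ` U"
  proof
    fix x assume "x \<in> box (e / M') (e / M')"
    hence "cj (inv\<^bsub>GL\<^esub> p) x \<in> box e e" using M'(2)[of "e / M'"] M'(1) by auto
    hence "cj (inv\<^bsub>GL\<^esub> p) x \<in> U" using eR by blast
    thus "x \<in> cj p ` U" using cj_inv[OF inv, of x] by (metis imageI)
  qed
  moreover have "cj p ` U \<subseteq> box (M * R) (M * R)" using M[of R] eR(3) by blast
  moreover have "subgroup (cj p ` U) GL" using U inv unfolding sandwiched_def by (blast intro: subgroup_cj)
  moreover have "e / M' > 0" using eR M' by simp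
  ultimately show ?thesis unfolding sandwiched_def by blast
qed

lemma gen_index_cj:
  assumes "p \<in> P21" "sandwiched A" "sandwiched B"
  shows "gen_index (cj p ` A) (cj p ` B) = gen_index A B"
proof -
  have p: "p \<in> carrier GL" using assms(1) by (simp add: P21_iff)
  have s: "subgroup A GL" "subgroup B GL" "subgroup (B \<inter> A) GL"
    using assms GL.subgroups_Inter_pair unfolding sandwiched_def by auto
  have "inj_on (cj p) UNIV"
    by (rule inj_on_inverseI[of _ "cj (inv\<^bsub>GL\<^esub> p)"])
      (metis GL.inv_inv GL_inv(3) cj_inv in_carrier_GL p)
  hence "cj p ` B \<inter> cj p ` A = cj p ` (B \<inter> A)" by (metis image_Int)
  moreover have "sub_index GL (cj p ` C) (cj p ` (B \<inter> A)) = sub_index GL C (B \<inter> A)" if "subgroup C GL" for C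
    using sub_index_conj[OF group_GL subgroup.subset[OF that] s(3) p] by (simp add: cj_def[abs_def])
  ultimately show ?thesis unfolding gen_index_def using s by simp
qed

definition \<delta> :: "'d^3^3 \<Rightarrow> real" where "\<delta> p = gen_index (cj p ` box 1 1) (box 1 1)"

text \<open>Passing from \<open>U\<close> to the unit box introduces the ratio of their volumes once
  for the conjugates and once, inverted, for the groups themselves. Conjugation preserves ratios, so
  the two cancel.\<close>

lemma gen_index_cj_self:
  assumes p: "p \<in> P21" and U: "sandwiched U"
  shows "gen_index (cj p ` U) U = \<delta> p"
proof -
  let ?V = "box 1 1"
  have V: "sandwiched ?V" by (rule sandwiched_box) auto
  have "gen_index (cj p ` U) U = gen_index (cj p ` U) (cj p ` ?V) * (gen_index (cj p ` ?V) ?V * gen_index ?V U)"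
    using gen_index_trans sandwiched_cj[OF p] U V by simp
  also have "\<dots> = \<delta> p * (gen_index U ?V * gen_index ?V U)"
    using gen_index_cj[OF p U V] by (simp add: \<delta>_def)
  also have "gen_index U ?V * gen_index ?V U = 1" using gen_index_trans[OF U V U] gen_index_self[OF U] by simp
  finally show ?thesis by simp
qed

lemma \<delta>_mult: assumes "p \<in> P21" "q \<in> P21" shows "\<delta> (p ** q) = \<delta> p * \<delta> q"
proof -
  let ?V = "box 1 1"
  have V: "sandwiched ?V" by (rule sandwiched_box) auto
  have "\<delta> (p ** q) = gen_index (cj p ` cj q ` ?V) ?V"
    unfolding \<delta>_def image_image using assms by (simp add: cj_cj P21_iff)
  also have "\<dots> = gen_index (cj p ` cj q ` ?V) (cj p ` ?V) * gen_index (cj p ` ?V) ?V"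
    by (rule gen_index_trans[symmetric]) (intro sandwiched_cj assms V)+
  also have "\<dots> = \<delta> q * \<delta> p"
    using gen_index_cj[OF assms(1) sandwiched_cj[OF assms(2) V] V] by (simp add: \<delta>_def)
  finally show ?thesis by simp
qed

lemma \<delta>_eq_1: "p \<in> P21 \<Longrightarrow> sandwiched U \<Longrightarrow> cj p ` U = U \<Longrightarrow> \<delta> p = 1"
  using gen_index_cj_self gen_index_self by metis

lemma cj_image_eqI:
  assumes "invertible p" "cj p ` U \<subseteq> U" "cj (inv\<^bsub>GL\<^esub> p) ` U \<subseteq> U" shows "cj p ` U = U"
proof (intro equalityI subsetI)
  fix x assume "x \<in> U"
  hence "cj (inv\<^bsub>GL\<^esub> p) x \<in> U" using assms(3) by blast
  thus "x \<in> cj p ` U" using cj_inv[OF assms(1), of x] by (metis imageI)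
qed (use assms in blast)

lemma \<delta>_GR_unip: "\<delta> (GR_unip X Y Z) = 1"
proof -
  \<comment> \<open>Conjugation by \<open>u(X,Y,Z)\<close> shears the corner entry by
    \<open>X\<close> times an element of norm at most 1. A radius of at least \<open>\<nu> X\<close>
    in the corner absorbs this, which is the purpose of two independent radii in
    \<open>box\<close>.\<close>
  define U where "U = box (max 1 (\<nu> X)) 1"
  have sub: "cj (GR_unip X Y Z) ` box (max 1 a) 1 \<subseteq> box (max 1 a) 1" if Xa: "\<nu> X \<le> max 1 a" for X Y Z a
  proof clarify
    fix u assume "u \<in> box (max 1 a) 1"
    then obtain Y' Z' where u: "u = GR_unip 0 Y' Z'" "\<nu> Z' \<le> max 1 a" "\<nu> Y' \<le> 1"
      unfolding box_def by blast
    have "\<nu> (X * Y') \<le> max 1 a * 1" unfolding nu_mult using u Xa by (intro mult_mono) auto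
    hence "\<nu> (Z' + X * Y') \<le> max 1 a" using nu_ultra[of Z' "X * Y'"] u by (auto simp: max_def split: if_splits)
    thus "cj (GR_unip X Y Z) u \<in> box (max 1 a) 1"
      unfolding cj_def u P21_conj_N21[OF P21_GR_unip] by (simp add: GR_unip_in_box u)
  qed
  have "cj (GR_unip X Y Z) ` U = U"
    unfolding U_def by (rule cj_image_eqI) (simp_all only: GR_unip_inv, (rule sub, simp)+)
  thus ?thesis by (intro \<delta>_eq_1[of _ U] P21_GR_unip) (auto simp: U_def intro!: sandwiched_box)
qed

text \<open>Conjugation by \<open>h\<close> is an isometry of \<open>D\<close>. Hence the
  normalizing factor disappears from the action of \<open>diag(h,h,h)\<close>.\<close>

lemma \<delta>_mat: assumes "h \<noteq> 0" shows "\<delta> (mat h) = 1"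
proof -
  have sub: "cj (mat h) ` box 1 1 \<subseteq> box 1 1" if "h \<noteq> 0" for h
    using that by (auto simp: box_def cj_def P21_conj_N21[OF P21_mat[OF that]] mat_nth nu_conj GR_unip_eq_iff)
  have "cj (mat h) ` box 1 1 = box 1 1"
    by (rule cj_image_eqI) (use sub[OF assms] sub[of "inverse h"] assms in \<open>simp_all add: mat_inv\<close>)
  thus ?thesis by (intro \<delta>_eq_1[of _ "box 1 1"] P21_mat assms sandwiched_box) auto
qed

text \<open>Both \<open>p\<close> and its inverse have entries of norm at most 1, so
  \<open>p\<close> normalizes the unit box. This makes the inducing representation smooth together
  with its normalizing factor.\<close>

lemma \<delta>_Kc: assumes "p \<in> P21" "p \<in> Kc r" "0 < r" "r < 1" shows "\<delta> p = 1"
proof -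
  have sub: "cj p ` box 1 1 \<subseteq> box 1 1" if p: "p \<in> P21" "p \<in> Kc r" for p
  proof clarify
    fix u assume "u \<in> box 1 1"
    then obtain Y Z where u: "u = GR_unip 0 Y Z" "\<nu> Z \<le> 1" "\<nu> Y \<le> 1" unfolding box_def by blast
    have le: "\<nu> (p $ i $ j) \<le> 1" for i j using Kc_mat_le[OF p(2) assms(4)] unfolding mat_le_def by blast
    \<comment> \<open>Two numbers at most 1 with product 1 are both 1, so the division by
      \<open>p$3$3\<close> in the conjugation formula enlarges nothing.\<close>
    have "\<nu> (p$3$3) * \<nu> ((inv\<^bsub>GL\<^esub> p) $ 3 $ 3) = 1" using P21_33(2)[OF p(1)] by (simp add: nu_mult[symmetric])
    moreover have "\<nu> ((inv\<^bsub>GL\<^esub> p) $ 3 $ 3) \<le> 1"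
      using Kc_mat_le[OF Kc_inv[OF p(2) assms(4)] assms(4)] unfolding mat_le_def by blast
    ultimately have "1 \<le> \<nu> (p$3$3)" using mult_left_le[of "\<nu> ((inv\<^bsub>GL\<^esub> p) $ 3 $ 3)" "\<nu> (p$3$3)"] by simp
    hence d: "inverse (\<nu> (p$3$3)) \<le> 1" by (rule inverse_le_1_iff[THEN iffD2, OF disjI2])
    have "\<nu> ((p$i$1 * Z + p$i$2 * Y) * inverse (p$3$3)) \<le> 1" for i
    proof -
      have "\<nu> (p$i$1 * Z) \<le> 1" "\<nu> (p$i$2 * Y) \<le> 1" unfolding nu_mult using le u by (auto intro!: mult_le_one)
      hence "\<nu> (p$i$1 * Z + p$i$2 * Y) \<le> 1" using nu_ultra[of "p$i$1 * Z" "p$i$2 * Y"] by simp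
      thus ?thesis unfolding nu_mult nu_inverse using d by (intro mult_le_one) auto
    qed
    thus "cj p u \<in> box 1 1" unfolding cj_def u P21_conj_N21[OF p(1)] GR_unip_in_box by blast
  qed
  have "cj p ` box 1 1 = box 1 1"
    using assms by (intro cj_image_eqI sub Kc_inv P21_inv) (auto simp: P21_iff)
  thus ?thesis using assms by (intro \<delta>_eq_1[of _ "box 1 1"] sandwiched_box) auto
qed

lemma compact_open_subgroup_box:
  assumes "r > 0" "s > 0"
  shows "compact_open_subgroup GL (GL_top absF D) N21 (box r s)"
  unfolding compact_open_subgroup_def
proof (intro conjI)
  show "subgroup (box r s) GL" "box r s \<subseteq> N21" using assms subgroup_box box_subset_N21 by auto
  let ?f = "\<lambda>A (k, l). A $ k $ l"
  \<comment> \<open>All entries except (1,3) and (2,3) are pinned to those of the identity, so the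
    image of the box is a product of two compact balls and singletons.\<close>
  define B where "B = (\<lambda>(k::3, l::3). if k = 1 \<and> l = 3 then cb r 0 else if k = 2 \<and> l = 3 then cb s 0 else {mat 1 $ k $ l})"
  show "compactin (GL_top absF D) (box r s)"
    unfolding GL_top_def
  proof (rule compactin_pullback_topology)
    show "box r s \<subseteq> {A. invertible A}" by (auto simp: box_def GR_unip_inv)
    have "?f ` box r s = PiE UNIV B"
    proof (intro equalityI subsetI)
      fix g assume "g \<in> ?f ` box r s"
      then obtain Y Z where g: "g = ?f (GR_unip 0 Y Z)" "\<nu> Z \<le> r" "\<nu> Y \<le> s" unfolding box_def by blast
      have "g (k, l) \<in> B (k, l)" for k l
        using exhaust_3[of k] exhaust_3[of l] g by (auto simp: B_def cb_def mat_nth)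
      thus "g \<in> PiE UNIV B" by (auto simp: PiE_UNIV_domain)
    next
      fix g assume g: "g \<in> PiE UNIV B"
      hence gB: "g k \<in> B k" for k by (auto simp: PiE_UNIV_domain)
      have "g k = ?f (GR_unip 0 (g (2,3)) (g (1,3))) k" for k
        using exhaust_3[of "fst k"] exhaust_3[of "snd k"] gB[of k]
        by (cases k) (auto simp: B_def mat_nth)
      hence "g = ?f (GR_unip 0 (g (2,3)) (g (1,3)))" by blast
      moreover have "GR_unip 0 (g (2,3)) (g (1,3)) \<in> box r s"
        using gB[of "(1,3)"] gB[of "(2,3)"] by (simp add: GR_unip_in_box B_def cb_def)
      ultimately show "g \<in> ?f ` box r s" by blast
    qed
    moreover have "compactin (quat_top absF D) (B k)" for k
      by (cases k) (auto simp: B_def compactin_cb)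
    ultimately show "compactin (product_topology (\<lambda>_. quat_top absF D) UNIV) (?f ` box r s)"
      by (simp add: compactin_PiE)
  qed
  show "openin (subtopology (GL_top absF D) N21) (box r s)"
  proof -
    define V where "V = {g :: 'd^3^3. invertible g \<and> \<nu> (g$1$3) \<le> r \<and> \<nu> (g$2$3) \<le> s}"
    have "openin (GL_top absF D) V"
      unfolding openin_GL_top
    proof (intro conjI ballI)
      fix g assume g: "g \<in> V"
      have "h \<in> V" if h: "invertible h" "mat_le (h - g) (min r s)" for h
      proof -
        have "\<nu> (h$i$j - g$i$j) \<le> min r s" for i j using h(2) unfolding mat_le_def by simp
        from this[of 1 3] this[of 2 3] have "\<nu> (h$1$3 - g$1$3) \<le> r" "\<nu> (h$2$3 - g$2$3) \<le> s" by auto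
        thus ?thesis using nu_diff_trans[of "h$1$3" 0 "g$1$3"] nu_diff_trans[of "h$2$3" 0 "g$2$3"] g h(1)
          by (auto simp: V_def)
      qed
      thus "\<exists>e>0. \<forall>h. invertible h \<and> mat_le (h - g) e \<longrightarrow> h \<in> V" using assms by (intro exI[of _ "min r s"]) auto
    qed (auto simp: V_def)
    moreover have "box r s = V \<inter> N21" by (auto simp: box_def V_def N21_eq GR_unip_inv GR_unip_eq_iff)
    ultimately show ?thesis unfolding openin_subtopology by blast
  qed
qed

text \<open>Openness at the identity provides the inner box; compactness against the exhaustion by
  bounded matrices provides the outer one.\<close>

lemma compact_open_subgroup_sandwiched:
  assumes "compact_open_subgroup GL (GL_top absF D) N21 U" shows "sandwiched U"
proof -
  have U: "subgroup U GL" "U \<subseteq> N21" "compactin (GL_top absF D) U" "openin (subtopology (GL_top absF D) N21) U"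
    using assms unfolding compact_open_subgroup_def by auto
  obtain W where W: "openin (GL_top absF D) W" "U = W \<inter> N21" using U(4) unfolding openin_subtopology by blast
  have "mat 1 \<in> W" using subgroup.one_closed[OF U(1)] W(2) by simp
  then obtain r where r: "r > 0" "Kc r \<subseteq> W" using open_contains_Kc[OF W(1)] by blast
  have "box r r \<subseteq> Kc r"
  proof
    fix x assume "x \<in> box r r"
    then obtain Y Z where x: "x = GR_unip 0 Y Z" "\<nu> Z \<le> r" "\<nu> Y \<le> r" unfolding box_def by blast
    have "\<nu> ((x - mat 1) $ i $ j) \<le> r" for i j
      using exhaust_3[of i] exhaust_3[of j] x r(1) by (auto simp: mat_nth)
    thus "x \<in> Kc r" unfolding Kc_def mat_le_def using x by (simp add: GR_unip_inv)
  qed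
  hence 1: "box r r \<subseteq> U" using r(2) W(2) box_subset_N21 by blast
  \<comment> \<open>The bound is at least 1, so a perturbation of the entries by at most 1 stays
    inside \<open>V n\<close> and \<open>V n\<close> is open.\<close>
  define V where "V n = {g :: 'd^3^3. invertible g \<and> mat_le g (real (Suc n))}" for n
  have "openin (GL_top absF D) (V n)" for n
    unfolding openin_GL_top
  proof (intro conjI ballI)
    fix g assume g: "g \<in> V n"
    have "h \<in> V n" if "invertible h" "mat_le (h - g) 1" for h
      using mat_le_add[OF that(2), of g "real (Suc n)"] g that(1) by (auto simp: V_def intro: mat_le_mono)
    thus "\<exists>e>0. \<forall>h. invertible h \<and> mat_le (h - g) e \<longrightarrow> h \<in> V n" by (intro exI[of _ 1]) auto
  qed (auto simp: V_def)
  hence op: "\<forall>S\<in>range V. openin (GL_top absF D) S" by blast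
  have cover: "U \<subseteq> \<Union>(range V)"
  proof
    fix x assume x: "x \<in> U"
    obtain m where m: "mat_le x m" using mat_le_exists by blast
    obtain n where "m \<le> real n" using real_arch_simple by blast
    hence "mat_le x (real (Suc n))" using mat_le_mono[OF m] by simp
    moreover have "invertible x" using x subgroup.subset[OF U(1)] by auto
    ultimately show "x \<in> \<Union>(range V)" unfolding V_def by blast
  qed
  have "\<exists>\<F>. finite \<F> \<and> \<F> \<subseteq> range V \<and> U \<subseteq> \<Union>\<F>"
    using U(3) op cover unfolding compactin_def by meson
  then obtain J where J: "finite J" "U \<subseteq> (\<Union>n\<in>J. V n)" by (metis finite_subset_image)
  define n where "n = Max (insert 0 J)"
  have "U \<subseteq> box (real (Suc n)) (real (Suc n))"
  proof
    fix x assume x: "x \<in> U"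
    then obtain k where k: "k \<in> J" "x \<in> V k" using J(2) by blast
    have "k \<le> n" unfolding n_def using J(1) k(1) by simp
    hence "mat_le x (real (Suc n))" using k(2) unfolding V_def by (auto intro: mat_le_mono)
    hence "\<nu> (x$1$3) \<le> real (Suc n)" "\<nu> (x$2$3) \<le> real (Suc n)" unfolding mat_le_def by blast+
    moreover obtain Y Z where "x = GR_unip 0 Y Z" using x U(2) unfolding N21_eq by blast
    ultimately show "x \<in> box (real (Suc n)) (real (Suc n))" by (simp add: GR_unip_in_box)
  qed
  thus ?thesis unfolding sandwiched_def using U(1) 1 r(1) by blast
qed

text \<open>Compact open subgroups of \<open>N21\<close> are sandwiched, so all of them give the
  same ratio and the definite description in \<open>modulus\<close> has a unique value.\<close>

lemma modulus_eq_\<delta>: assumes "p \<in> P21" shows "modulus GL (GL_top absF D) N21 p = \<delta> p"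
  unfolding modulus_def
proof (rule the_equality)
  have cj: "(\<lambda>u. p \<otimes>\<^bsub>GL\<^esub> u \<otimes>\<^bsub>GL\<^esub> inv\<^bsub>GL\<^esub> p) ` U = cj p ` U" for U by (simp add: cj_def[abs_def])
  show "\<exists>U. compact_open_subgroup GL (GL_top absF D) N21 U \<and>
      (let U' = (\<lambda>u. p \<otimes>\<^bsub>GL\<^esub> u \<otimes>\<^bsub>GL\<^esub> inv\<^bsub>GL\<^esub> p) ` U in
        \<delta> p = real (sub_index GL U' (U \<inter> U')) / real (sub_index GL U (U \<inter> U')))"
    unfolding cj Let_def
    by (intro exI[of _ "box 1 1"] conjI compact_open_subgroup_box) (simp_all add: \<delta>_def gen_index_def)
  fix c assume "\<exists>U. compact_open_subgroup GL (GL_top absF D) N21 U \<and>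
      (let U' = (\<lambda>u. p \<otimes>\<^bsub>GL\<^esub> u \<otimes>\<^bsub>GL\<^esub> inv\<^bsub>GL\<^esub> p) ` U in
        c = real (sub_index GL U' (U \<inter> U')) / real (sub_index GL U (U \<inter> U')))"
  then obtain U where "compact_open_subgroup GL (GL_top absF D) N21 U" "c = gen_index (cj p ` U) U"
    unfolding cj Let_def gen_index_def by blast
  thus "c = \<delta> p" using gen_index_cj_self[OF assms] compact_open_subgroup_sandwiched by blast
qed

end

section \<open>Extension of equivariant forms\<close>

text \<open>If \<open>A\<close> is an abelian normal subgroup of \<open>R\<close> and every \<open>v \<in> V\<close> is moved into \<open>W\<close> by a product of
  operators \<open>a - 1\<close> with \<open>\<xi> a \<noteq> 1\<close>, then \<open>V\<close> and \<open>W\<close> have the same \<open>\<xi>\<close>-equivariant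
  forms: a form \<open>L\<close> on \<open>W\<close> can only be extended by dividing \<open>L ((a\<^sub>1 - 1) \<dots> (a\<^sub>n - 1) v)\<close> by
  \<open>(\<xi> a\<^sub>1 - 1) \<dots> (\<xi> a\<^sub>n - 1)\<close>, and this is well defined because the operators commute.\<close>

locale equivariant_extension =
  fixes s :: "complex \<Rightarrow> 'w::ab_group_add \<Rightarrow> 'w" and V W :: "'w set"
    and act :: "'g \<Rightarrow> 'w \<Rightarrow> 'w" and R A :: "'g set" and \<xi> :: "'g \<Rightarrow> complex"
  assumes add_V: "v \<in> V \<Longrightarrow> w \<in> V \<Longrightarrow> v + w \<in> V" and diff_V: "v \<in> V \<Longrightarrow> w \<in> V \<Longrightarrow> v - w \<in> V"
    and scale_V: "v \<in> V \<Longrightarrow> s c v \<in> V"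
    and W_V: "W \<subseteq> V" and add_W: "v \<in> W \<Longrightarrow> w \<in> W \<Longrightarrow> v + w \<in> W"
    and diff_W: "v \<in> W \<Longrightarrow> w \<in> W \<Longrightarrow> v - w \<in> W" and scale_W: "v \<in> W \<Longrightarrow> s c v \<in> W"
    and scale_diff: "s c (v - w) = s c v - s c w"
    and act_V: "g \<in> R \<Longrightarrow> v \<in> V \<Longrightarrow> act g v \<in> V" and act_W: "g \<in> R \<Longrightarrow> v \<in> W \<Longrightarrow> act g v \<in> W"
    and act_add: "g \<in> R \<Longrightarrow> v \<in> V \<Longrightarrow> w \<in> V \<Longrightarrow> act g (v + w) = act g v + act g w"
    and act_diff: "g \<in> R \<Longrightarrow> v \<in> V \<Longrightarrow> w \<in> V \<Longrightarrow> act g (v - w) = act g v - act g w"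
    and act_scale: "g \<in> R \<Longrightarrow> v \<in> V \<Longrightarrow> act g (s c v) = s c (act g v)"
    and A_R: "A \<subseteq> R"
    and A_commute: "a \<in> A \<Longrightarrow> b \<in> A \<Longrightarrow> v \<in> V \<Longrightarrow> act a (act b v) = act b (act a v)"
    and A_normal: "g \<in> R \<Longrightarrow> a \<in> A \<Longrightarrow> \<exists>a'\<in>A. \<xi> a' = \<xi> a \<and> (\<forall>v\<in>V. act g (act a v) = act a' (act g v))"
begin

definition equivariant :: "'w set \<Rightarrow> ('w \<Rightarrow> complex) \<Rightarrow> bool" where
  "equivariant X L \<longleftrightarrow> (\<forall>v\<in>X. \<forall>w\<in>X. L (v + w) = L v + L w) \<and> (\<forall>c. \<forall>v\<in>X. L (s c v) = c * L v) \<and>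
     (\<forall>g\<in>R. \<forall>v\<in>X. L (act g v) = \<xi> g * L v)"

definition diff_ops :: "'g list \<Rightarrow> 'w \<Rightarrow> 'w" where "diff_ops as v = foldr (\<lambda>a v. act a v - v) as v"

definition val :: "'g list \<Rightarrow> complex" where "val as = prod_list (map (\<lambda>a. \<xi> a - 1) as)"

definition good :: "'g list \<Rightarrow> bool" where "good as \<longleftrightarrow> set as \<subseteq> A \<and> (\<forall>a\<in>set as. \<xi> a \<noteq> 1)"

lemma diff_ops_simps [simp]: "diff_ops [] v = v" "diff_ops (a # as) v = act a (diff_ops as v) - diff_ops as v"
  by (simp_all add: diff_ops_def)

lemma val_simps [simp]: "val [] = 1" "val (a # as) = (\<xi> a - 1) * val as"
  by (simp_all add: val_def)

lemma good_simps [simp]: "good []" "good (a # as) \<longleftrightarrow> a \<in> A \<and> \<xi> a \<noteq> 1 \<and> good as"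
  by (auto simp: good_def)

lemma val_nz: "good as \<Longrightarrow> val as \<noteq> 0"
  by (induction as) auto

lemma diff_ops_V: "good as \<Longrightarrow> v \<in> V \<Longrightarrow> diff_ops as v \<in> V"
  using A_R by (induction as) (auto intro: diff_V act_V)

lemma diff_ops_W: "good as \<Longrightarrow> v \<in> W \<Longrightarrow> diff_ops as v \<in> W"
  using A_R by (induction as) (auto intro: diff_W act_W)

lemma diff_ops_add: "good as \<Longrightarrow> v \<in> V \<Longrightarrow> w \<in> V \<Longrightarrow> diff_ops as (v + w) = diff_ops as v + diff_ops as w"
  using A_R by (induction as) (auto simp: act_add diff_ops_V subset_iff)

lemma diff_ops_scale: "good as \<Longrightarrow> v \<in> V \<Longrightarrow> diff_ops as (s c v) = s c (diff_ops as v)"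
  using A_R by (induction as) (auto simp: act_scale diff_ops_V subset_iff scale_diff)

lemma diff_ops_act: "good as \<Longrightarrow> a \<in> A \<Longrightarrow> v \<in> V \<Longrightarrow> diff_ops as (act a v) = act a (diff_ops as v)"
  using A_R by (induction as) (auto simp: act_diff diff_ops_V act_V subset_iff A_commute)

lemma diff_ops_commute: "good as \<Longrightarrow> good bs \<Longrightarrow> v \<in> V \<Longrightarrow> diff_ops as (diff_ops bs v) = diff_ops bs (diff_ops as v)"
proof (induction bs)
  case (Cons b bs)
  have "diff_ops as (x - y) = diff_ops as x - diff_ops as y" if "x \<in> V" "y \<in> V" for x y
    using diff_ops_add[OF Cons.prems(1) diff_V[OF that] that(2)] by (simp add: algebra_simps)
  thus ?case using Cons A_R by (auto simp: diff_ops_act diff_ops_V act_V subset_iff)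
qed simp

lemma diff_ops_append: "diff_ops (as @ bs) v = diff_ops as (diff_ops bs v)"
  by (simp add: diff_ops_def)

lemma equivariant_diff_ops:
  assumes "equivariant X L" "\<And>a v. a \<in> A \<Longrightarrow> v \<in> X \<Longrightarrow> act a v \<in> X"
    "\<And>v w. v \<in> X \<Longrightarrow> w \<in> X \<Longrightarrow> v - w \<in> X"
  shows "good as \<Longrightarrow> v \<in> X \<Longrightarrow> diff_ops as v \<in> X \<and> L (diff_ops as v) = val as * L v"
proof (induction as)
  case (Cons a as)
  hence IH: "diff_ops as v \<in> X" "L (diff_ops as v) = val as * L v" and a: "a \<in> A" by auto
  have "L (act a (diff_ops as v) - diff_ops as v + diff_ops as v) = L (act a (diff_ops as v) - diff_ops as v) + L (diff_ops as v)"
    using assms IH a unfolding equivariant_def by blast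
  moreover have "L (act a (diff_ops as v)) = \<xi> a * L (diff_ops as v)"
    using assms(1) IH(1) a A_R unfolding equivariant_def by blast
  ultimately show ?case using IH assms(2,3) a by (simp add: algebra_simps)
qed simp

lemma equivariant_diff_ops_V: "equivariant V L \<Longrightarrow> good as \<Longrightarrow> v \<in> V \<Longrightarrow> L (diff_ops as v) = val as * L v"
  using equivariant_diff_ops[of V L as v] act_V diff_V A_R by blast

lemma equivariant_diff_ops_W: "equivariant W L \<Longrightarrow> good as \<Longrightarrow> v \<in> W \<Longrightarrow> L (diff_ops as v) = val as * L v"
  using equivariant_diff_ops[of W L as v] act_W diff_W A_R by blast

text \<open>Normality moves a list of operators across \<open>g\<close>, at the cost of replacing
  each element by one with the same character value. Thus an extension built from \<open>A\<close>
  alone is equivariant under all of \<open>R\<close>.\<close>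

lemma diff_ops_normal:
  assumes "g \<in> R"
  shows "good as \<Longrightarrow> \<exists>bs. good bs \<and> val bs = val as \<and> (\<forall>v\<in>V. diff_ops bs (act g v) = act g (diff_ops as v))"
proof (induction as)
  case Nil show ?case by (intro exI[of _ "[]"]) simp
next
  case (Cons a as)
  then obtain bs where bs: "good bs" "val bs = val as" "\<forall>v\<in>V. diff_ops bs (act g v) = act g (diff_ops as v)" by auto
  obtain b where b: "b \<in> A" "\<xi> b = \<xi> a" "\<forall>v\<in>V. act g (act a v) = act b (act g v)"
    using A_normal[OF assms, of a] Cons.prems by auto
  have "diff_ops (b # bs) (act g v) = act g (diff_ops (a # as) v)" if v: "v \<in> V" for v
  proof -
    have TV: "diff_ops as v \<in> V" "act a (diff_ops as v) \<in> V" using Cons.prems v A_R by (auto intro: diff_ops_V act_V)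
    thus ?thesis using bs(3) b(3) v assms by (simp add: act_diff)
  qed
  thus ?case using bs b Cons.prems by (intro exI[of _ "b # bs"]) auto
qed

context
  assumes kill: "v \<in> V \<Longrightarrow> \<exists>as. good as \<and> diff_ops as v \<in> W"
begin

lemma equivariant_unique:
  assumes "equivariant V L" "\<And>v. v \<in> W \<Longrightarrow> L v = 0" "v \<in> V"
  shows "L v = 0"
proof -
  obtain as where as: "good as" "diff_ops as v \<in> W" using kill assms(3) by blast
  hence "val as * L v = 0" using equivariant_diff_ops_V[OF assms(1) as(1) assms(3)] assms(2) by simp
  thus ?thesis using val_nz[OF as(1)] by simp
qed

lemma equivariant_exists:
  assumes L0: "equivariant W L0"
  shows "\<exists>L. equivariant V L \<and> (\<forall>v\<in>W. L v = L0 v)"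
proof -
  define L where "L v = (SOME c. \<exists>as. good as \<and> diff_ops as v \<in> W \<and> c = L0 (diff_ops as v) / val as)" for v
  have L: "L v = L0 (diff_ops as v) / val as" if v: "v \<in> V" and as: "good as" "diff_ops as v \<in> W" for v as
  proof -
    have "\<exists>c as. good as \<and> diff_ops as v \<in> W \<and> c = L0 (diff_ops as v) / val as" using as by blast
    hence "\<exists>as. good as \<and> diff_ops as v \<in> W \<and> L v = L0 (diff_ops as v) / val as" unfolding L_def by (rule someI_ex)
    then obtain bs where bs: "good bs" "diff_ops bs v \<in> W" "L v = L0 (diff_ops bs v) / val bs" by blast
    \<comment> \<open>Both sides are the value of \<open>L0\<close> on the vector obtained from
      \<open>v\<close> by applying both lists, in either order. So the quotient does not depend on
      the list.\<close>
    have "val as * L0 (diff_ops bs v) = L0 (diff_ops as (diff_ops bs v))" by (simp add: equivariant_diff_ops_W[OF L0 as(1) bs(2)])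
    also have "\<dots> = val bs * L0 (diff_ops as v)" by (simp add: diff_ops_commute[OF as(1) bs(1) v] equivariant_diff_ops_W[OF L0 bs(1) as(2)])
    finally have "val as * L0 (diff_ops bs v) = val bs * L0 (diff_ops as v)" .
    moreover have "val as \<noteq> 0" "val bs \<noteq> 0" using val_nz as(1) bs(1) by auto
    ultimately show ?thesis using bs(3) by (simp add: frac_eq_eq mult.commute)
  qed
  have ext: "L v = L0 v" if "v \<in> W" for v using L[of v "[]"] that W_V by auto
  have add: "L (v + w) = L v + L w" if vw: "v \<in> V" "w \<in> V" for v w
  proof -
    obtain as bs where as: "good as" "diff_ops as v \<in> W" and bs: "good bs" "diff_ops bs w \<in> W" using kill vw by meson
    \<comment> \<open>The concatenation moves both vectors into \<open>W\<close>: the operators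
      commute and preserve \<open>W\<close>.\<close>
    have cs: "good (as @ bs)" using as(1) bs(1) by (auto simp: good_def)
    have W: "diff_ops (as @ bs) v \<in> W" "diff_ops (as @ bs) w \<in> W"
      using as bs vw diff_ops_commute[OF as(1) bs(1) vw(1)] by (simp_all add: diff_ops_append diff_ops_W)
    have "L0 (diff_ops (as @ bs) (v + w)) = L0 (diff_ops (as @ bs) v) + L0 (diff_ops (as @ bs) w)"
      using L0 W diff_ops_add[OF cs vw] unfolding equivariant_def by simp
    moreover have "diff_ops (as @ bs) (v + w) \<in> W" using diff_ops_add[OF cs vw] W add_W by simp
    ultimately show ?thesis
      using L[OF vw(1) cs W(1)] L[OF vw(2) cs W(2)] L[OF add_V[OF vw] cs] by (simp add: add_divide_distrib)
  qed
  have scale: "L (s c v) = c * L v" if v: "v \<in> V" for c v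
  proof -
    obtain as where as: "good as" "diff_ops as v \<in> W" using kill v by blast
    have "diff_ops as (s c v) = s c (diff_ops as v)" using as(1) v by (rule diff_ops_scale)
    moreover have "L0 (s c (diff_ops as v)) = c * L0 (diff_ops as v)" using L0 as(2) unfolding equivariant_def by blast
    ultimately show ?thesis using L[OF v as] L[OF scale_V[OF v] as(1)] scale_W[OF as(2)] by simp
  qed
  have eq: "L (act g v) = \<xi> g * L v" if g: "g \<in> R" and v: "v \<in> V" for g v
  proof -
    obtain as where as: "good as" "diff_ops as v \<in> W" using kill v by blast
    obtain bs where bs: "good bs" "val bs = val as" "diff_ops bs (act g v) = act g (diff_ops as v)"
      using diff_ops_normal[OF g as(1)] v by blast
    have "L0 (act g (diff_ops as v)) = \<xi> g * L0 (diff_ops as v)" using L0 as(2) g unfolding equivariant_def by blast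
    thus ?thesis using L[OF v as] L[OF act_V[OF g v] bs(1)] act_W[OF g as(2)] bs by simp
  qed
  show ?thesis using add scale eq ext unfolding equivariant_def by blast
qed

end

end

text \<open>\<open>T\<close> is linear on \<open>W1\<close> only, not on the whole type, so spans
  and independence are transported inside \<open>W1\<close>, by means of one basis and its
  image.\<close>

lemma edim_bij_eq:
  fixes s1 :: "complex \<Rightarrow> 'a::ab_group_add \<Rightarrow> 'a" and s2 :: "complex \<Rightarrow> 'b::ab_group_add \<Rightarrow> 'b"
  assumes vs1: "vector_space s1" and vs2: "vector_space s2"
    and sub1: "module.subspace s1 W1" and sub2: "module.subspace s2 W2"
    and bij: "bij_betw T W1 W2"
    and add: "\<And>x y. x \<in> W1 \<Longrightarrow> y \<in> W1 \<Longrightarrow> T (x + y) = T x + T y"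
    and scale: "\<And>c x. x \<in> W1 \<Longrightarrow> T (s1 c x) = s2 c (T x)"
  shows "edim s1 W1 = edim s2 W2"
proof -
  interpret v1: vector_space s1 by (rule vs1)
  interpret v2: vector_space s2 by (rule vs2)
  have T0: "T 0 = 0" using add[of 0 0] v1.subspace_0[OF sub1] by simp
  have inj: "inj_on T W1" and img: "T ` W1 = W2" using bij by (auto simp: bij_betw_def)
  have Tsum: "T (\<Sum>b\<in>t. s1 (c b) b) = (\<Sum>b\<in>t. s2 (c b) (T b)) \<and> (\<Sum>b\<in>t. s1 (c b) b) \<in> W1"
    if "finite t" "t \<subseteq> W1" for c t
    using that
  proof induction
    case (insert x F)
    thus ?case using sub1 by (auto simp: add scale v1.subspace_add v1.subspace_scale)
  qed (use T0 v1.subspace_0[OF sub1] in auto)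
  have span: "T ` v1.span B = v2.span (T ` B)" if B: "B \<subseteq> W1" for B
  proof (intro equalityI subsetI)
    fix y assume "y \<in> T ` v1.span B"
    then obtain x where x: "x \<in> v1.span B" "y = T x" by blast
    then obtain t c where t: "finite t" "t \<subseteq> B" "x = (\<Sum>b\<in>t. s1 (c b) b)" unfolding v1.span_explicit by blast
    hence "y = (\<Sum>b\<in>t. s2 (c b) (T b))" using Tsum[of t c] B x(2) by auto
    thus "y \<in> v2.span (T ` B)" using t(2)
      by (simp only:) (intro v2.span_sum v2.span_scale v2.span_base, blast)
  next
    fix y assume "y \<in> v2.span (T ` B)"
    thus "y \<in> T ` v1.span B"
    proof (induction rule: v2.span_induct_alt)
      case base show ?case using T0 v1.span_zero by (metis imageI)
    next
      case (step c z y)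
      then obtain b where b: "b \<in> B" "z = T b" by blast
      from step obtain x where x: "x \<in> v1.span B" "y = T x" by blast
      have "x \<in> W1" using x(1) v1.span_minimal[OF B sub1] by blast
      hence "T (s1 c b + x) = s2 c z + y" using b x B v1.subspace_scale[OF sub1] by (simp add: add scale subset_iff)
      moreover have "s1 c b + x \<in> v1.span B" by (rule v1.span_add[OF v1.span_scale[OF v1.span_base[OF b(1)]] x(1)])
      ultimately show ?case by (metis imageI)
    qed
  qed
  obtain B where B: "B \<subseteq> W1" "v1.independent B" "W1 \<subseteq> v1.span B" "card B = v1.dim W1"
    using v1.basis_exists by blast
  have spB: "v1.span B = W1" using B v1.span_minimal[OF B(1) sub1] by blast
  hence spTB: "v2.span (T ` B) = W2" using span[OF B(1)] img by simp
  have indTB: "v2.independent (T ` B)"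
    unfolding v2.dependent_def
  proof clarify
    fix b assume b: "b \<in> B" "T b \<in> v2.span (T ` B - {T b})"
    have "T ` B - {T b} = T ` (B - {b})" using inj B(1) b(1) by (auto simp: inj_on_def)
    hence "T b \<in> T ` v1.span (B - {b})" using b span[of "B - {b}"] B(1) by auto
    moreover have "v1.span (B - {b}) \<subseteq> W1" using B(1) sub1 by (intro v1.span_minimal) auto
    ultimately have "b \<in> v1.span (B - {b})" using inj b(1) B(1) by (auto simp: inj_on_def subset_iff)
    thus False using B(2) b(1) unfolding v1.dependent_def by blast
  qed
  have cardTB: "card (T ` B) = card B" and finTB: "finite (T ` B) \<longleftrightarrow> finite B"
    using inj B(1) by (meson card_image inj_on_subset finite_image_iff)+
  have dim2: "v2.dim W2 = card (T ` B)"
    using v2.dim_span_eq_card_independent[OF indTB] spTB by simp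
  \<comment> \<open>A finite spanning set bounds every independent set, so the case distinction in
    \<open>edim\<close> becomes finiteness of the chosen basis.\<close>
  have fin1: "(\<exists>C. finite C \<and> W1 \<subseteq> v1.span C) \<longleftrightarrow> finite B"
    using v1.independent_span_bound[of _ B] B spB by blast
  have fin2: "(\<exists>C. finite C \<and> W2 \<subseteq> v2.span C) \<longleftrightarrow> finite (T ` B)"
    using v2.independent_span_bound[of _ "T ` B"] indTB spTB v2.span_superset[of "T ` B"] by blast
  show ?thesis unfolding edim_def fin1 fin2 using finTB cardTB dim2 B(4) by simp
qed

section \<open>Integration on \<open>D\<close> as summation over balls\<close>

context p_adic_quaternion
begin

definition pick :: "'d set \<Rightarrow> 'd" where "pick C = (SOME x. x \<in> C)"

definition balls :: "real \<Rightarrow> 'd set set" where "balls r = range (cb r)"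

definition loc_inv :: "real \<Rightarrow> ('d \<Rightarrow> 'b) \<Rightarrow> bool" where
  "loc_inv r \<phi> \<longleftrightarrow> (\<forall>x y. \<nu> (x - y) \<le> r \<longrightarrow> \<phi> x = \<phi> y)"

definition bdd_supp :: "('d \<Rightarrow> 'b::zero) \<Rightarrow> bool" where
  "bdd_supp \<phi> \<longleftrightarrow> (\<exists>R. \<forall>x. \<phi> x \<noteq> 0 \<longrightarrow> \<nu> x \<le> R)"

text \<open>For \<open>\<phi>\<close> invariant under translation by the ball of radius \<open>r\<close>, this is the integral of \<open>\<phi>\<close> divided
  by the volume of that ball.\<close>

definition csum :: "real \<Rightarrow> ('d \<Rightarrow> complex) \<Rightarrow> complex" where
  "csum r \<phi> = (\<Sum>C\<in>{C\<in>balls r. \<phi> (pick C) \<noteq> 0}. \<phi> (pick C))"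

text \<open>For \<open>0 < s \<le> r\<close> this is the index of \<open>cb s 0\<close> in
  \<open>cb r 0\<close>, that is, the ratio of the volumes of the two balls.\<close>

definition ball_idx :: "real \<Rightarrow> real \<Rightarrow> nat" where
  "ball_idx r s = card {C\<in>balls s. C \<subseteq> cb r 0}"

lemma cb_eq_iff: assumes "0 \<le> r" shows "cb r x = cb r y \<longleftrightarrow> \<nu> (x - y) \<le> r"
proof
  assume "cb r x = cb r y"
  moreover have "x \<in> cb r x" using assms by (simp add: cb_def)
  ultimately show "\<nu> (x - y) \<le> r" by (auto simp: cb_def)
next
  assume xy: "\<nu> (x - y) \<le> r"
  have "\<nu> (z - y) \<le> r" if "\<nu> (z - x) \<le> r" for z using nu_diff_trans[of z y x] xy that by auto
  moreover have "\<nu> (z - x) \<le> r" if "\<nu> (z - y) \<le> r" for z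
    using nu_diff_trans[of z x y] xy that nu_minus_commute[of y x] by auto
  ultimately show "cb r x = cb r y" unfolding cb_def by blast
qed

lemma pick_cb: "0 \<le> r \<Longrightarrow> \<nu> (pick (cb r x) - x) \<le> r"
  unfolding pick_def using someI[of "\<lambda>y. y \<in> cb r x" x] by (simp add: cb_def)

lemma pick_balls: "0 \<le> r \<Longrightarrow> C \<in> balls r \<Longrightarrow> cb r (pick C) = C"
proof -
  assume r: "0 \<le> r" and "C \<in> balls r"
  then obtain x where x: "C = cb r x" by (auto simp: balls_def)
  show ?thesis unfolding x cb_eq_iff[OF r] by (rule pick_cb[OF r])
qed

lemma loc_inv_pick: "0 \<le> r \<Longrightarrow> loc_inv r \<phi> \<Longrightarrow> \<phi> (pick (cb r x)) = \<phi> x"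
  using pick_cb[of r x] unfolding loc_inv_def by blast

lemma finite_balls_bounded: assumes "r > 0" shows "finite {C\<in>balls r. \<nu> (pick C) \<le> R}"
proof -
  obtain S where S: "finite S" "cb R 0 \<subseteq> (\<Union>x\<in>S. cb r x)" using finite_cover_cb[OF assms] by blast
  have "{C\<in>balls r. \<nu> (pick C) \<le> R} \<subseteq> cb r ` S"
  proof clarify
    fix C assume C: "C \<in> balls r" "\<nu> (pick C) \<le> R"
    hence "pick C \<in> cb R 0" by (simp add: cb_def)
    then obtain x where x: "x \<in> S" "\<nu> (pick C - x) \<le> r" using S(2) unfolding cb_def by blast
    hence "C = cb r x" using pick_balls[of r C] C(1) assms cb_eq_iff[of r "pick C" x] by simp
    thus "C \<in> cb r ` S" using x by blast
  qed
  thus ?thesis using S(1) finite_surj by blast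
qed

lemma finite_csum_supp: "r > 0 \<Longrightarrow> bdd_supp \<phi> \<Longrightarrow> finite {C\<in>balls r. \<phi> (pick C) \<noteq> 0}"
proof -
  assume r: "r > 0" and "bdd_supp \<phi>"
  then obtain R where R: "\<And>x. \<phi> x \<noteq> 0 \<Longrightarrow> \<nu> x \<le> R" unfolding bdd_supp_def by blast
  show ?thesis by (rule finite_subset[OF _ finite_balls_bounded[OF r, of R]]) (use R in auto)
qed

lemma csum_superset:
  assumes "finite S" "S \<subseteq> balls r" "{C\<in>balls r. \<phi> (pick C) \<noteq> 0} \<subseteq> S"
  shows "csum r \<phi> = (\<Sum>C\<in>S. \<phi> (pick C))"
  unfolding csum_def by (rule sum.mono_neutral_left) (use assms in auto)

lemma csum_add:
  assumes "r > 0" "bdd_supp \<phi>" "bdd_supp \<eta>"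
  shows "csum r (\<lambda>x. \<phi> x + \<eta> x) = csum r \<phi> + csum r \<eta>"
proof -
  define S where "S = {C\<in>balls r. \<phi> (pick C) \<noteq> 0} \<union> {C\<in>balls r. \<eta> (pick C) \<noteq> 0}"
  have S: "finite S" unfolding S_def by (intro finite_UnI finite_csum_supp assms)
  have "csum r \<phi> = (\<Sum>C\<in>S. \<phi> (pick C))" "csum r \<eta> = (\<Sum>C\<in>S. \<eta> (pick C))"
    "csum r (\<lambda>x. \<phi> x + \<eta> x) = (\<Sum>C\<in>S. \<phi> (pick C) + \<eta> (pick C))"
    by (rule csum_superset[OF S]; force simp: S_def)+
  thus ?thesis by (simp add: sum.distrib)
qed

lemma csum_cmult: "csum r (\<lambda>x. c * \<phi> x) = c * csum r \<phi>"
  by (cases "c = 0") (simp_all add: csum_def sum_distrib_left)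

text \<open>An isometric bijection permutes the balls of radius \<open>r\<close>. It need not
  respect the chosen points of the balls, but local invariance makes the values agree.\<close>

lemma csum_reindex:
  assumes r: "r > 0" and inv: "loc_inv r \<phi>" and surj: "surj \<tau>" and iso: "\<And>x y. \<nu> (\<tau> x - \<tau> y) = \<nu> (x - y)"
  shows "csum r (\<lambda>x. \<phi> (\<tau> x)) = csum r \<phi>"
proof -
  have inj: "inj \<tau>"
  proof (rule injI)
    fix x y assume "\<tau> x = \<tau> y"
    hence "\<nu> (x - y) = 0" using iso[of x y] by simp
    thus "x = y" by simp
  qed
  have img: "\<tau> ` cb r x = cb r (\<tau> x)" for x
  proof (intro equalityI subsetI)
    fix z assume "z \<in> cb r (\<tau> x)"
    moreover obtain y where "z = \<tau> y" using surj by (metis surjD)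
    ultimately show "z \<in> \<tau> ` cb r x" by (auto simp: cb_def iso)
  qed (auto simp: cb_def iso)
  have val: "\<phi> (pick (\<tau> ` C)) = \<phi> (\<tau> (pick C))" if "C \<in> balls r" for C
  proof -
    have C: "C = cb r (pick C)" using that r by (simp add: pick_balls)
    have "\<phi> (pick (\<tau> ` C)) = \<phi> (pick (cb r (\<tau> (pick C))))" using img[of "pick C"] C by simp
    thus ?thesis using loc_inv_pick[of r \<phi>] inv r by simp
  qed
  have bij: "bij_betw ((`) \<tau>) {C\<in>balls r. \<phi> (\<tau> (pick C)) \<noteq> 0} {C\<in>balls r. \<phi> (pick C) \<noteq> 0}"
    unfolding bij_betw_def
  proof
    show "inj_on ((`) \<tau>) {C \<in> balls r. \<phi> (\<tau> (pick C)) \<noteq> 0}" using inj by (simp add: inj_on_def inj_image_eq_iff)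
    show "(`) \<tau> ` {C \<in> balls r. \<phi> (\<tau> (pick C)) \<noteq> 0} = {C \<in> balls r. \<phi> (pick C) \<noteq> 0}"
    proof (intro equalityI subsetI)
      fix E assume "E \<in> (`) \<tau> ` {C \<in> balls r. \<phi> (\<tau> (pick C)) \<noteq> 0}"
      then obtain C where "E = \<tau> ` C" "C \<in> balls r" "\<phi> (\<tau> (pick C)) \<noteq> 0" by blast
      thus "E \<in> {C \<in> balls r. \<phi> (pick C) \<noteq> 0}" using val[of C] img by (auto simp: balls_def)
    next
      fix E assume E: "E \<in> {C \<in> balls r. \<phi> (pick C) \<noteq> 0}"
      then obtain z where "E = cb r z" by (auto simp: balls_def)
      moreover obtain x where "z = \<tau> x" using surj by (metis surjD)
      ultimately have x: "E = \<tau> ` cb r x" "cb r x \<in> balls r" using img by (auto simp: balls_def)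
      hence "\<phi> (\<tau> (pick (cb r x))) \<noteq> 0" using val[of "cb r x"] E by simp
      thus "E \<in> (`) \<tau> ` {C \<in> balls r. \<phi> (\<tau> (pick C)) \<noteq> 0}" using x by blast
    qed
  qed
  have "csum r \<phi> = (\<Sum>C\<in>{C\<in>balls r. \<phi> (\<tau> (pick C)) \<noteq> 0}. \<phi> (pick (\<tau> ` C)))"
    unfolding csum_def by (rule sum.reindex_bij_betw[OF bij, symmetric])
  also have "\<dots> = csum r (\<lambda>x. \<phi> (\<tau> x))" unfolding csum_def by (rule sum.cong) (auto simp: val)
  finally show ?thesis by simp
qed

lemma csum_translate:
  assumes "r > 0" "loc_inv r \<phi>" shows "csum r (\<lambda>x. \<phi> (x + t)) = csum r \<phi>"
  using assms by (intro csum_reindex) (auto simp: surj_def intro: exI[of _ "_ - t"])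

lemma csum_conj:
  assumes "r > 0" "loc_inv r \<phi>" "h \<noteq> 0" shows "csum r (\<lambda>x. \<phi> (h * x * inverse h)) = csum r \<phi>"
proof (rule csum_reindex[OF assms(1,2)])
  show "surj (\<lambda>x. h * x * inverse h)"
    unfolding surj_def using assms(3) by (auto intro!: exI[of _ "inverse h * _ * h"] simp: mult.assoc)
      (simp add: mult.assoc[symmetric])
  show "\<nu> (h * x * inverse h - h * y * inverse h) = \<nu> (x - y)" for x y
    using nu_conj[OF assms(3), of "x - y"] by (simp add: algebra_simps)
qed

lemma subballs_eq:
  assumes "0 < s" "s \<le> r"
  shows "{C\<in>balls s. C \<subseteq> cb r x} = {C\<in>balls s. \<nu> (pick C - x) \<le> r}"
proof -
  have "C \<subseteq> cb r x \<longleftrightarrow> \<nu> (pick C - x) \<le> r" if "C \<in> balls s" for C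
  proof
    have C: "C = cb s (pick C)" using pick_balls[of s C] that assms by simp
    hence "pick C \<in> C" using assms by (metis cb_def diff_self less_eq_real_def mem_Collect_eq nu_0)
    thus "C \<subseteq> cb r x \<Longrightarrow> \<nu> (pick C - x) \<le> r" by (auto simp: cb_def)
    assume px: "\<nu> (pick C - x) \<le> r"
    show "C \<subseteq> cb r x"
    proof
      fix y assume "y \<in> C"
      hence "\<nu> (y - pick C) \<le> s" using C by (auto simp: cb_def)
      thus "y \<in> cb r x" using nu_diff_trans[of y x "pick C"] px assms by (auto simp: cb_def)
    qed
  qed
  thus ?thesis by blast
qed

lemma finite_subballs: "0 < s \<Longrightarrow> s \<le> r \<Longrightarrow> finite {C\<in>balls s. C \<subseteq> cb r 0}"
  using subballs_eq[of s r 0] finite_balls_bounded[of s r] by simp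

lemma ball_idx_pos: "0 < s \<Longrightarrow> s \<le> r \<Longrightarrow> ball_idx r s > 0"
proof -
  assume s: "0 < s" "s \<le> r"
  have "cb s 0 \<in> balls s" by (simp add: balls_def)
  moreover have "cb s 0 \<subseteq> cb r 0" using s by (auto simp: cb_def)
  ultimately have "cb s 0 \<in> {C\<in>balls s. C \<subseteq> cb r 0}" by simp
  thus ?thesis unfolding ball_idx_def using finite_subballs[OF s] by (auto simp: card_gt_0_iff)
qed

lemma card_subballs:
  assumes "0 < s" "s \<le> r"
  shows "card {C\<in>balls s. C \<subseteq> cb r x} = ball_idx r s"
proof -
  have img: "(\<lambda>y. y + x) ` cb t y = cb t (y + x)" for t y
  proof (intro equalityI subsetI)
    fix z assume "z \<in> cb t (y + x)"
    hence "z - x \<in> cb t y" by (simp add: cb_def algebra_simps)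
    thus "z \<in> (\<lambda>y. y + x) ` cb t y" by (metis diff_add_cancel imageI)
  qed (auto simp: cb_def)
  have inj: "inj (\<lambda>y. y + x)" by simp
  have "bij_betw ((`) (\<lambda>y. y + x)) {C\<in>balls s. C \<subseteq> cb r 0} {C\<in>balls s. C \<subseteq> cb r x}"
    unfolding bij_betw_def
  proof
    show "inj_on ((`) (\<lambda>y. y + x)) {C\<in>balls s. C \<subseteq> cb r 0}"
      using inj by (simp add: inj_on_def inj_image_eq_iff)
    show "(`) (\<lambda>y. y + x) ` {C\<in>balls s. C \<subseteq> cb r 0} = {C\<in>balls s. C \<subseteq> cb r x}"
    proof (intro equalityI subsetI)
      fix E assume "E \<in> (`) (\<lambda>y. y + x) ` {C\<in>balls s. C \<subseteq> cb r 0}"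
      then obtain C where C: "E = (\<lambda>y. y + x) ` C" "C \<in> balls s" "C \<subseteq> cb r 0" by blast
      have "E \<subseteq> cb r x" using image_mono[OF C(3), of "\<lambda>y. y + x"] img[of r 0] C(1) by simp
      moreover have "E \<in> balls s" using C(1,2) img by (auto simp: balls_def)
      ultimately show "E \<in> {C\<in>balls s. C \<subseteq> cb r x}" by blast
    next
      fix E assume "E \<in> {C\<in>balls s. C \<subseteq> cb r x}"
      then obtain y where y: "E = cb s y" "cb s y \<subseteq> cb r x" by (auto simp: balls_def)
      have E: "E = (\<lambda>y. y + x) ` cb s (y - x)" using img[of s "y - x"] y by simp
      hence "(\<lambda>y. y + x) ` cb s (y - x) \<subseteq> (\<lambda>y. y + x) ` cb r 0" using y img[of r 0] by simp
      hence "cb s (y - x) \<subseteq> cb r 0" using inj by (simp add: inj_image_subset_iff)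
      thus "E \<in> (`) (\<lambda>y. y + x) ` {C\<in>balls s. C \<subseteq> cb r 0}" using E by (auto simp: balls_def)
    qed
  qed
  thus ?thesis unfolding ball_idx_def by (rule bij_betw_same_card[symmetric])
qed

text \<open>Every ball of radius \<open>r\<close> is the disjoint union of
  \<open>ball_idx r s\<close> balls of radius \<open>s\<close>, on each of which the function has
  the value it has on the large ball.\<close>

lemma csum_refine:
  assumes s: "0 < s" "s \<le> r" and inv: "loc_inv r \<phi>" and bdd: "bdd_supp \<phi>"
  shows "csum s \<phi> = of_nat (ball_idx r s) * csum r \<phi>"
proof -
  have r: "r > 0" using s by simp
  let ?B = "{B\<in>balls r. \<phi> (pick B) \<noteq> 0}" and ?sub = "\<lambda>B. {C\<in>balls s. C \<subseteq> B}"
  have Bcb: "cb r (pick B) = B" if "B \<in> balls r" for B using that r by (simp add: pick_balls)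
  have sub: "?sub B = {C\<in>balls s. \<nu> (pick C - pick B) \<le> r}" if "B \<in> balls r" for B
    using subballs_eq[OF s, of "pick B"] Bcb[OF that] by simp
  have val: "\<phi> (pick C) = \<phi> (pick B)" if "B \<in> balls r" "C \<in> ?sub B" for B C
    using inv that sub[OF that(1)] unfolding loc_inv_def by blast
  have fin: "finite (?sub B)" if "B \<in> balls r" for B
    using card_subballs[OF s, of "pick B"] ball_idx_pos[OF s] Bcb[OF that] by (metis card_gt_0_iff)
  have "{C\<in>balls s. \<phi> (pick C) \<noteq> 0} = (\<Union>B\<in>?B. ?sub B)"
  proof (intro equalityI subsetI)
    fix C assume C: "C \<in> {C\<in>balls s. \<phi> (pick C) \<noteq> 0}"
    let ?B1 = "cb r (pick C)"
    have b: "?B1 \<in> balls r" by (simp add: balls_def)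
    have "C \<in> {C \<in> balls s. \<nu> (pick C - pick ?B1) \<le> r}"
      using C pick_cb[of r "pick C"] r nu_minus_commute[of "pick C" "pick ?B1"] by simp
    hence CB: "C \<in> ?sub ?B1" using sub[OF b] by blast
    hence "\<phi> (pick ?B1) \<noteq> 0" using val[OF b CB] C by simp
    thus "C \<in> (\<Union>B\<in>?B. ?sub B)" using CB b by blast
  next
    fix C assume "C \<in> (\<Union>B\<in>?B. ?sub B)"
    thus "C \<in> {C\<in>balls s. \<phi> (pick C) \<noteq> 0}" using val by fastforce
  qed
  hence "csum s \<phi> = (\<Sum>C\<in>(\<Union>B\<in>?B. ?sub B). \<phi> (pick C))" by (simp add: csum_def)
  also have "\<dots> = (\<Sum>B\<in>?B. \<Sum>C\<in>?sub B. \<phi> (pick C))"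
  proof (rule sum.UNION_disjoint)
    show "finite ?B" using r bdd by (rule finite_csum_supp)
    show "\<forall>B\<in>?B. finite (?sub B)" using fin by blast
    show "\<forall>B\<in>?B. \<forall>B'\<in>?B. B \<noteq> B' \<longrightarrow> ?sub B \<inter> ?sub B' = {}"
    proof (intro ballI impI equals0I)
      fix B B' C assume B: "B \<in> ?B" "B' \<in> ?B" "B \<noteq> B'" and C: "C \<in> ?sub B \<inter> ?sub B'"
      have "\<nu> (pick C - pick B) \<le> r" "\<nu> (pick C - pick B') \<le> r" using C sub B by blast+
      hence "cb r (pick C) = cb r (pick B)" "cb r (pick C) = cb r (pick B')" using cb_eq_iff[of r] r by auto
      hence "B = B'" using Bcb B by auto
      with B(3) show False by simp
    qed
  qed
  also have "\<dots> = (\<Sum>B\<in>?B. of_nat (ball_idx r s) * \<phi> (pick B))"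
  proof (rule sum.cong[OF refl])
    fix B assume B: "B \<in> ?B"
    have "(\<Sum>C\<in>?sub B. \<phi> (pick C)) = (\<Sum>C\<in>?sub B. \<phi> (pick B))" using B val by (intro sum.cong) auto
    also have "card (?sub B) = ball_idx r s" using card_subballs[OF s, of "pick B"] Bcb B by auto
    ultimately show "(\<Sum>C\<in>?sub B. \<phi> (pick C)) = of_nat (ball_idx r s) * \<phi> (pick B)" by simp
  qed
  finally show ?thesis by (simp add: csum_def sum_distrib_left)
qed

lemma csum_indicator:
  assumes "0 < s" "s \<le> r"
  shows "csum s (\<lambda>x. if \<nu> x \<le> r then c else 0) = of_nat (ball_idx r s) * c"
proof -
  let ?S = "{C\<in>balls s. C \<subseteq> cb r 0}"
  have S: "?S = {C\<in>balls s. \<nu> (pick C) \<le> r}" using subballs_eq[OF assms, of 0] by simp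
  have "csum s (\<lambda>x. if \<nu> x \<le> r then c else 0) = (\<Sum>C\<in>?S. if \<nu> (pick C) \<le> r then c else 0)"
    by (rule csum_superset[OF finite_subballs[OF assms]]) (auto simp: S split: if_splits)
  also have "\<dots> = (\<Sum>C\<in>?S. c)" by (rule sum.cong) (auto simp: S)
  finally show ?thesis by (simp add: ball_idx_def)
qed

text \<open>Obtained by summing the indicator function of the ball of radius \<open>r\<close> over
  balls of radius \<open>t\<close> and of radius \<open>s\<close>, and comparing the results by
  \<open>csum_refine\<close>.\<close>

lemma ball_idx_mult:
  assumes "0 < t" "t \<le> s" "s \<le> r"
  shows "ball_idx r t = ball_idx s t * ball_idx r s"
proof -
  let ?\<phi> = "\<lambda>x. if \<nu> x \<le> r then 1 else 0 :: complex"
  have "?\<phi> x = ?\<phi> y" if "\<nu> (x - y) \<le> s" for x y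
    using nu_diff_trans[of x 0 y] nu_diff_trans[of y 0 x] that assms nu_minus_commute[of x y] by auto
  hence "loc_inv s ?\<phi>" unfolding loc_inv_def by blast
  moreover have "bdd_supp ?\<phi>" unfolding bdd_supp_def by (intro exI[of _ r]) auto
  ultimately have "csum t ?\<phi> = of_nat (ball_idx s t) * csum s ?\<phi>" using csum_refine assms by blast
  hence "of_nat (ball_idx r t) = (of_nat (ball_idx s t * ball_idx r s) :: complex)"
    using csum_indicator[of t r 1] csum_indicator[of s r 1] assms by simp
  thus ?thesis by (simp only: of_nat_eq_iff)
qed

end

section \<open>The orbit filtration of the induced representation\<close>

text \<open>For small parameters these lie in the congruence subgroups that fix a given function.
  Right translation by them clears an entry of the third row, which bounds supports and adjusts
  representatives on the open cell.\<close>

definition lowu :: "'d::division_ring \<Rightarrow> 'd \<Rightarrow> 'd^3^3" where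
  "lowu a b = vector [vector [1, 0, 0], vector [0, 1, 0], vector [a, b, 1]]"

definition lowu21 :: "'d::division_ring \<Rightarrow> 'd^3^3" where
  "lowu21 a = vector [vector [1, 0, 0], vector [a, 1, 0], vector [0, 0, 1]]"

lemma lowu_nth [simp]:
  "lowu a b $ 1 $ 1 = 1" "lowu a b $ 1 $ 2 = 0" "lowu a b $ 1 $ 3 = 0" "lowu a b $ 2 $ 1 = 0" "lowu a b $ 2 $ 2 = 1" "lowu a b $ 2 $ 3 = 0"
  "lowu a b $ 3 $ 1 = a" "lowu a b $ 3 $ 2 = b" "lowu a b $ 3 $ 3 = 1"
  by (simp_all add: lowu_def)

lemma lowu21_nth [simp]:
  "lowu21 a $ 1 $ 1 = 1" "lowu21 a $ 1 $ 2 = 0" "lowu21 a $ 1 $ 3 = 0" "lowu21 a $ 2 $ 1 = a" "lowu21 a $ 2 $ 2 = 1" "lowu21 a $ 2 $ 3 = 0"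
  "lowu21 a $ 3 $ 1 = 0" "lowu21 a $ 3 $ 2 = 0" "lowu21 a $ 3 $ 3 = 1"
  by (simp_all add: lowu21_def)

lemma invertible_lowu: "invertible (lowu a b)" "inv\<^bsub>GL\<^esub> (lowu a b) = lowu (- a) (- b)"
  using GL_inv_eqI[of "lowu a b" "lowu (- a) (- b)"] by (simp_all add: eq3_iff mult3_nth mat_nth)

lemma invertible_lowu21: "invertible (lowu21 a)"
  using GL_inv_eqI[of "lowu21 a" "lowu21 (- a)"] by (simp add: eq3_iff mult3_nth mat_nth)

lemma shalika_unip_nth [simp]:
  "shalika_unip X $ 1 $ 1 = 1" "shalika_unip X $ 1 $ 2 = X" "shalika_unip X $ 2 $ 1 = 0" "shalika_unip X $ 2 $ 2 = 1"
  by (simp_all add: shalika_unip_def)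

lemma invertible_shalika_unip: "invertible (shalika_unip X)"
  using GL_inv_eqI(1)[of "shalika_unip X" "shalika_unip (- X)"] by (simp add: eq2_iff mult2_nth mat_nth)

lemma GR_groupE:
  assumes "g \<in> GR_group"
  obtains h X Y Z where "h \<noteq> 0" "g = mat h ** GR_unip X Y Z"
  using assms unfolding GR_group_def by blast

lemma GR_group_P21: "g \<in> GR_group \<Longrightarrow> g \<in> P21"
  by (auto elim!: GR_groupE intro!: P21_mult P21_mat P21_GR_unip)

lemma GR_group_invertible: "g \<in> GR_group \<Longrightarrow> invertible g"
  using GR_group_P21 P21_iff by blast

lemma GR_group_GR_unip: "GR_unip X Y Z \<in> GR_group"
proof -
  have "GR_unip X Y Z = mat 1 ** GR_unip X Y Z" by simp
  thus ?thesis unfolding GR_group_def using one_neq_zero by blast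
qed

lemma GR_group_mat: "h \<noteq> 0 \<Longrightarrow> mat h \<in> GR_group"
  using GR_unip_0 matrix_mul_rid[of "mat h"] unfolding GR_group_def by (metis (mono_tags, lifting) mem_Collect_eq)

lemma (in p_adic_quaternion) nu_inverse_le:
  assumes "\<not> \<nu> z \<le> 1 / r" "0 < r" shows "z \<noteq> 0" "\<nu> (inverse z) \<le> r"
proof -
  show "z \<noteq> 0" using assms by auto
  have "inverse (\<nu> z) \<le> inverse (1 / r)" using assms by (intro le_imp_inverse_le) auto
  thus "\<nu> (inverse z) \<le> r" by (simp add: nu_inverse)
qed

locale GR_setup = p_adic_quaternion prm absF D
  for prm :: nat and absF :: "'f::field_char_0 \<Rightarrow> real" and D :: "('f, 'd::division_ring) quat" +
  fixes \<psi> \<omega> :: "'f \<Rightarrow> complex" and \<pi> :: "('d^2^2, 'v::ab_group_add) rep"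
  assumes psi: "nontrivial_additive_character absF \<psi>" and omega: "unitary_character absF \<omega>"
    and smooth: "smooth_representation GL (GL_top absF D) \<pi>"
begin

abbreviation "sc \<equiv> rscale \<pi>"
abbreviation "S \<equiv> rspace \<pi>"

lemma rep: "representation GL \<pi>" using smooth by (simp add: smooth_representation_def)

sublocale vs: vector_space sc using rep by (simp add: representation_def)

lemma S_subspace: "vs.subspace S" using rep by (simp add: representation_def)

lemma S_0: "0 \<in> S" and S_add: "v \<in> S \<Longrightarrow> w \<in> S \<Longrightarrow> v + w \<in> S" and S_diff: "v \<in> S \<Longrightarrow> w \<in> S \<Longrightarrow> v - w \<in> S"
  and S_scale: "v \<in> S \<Longrightarrow> sc c v \<in> S"
  using S_subspace by (auto intro: vs.subspace_0 vs.subspace_add vs.subspace_diff vs.subspace_scale)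

lemma pi_S: "invertible g \<Longrightarrow> v \<in> S \<Longrightarrow> ract \<pi> g v \<in> S"
  and pi_add: "invertible g \<Longrightarrow> v \<in> S \<Longrightarrow> w \<in> S \<Longrightarrow> ract \<pi> g (v + w) = ract \<pi> g v + ract \<pi> g w"
  and pi_scale: "invertible g \<Longrightarrow> v \<in> S \<Longrightarrow> ract \<pi> g (sc c v) = sc c (ract \<pi> g v)"
  and pi_one: "v \<in> S \<Longrightarrow> ract \<pi> (mat 1) v = v"
  and pi_mult: "invertible g \<Longrightarrow> invertible h \<Longrightarrow> v \<in> S \<Longrightarrow> ract \<pi> (g ** h) v = ract \<pi> g (ract \<pi> h v)"
  using rep by (simp_all add: representation_def)

definition \<theta> :: "'d \<Rightarrow> complex" where "\<theta> h = inverse (\<omega> (rnorm D h))"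

lemma omega_nz: "x \<noteq> 0 \<Longrightarrow> \<omega> x \<noteq> 0"
  using omega unfolding unitary_character_def by (metis norm_zero zero_neq_one)

lemma \<theta>_mult: "h \<noteq> 0 \<Longrightarrow> k \<noteq> 0 \<Longrightarrow> \<theta> (h * k) = \<theta> h * \<theta> k"
  using omega rnorm_eq_0 unfolding unitary_character_def \<theta>_def rnorm_mult by (simp add: rnorm_eq_0)

lemma \<theta>_omega: "h \<noteq> 0 \<Longrightarrow> \<omega> (rnorm D h) * \<theta> h = 1"
  using omega_nz[of "rnorm D h"] by (simp add: \<theta>_def rnorm_eq_0)

lemma \<theta>_1: "\<theta> 1 = 1"
  using \<theta>_mult[of 1 1] \<theta>_omega[of 1] by auto

definition \<Psi> :: "'d \<Rightarrow> complex" where "\<Psi> x = \<psi> (rtrace D x)"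

lemma psi_add: "\<psi> (x + y) = \<psi> x * \<psi> y" and psi_norm: "cmod (\<psi> x) = 1"
  using psi unfolding nontrivial_additive_character_def by auto

lemma \<Psi>_add: "\<Psi> (x + y) = \<Psi> x * \<Psi> y" by (simp add: \<Psi>_def rtrace_add psi_add)
lemma \<Psi>_nz: "\<Psi> x \<noteq> 0" using psi_norm[of "rtrace D x"] by (auto simp: \<Psi>_def)
lemma \<Psi>_0 [simp]: "\<Psi> 0 = 1" using \<Psi>_add[of 0 0] \<Psi>_nz[of 0] by simp
lemma \<Psi>_conj: "h \<noteq> 0 \<Longrightarrow> \<Psi> (h * x * inverse h) = \<Psi> x" by (simp add: \<Psi>_def rtrace_conj)

text \<open>The ball of radius \<open>r0\<close> serves as the unit of volume. On it the character
  disappears from the integrals, so functions supported there see only the form on \<pi>_D.\<close>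

definition r0 :: real where "r0 = (SOME r. r > 0 \<and> (\<forall>x. \<nu> x \<le> r \<longrightarrow> \<Psi> x = 1))"

lemma r0: "r0 > 0" "\<nu> x \<le> r0 \<Longrightarrow> \<Psi> x = 1"
proof -
  have "\<exists>r. r > 0 \<and> (\<forall>x. \<nu> x \<le> r \<longrightarrow> \<Psi> x = 1)"
    using trace_character_trivial_near_0[OF psi] unfolding \<Psi>_def by blast
  hence "r0 > 0 \<and> (\<forall>x. \<nu> x \<le> r0 \<longrightarrow> \<Psi> x = 1)" unfolding r0_def by (rule someI_ex)
  thus "r0 > 0" "\<nu> x \<le> r0 \<Longrightarrow> \<Psi> x = 1" by auto
qed

definition \<xi> :: "'d^3^3 \<Rightarrow> complex" where "\<xi> = GR_char D \<psi>"

lemma \<xi>_eq: "h \<noteq> 0 \<Longrightarrow> \<xi> (mat h ** GR_unip X Y Z) = \<Psi> X * \<Psi> Y"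
  by (simp add: \<xi>_def GR_char_def mult3_nth mat_nth mult.assoc[symmetric] psi_add \<Psi>_def)

lemma \<xi>_GR_unip: "\<xi> (GR_unip X Y Z) = \<Psi> X * \<Psi> Y"
  using \<xi>_eq[of 1 X Y Z] by simp

lemma \<xi>_mat: "h \<noteq> 0 \<Longrightarrow> \<xi> (mat h) = 1"
  using \<xi>_eq[of h 0 0 0] by (simp add: GR_unip_0)

text \<open>The inducing representation of P with the normalizing factor included, so that functions
  in the induced space satisfy f(p g) = \<open>\<tau>\<close> p (f g).\<close>

definition \<tau> :: "'d^3^3 \<Rightarrow> 'v \<Rightarrow> 'v" where
  "\<tau> p v = sc (complex_of_real (sqrt (\<delta> p)) * \<theta> (p$3$3)) (ract \<pi> (block2 p) v)"

lemma \<tau>_S: "p \<in> P21 \<Longrightarrow> v \<in> S \<Longrightarrow> \<tau> p v \<in> S"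
  by (simp add: \<tau>_def S_scale pi_S invertible_block2)

lemma \<tau>_add: "p \<in> P21 \<Longrightarrow> v \<in> S \<Longrightarrow> w \<in> S \<Longrightarrow> \<tau> p (v + w) = \<tau> p v + \<tau> p w"
  by (simp add: \<tau>_def pi_add invertible_block2 vs.scale_right_distrib)

lemma \<tau>_scale: "p \<in> P21 \<Longrightarrow> v \<in> S \<Longrightarrow> \<tau> p (sc c v) = sc c (\<tau> p v)"
  by (simp add: \<tau>_def pi_scale invertible_block2 mult.commute)

lemma \<tau>_0: "p \<in> P21 \<Longrightarrow> \<tau> p 0 = 0"
  using \<tau>_add[of p 0 0] S_0 by simp

lemma \<tau>_diff: "p \<in> P21 \<Longrightarrow> v \<in> S \<Longrightarrow> w \<in> S \<Longrightarrow> \<tau> p (v - w) = \<tau> p v - \<tau> p w"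
  using \<tau>_add[of p "v - w" w] by (simp add: S_diff)

lemma \<tau>_mult: assumes "p \<in> P21" "q \<in> P21" "v \<in> S" shows "\<tau> (p ** q) v = \<tau> p (\<tau> q v)"
proof -
  have "\<theta> ((p ** q) $ 3 $ 3) = \<theta> (p$3$3) * \<theta> (q$3$3)"
    using assms(1,2)[THEN P21_33(1)] assms(1) by (simp add: P21_mult_33 \<theta>_mult)
  thus ?thesis using assms
    by (simp add: \<tau>_def \<delta>_mult real_sqrt_mult block2_mult pi_mult invertible_block2 pi_scale pi_S mult_ac)
qed

lemma \<tau>_GR_unip: "\<tau> (GR_unip X Y Z) v = ract \<pi> (shalika_unip X) v"
  by (simp add: \<tau>_def \<delta>_GR_unip block2_GR_unip \<theta>_1)

lemma shalika_unip_0: "shalika_unip 0 = mat 1"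
  by (simp add: eq2_iff mat_nth)

lemma \<tau>_N: "v \<in> S \<Longrightarrow> \<tau> (GR_unip 0 Y Z) v = v"
  by (simp add: \<tau>_GR_unip shalika_unip_0 pi_one)

lemma \<tau>_mat: "h \<noteq> 0 \<Longrightarrow> \<tau> (mat h) v = sc (\<theta> h) (ract \<pi> (mat h) v)"
  by (simp add: \<tau>_def \<delta>_mat block2_mat mat_nth)

text \<open>Near the identity the three factors are trivial for separate reasons: \<pi>_D is smooth,
  the character of the reduced norm is locally trivial, and the modulus is 1 on congruence
  subgroups.\<close>

lemma \<tau>_smooth: assumes v: "v \<in> S" shows "\<exists>r>0. r < 1 \<and> (\<forall>p\<in>P21. p \<in> Kc r \<longrightarrow> \<tau> p v = v)"
proof -
  have "openin (GL_top absF D) {g \<in> carrier GL. ract \<pi> g v = v}"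
    using smooth v unfolding smooth_representation_def by blast
  moreover have "mat 1 \<in> {g \<in> carrier GL. ract \<pi> g v = v}" using pi_one[OF v] GL.one_closed by simp
  ultimately obtain r where r: "r > 0" "r < 1" "Kc r \<subseteq> {g \<in> carrier GL. ract \<pi> g v = v}"
    using open_contains_Kc by blast
  obtain e where e: "e > 0" "\<And>x. \<nu> (x - 1) \<le> e \<Longrightarrow> \<omega> (rnorm D x) = 1"
    using norm_character_trivial_near_1[OF omega] by blast
  have "\<tau> p v = v" if p: "p \<in> P21" "p \<in> Kc (min r e)" for p
  proof -
    have le: "\<nu> ((p - mat 1) $ i $ j) \<le> min r e" for i j using p(2) unfolding Kc_def mat_le_def by blast
    have "\<delta> p = 1" using p(1) Kc_mono[of "min r e" r] p(2) r by (intro \<delta>_Kc[of _ r]) auto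
    moreover have "\<theta> (p$3$3) = 1" using e(2)[of "p$3$3"] le[of 3 3] by (simp add: \<theta>_def mat_nth)
    moreover have "\<nu> ((block2 p - mat 1) $ i $ j) \<le> r" for i j
      using exhaust_2[of i] exhaust_2[of j] le[of 1 1] le[of 1 2] le[of 2 1] le[of 2 2] by (auto simp: mat_nth)
    hence "block2 p \<in> Kc r" unfolding Kc_def mat_le_def using invertible_block2[OF p(1)] by blast
    hence "ract \<pi> (block2 p) v = v" using r(3) by blast
    ultimately show ?thesis by (simp add: \<tau>_def)
  qed
  thus ?thesis using r e by (intro exI[of _ "min r e"]) auto
qed

section \<open>The induced space and its two subspaces\<close>

definition V :: "('d^3^3 \<Rightarrow> 'v) set" where "V = rspace (induced_GL3 absF D \<pi> \<theta>)"

definition act :: "'d^3^3 \<Rightarrow> ('d^3^3 \<Rightarrow> 'v) \<Rightarrow> 'd^3^3 \<Rightarrow> 'v" where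
  "act g f = (\<lambda>x. if invertible x then f (x ** g) else 0)"

definition scf :: "complex \<Rightarrow> ('d^3^3 \<Rightarrow> 'v) \<Rightarrow> 'd^3^3 \<Rightarrow> 'v" where "scf c f = (\<lambda>x. sc c (f x))"

lemma ract_induced: "ract (induced_GL3 absF D \<pi> \<theta>) = act"
  and rscale_induced: "rscale (induced_GL3 absF D \<pi> \<theta>) = scf"
  by (intro ext; simp add: induced_GL3_def normalized_induction_def act_def scf_def levi_rep_def)+

text \<open>The modulus is replaced by \<open>\<delta>\<close>, and the open subgroup fixing
  \<open>f\<close> by a congruence subgroup, which is possible because these form a base at the
  identity.\<close>

lemma V_iff: "f \<in> V \<longleftrightarrow> (\<forall>g. invertible g \<longrightarrow> f g \<in> S) \<and> (\<forall>g. \<not> invertible g \<longrightarrow> f g = 0) \<and>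
   (\<forall>p\<in>P21. \<forall>g. invertible g \<longrightarrow> f (p ** g) = \<tau> p (f g)) \<and>
   (\<exists>r>0. r < 1 \<and> (\<forall>g k. invertible g \<longrightarrow> k \<in> Kc r \<longrightarrow> f (g ** k) = f g))"
proof -
  have "(\<exists>K. subgroup K GL \<and> openin (GL_top absF D) K \<and> (\<forall>g. invertible g \<longrightarrow> (\<forall>k\<in>K. f (g ** k) = f g))) \<longleftrightarrow>
      (\<exists>r>0. r < 1 \<and> (\<forall>g k. invertible g \<longrightarrow> k \<in> Kc r \<longrightarrow> f (g ** k) = f g))" (is "?l \<longleftrightarrow> ?r")
  proof
    assume ?l
    then obtain K where K: "subgroup K GL" "openin (GL_top absF D) K" "\<And>g k. invertible g \<Longrightarrow> k \<in> K \<Longrightarrow> f (g ** k) = f g" by blast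
    have "mat 1 \<in> K" using subgroup.one_closed[OF K(1)] by simp
    then obtain r where "r > 0" "r < 1" "Kc r \<subseteq> K" using open_contains_Kc[OF K(2)] by blast
    thus ?r using K(3) by blast
  next
    assume ?r
    then obtain r where "r > 0" "r < 1" "\<And>g k. invertible g \<Longrightarrow> k \<in> Kc r \<Longrightarrow> f (g ** k) = f g" by blast
    thus ?l using subgroup_Kc[of r] openin_Kc[of r] by blast
  qed
  moreover have "sc (complex_of_real (sqrt (modulus GL (GL_top absF D) N21 p))) (sc (\<theta> (p$3$3)) (ract \<pi> (block2 p) v)) = \<tau> p v"
    if "p \<in> P21" for p v using modulus_eq_\<delta>[OF that] by (simp add: \<tau>_def)
  ultimately show ?thesis
    unfolding V_def induced_GL3_def normalized_induction_def levi_rep_def by (simp add: Ball_def)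
qed

lemma V_S: "f \<in> V \<Longrightarrow> invertible g \<Longrightarrow> f g \<in> S"
  and V_zero: "f \<in> V \<Longrightarrow> \<not> invertible g \<Longrightarrow> f g = 0"
  and V_left: "f \<in> V \<Longrightarrow> p \<in> P21 \<Longrightarrow> invertible g \<Longrightarrow> f (p ** g) = \<tau> p (f g)"
  by (auto simp: V_iff)

lemma V_right:
  assumes "f \<in> V"
  obtains r where "r > 0" "r < 1" "\<And>g k. invertible g \<Longrightarrow> k \<in> Kc r \<Longrightarrow> f (g ** k) = f g"
  using assms unfolding V_iff by blast

lemma V_linear:
  assumes f: "f \<in> V" and g: "g \<in> V" shows "f + g \<in> V" "f - g \<in> V" "scf c f \<in> V"
proof -
  obtain r1 where r1: "r1 > 0" "r1 < 1" "\<And>x k. invertible x \<Longrightarrow> k \<in> Kc r1 \<Longrightarrow> f (x ** k) = f x" using V_right[OF f] by blast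
  obtain r2 where r2: "r2 > 0" "r2 < 1" "\<And>x k. invertible x \<Longrightarrow> k \<in> Kc r2 \<Longrightarrow> g (x ** k) = g x" using V_right[OF g] by blast
  have m: "k \<in> Kc (min r1 r2) \<Longrightarrow> k \<in> Kc r1 \<and> k \<in> Kc r2" for k :: "'d^3^3"
    using Kc_mono[of "min r1 r2" r1] Kc_mono[of "min r1 r2" r2] by auto
  show "f + g \<in> V" unfolding V_iff using f g r1 r2 m
    by (intro conjI exI[of _ "min r1 r2"]) (auto simp: V_S V_zero V_left S_add \<tau>_add)
  show "f - g \<in> V" unfolding V_iff using f g r1 r2 m
    by (intro conjI exI[of _ "min r1 r2"]) (auto simp: V_S V_zero V_left S_diff \<tau>_diff)
  show "scf c f \<in> V" unfolding V_iff using f r1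
    by (intro conjI exI[of _ r1]) (auto simp: scf_def V_S V_zero V_left S_scale \<tau>_scale)
qed

lemma V_act: assumes f: "f \<in> V" and g: "invertible g" shows "act g f \<in> V"
proof -
  obtain r where r: "r > 0" "r < 1" "\<And>x k. invertible x \<Longrightarrow> k \<in> Kc r \<Longrightarrow> f (x ** k) = f x" using V_right[OF f] by blast
  let ?h = "inv\<^bsub>GL\<^esub> g"
  obtain M M' where M: "M > 0" "M' > 0" "mat_le ?h M" "mat_le g M'" using mat_le_exists by meson
  \<comment> \<open>The translated function is invariant under \<open>k\<close> as soon as the
    conjugate of \<open>k\<close> by \<open>g\<close> lies in \<open>Kc r\<close>. Conjugation
    scales the level by at most \<open>M * M'\<close>.\<close>
  define e where "e = min (1/2) (r / (M * M'))"
  have e: "e > 0" "e < 1" "M * e * M' \<le> r" using M r by (auto simp: e_def min_def field_simps)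
  have hinv: "inv\<^bsub>GL\<^esub> ?h = g" using GL.inv_inv[of g] g by simp
  have "act g f (x ** k) = act g f x" if x: "invertible x" and k: "k \<in> Kc e" for x k
  proof -
    have kinv: "invertible k" using k by (simp add: Kc_def)
    have "?h ** k ** g \<in> Kc (M * e * M')" using Kc_conj[OF M(3), of M' k e] M(4) hinv g k by simp
    hence "?h ** k ** g \<in> Kc r" using Kc_mono[OF e(3)] by blast
    hence "f (x ** g ** (?h ** k ** g)) = f (x ** g)" using r(3) x g by (simp add: invertible_matrix_mult)
    moreover have "x ** g ** (?h ** k ** g) = x ** (g ** ?h) ** k ** g" by (simp only: matrix_mul_assoc)
    ultimately show ?thesis using x g kinv by (simp add: act_def invertible_matrix_mult)
  qed
  moreover have "act g f (p ** x) = \<tau> p (act g f x)" if "p \<in> P21" "invertible x" for p x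
    using V_left[OF f that(1), of "x ** g"] that g by (simp add: act_def invertible_matrix_mult matrix_mul_assoc P21_iff)
  moreover have "act g f x \<in> S" if "invertible x" for x
    using V_S[OF f, of "x ** g"] that g by (simp add: act_def invertible_matrix_mult)
  moreover have "act g f x = 0" if "\<not> invertible x" for x using that by (simp add: act_def)
  ultimately show ?thesis unfolding V_iff using e by blast
qed

lemma act_linear:
  "act g (f + f') = act g f + act g f'" "act g (f - f') = act g f - act g f'" "act g (scf c f) = scf c (act g f)"
  by (auto simp: act_def scf_def)

lemma act_mult: "invertible g \<Longrightarrow> act (g ** h) f = act g (act h f)"
  by (auto simp: act_def invertible_matrix_mult matrix_mul_assoc)

text \<open>\<open>V1\<close> consists of the functions supported off the closed orbit,
  \<open>V0\<close> of those supported on the open one. Compact support modulo P is not imposed: it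
  follows from invariance under an open subgroup.\<close>

definition V1 :: "('d^3^3 \<Rightarrow> 'v) set" where "V1 = {f \<in> V. \<forall>g\<in>P21. f g = 0}"

definition V0 :: "('d^3^3 \<Rightarrow> 'v) set" where "V0 = {f \<in> V. \<forall>g. invertible g \<and> g$3$1 = 0 \<longrightarrow> f g = 0}"

lemma V0_V1: "V0 \<subseteq> V1" and V1_V: "V1 \<subseteq> V"
  by (auto simp: V0_def V1_def P21_iff)

lemma V1_linear: "f \<in> V1 \<Longrightarrow> g \<in> V1 \<Longrightarrow> f + g \<in> V1" "f \<in> V1 \<Longrightarrow> g \<in> V1 \<Longrightarrow> f - g \<in> V1" "f \<in> V1 \<Longrightarrow> scf c f \<in> V1"
  by (auto simp: V1_def V_linear) (simp add: scf_def)

lemma V0_linear: "f \<in> V0 \<Longrightarrow> g \<in> V0 \<Longrightarrow> f + g \<in> V0" "f \<in> V0 \<Longrightarrow> g \<in> V0 \<Longrightarrow> f - g \<in> V0" "f \<in> V0 \<Longrightarrow> scf c f \<in> V0"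
  by (auto simp: V0_def V_linear) (simp add: scf_def)

lemma V1_act: "g \<in> GR_group \<Longrightarrow> f \<in> V1 \<Longrightarrow> act g f \<in> V1"
proof -
  assume g: "g \<in> GR_group" and f: "f \<in> V1"
  have "act g f x = 0" if "x \<in> P21" for x
    using f P21_mult[OF that GR_group_P21[OF g]] that by (simp add: V1_def act_def)
  thus ?thesis using f V_act[OF _ GR_group_invertible[OF g], of f] unfolding V1_def by blast
qed

lemma V0_act: "g \<in> GR_group \<Longrightarrow> f \<in> V0 \<Longrightarrow> act g f \<in> V0"
proof -
  assume g: "g \<in> GR_group" and f: "f \<in> V0"
  have eq: "(x ** g) $ 3 $ 1 = 0" if "x $ 3 $ 1 = 0" for x :: "'d^3^3"
    using g that by (elim GR_groupE) (simp add: mult3_nth mat_nth)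
  have "act g f x = 0" if "invertible x" "x $ 3 $ 1 = 0" for x
    using f eq[OF that(2)] that GR_group_invertible[OF g] by (simp add: V0_def act_def invertible_matrix_mult)
  thus ?thesis using f V_act[OF _ GR_group_invertible[OF g], of f] unfolding V0_def by blast
qed

definition equiv_form :: "('d^3^3 \<Rightarrow> 'v) set \<Rightarrow> (('d^3^3 \<Rightarrow> 'v) \<Rightarrow> complex) \<Rightarrow> bool" where
  "equiv_form X L \<longleftrightarrow> (\<forall>f\<in>X. \<forall>f'\<in>X. L (f + f') = L f + L f') \<and> (\<forall>c. \<forall>f\<in>X. L (scf c f) = c * L f) \<and>
     (\<forall>g\<in>GR_group. \<forall>f\<in>X. L (act g f) = \<xi> g * L f)"

text \<open>Both families are normalized by R, which changes \<open>X\<close> or \<open>Y\<close>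
  only by conjugation with some \<open>h\<close> and otherwise affects the corner. The reduced trace
  is invariant under conjugation, so the character values are preserved.\<close>

lemma GR_group_conj_abelian:
  assumes g: "g \<in> GR_group"
  shows "\<exists>Z'. \<exists>h. h \<noteq> 0 \<and> g ** GR_unip X 0 Z = GR_unip (h * X * inverse h) 0 Z' ** g"
    and "\<exists>Z'. \<exists>h. h \<noteq> 0 \<and> g ** GR_unip 0 Y Z = GR_unip 0 (h * Y * inverse h) Z' ** g"
proof -
  obtain h X1 Y1 Z1 where h: "h \<noteq> 0" "g = mat h ** GR_unip X1 Y1 Z1" using g by (rule GR_groupE)
  have "GR_unip X1 Y1 Z1 ** GR_unip X 0 Z = GR_unip X 0 (Z - X * Y1) ** GR_unip X1 Y1 Z1"
    by (simp add: GR_unip_mult algebra_simps)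
  hence "g ** GR_unip X 0 Z = (mat h ** GR_unip X 0 (Z - X * Y1)) ** GR_unip X1 Y1 Z1"
    using h(2) by (metis matrix_mul_assoc)
  also have "\<dots> = GR_unip (h * X * inverse h) 0 (h * (Z - X * Y1) * inverse h) ** g"
    using mat_mult_GR_unip[OF h(1), of X 0] h(2) by (simp add: matrix_mul_assoc)
  finally show "\<exists>Z'. \<exists>h. h \<noteq> 0 \<and> g ** GR_unip X 0 Z = GR_unip (h * X * inverse h) 0 Z' ** g" using h(1) by blast
  have "GR_unip X1 Y1 Z1 ** GR_unip 0 Y Z = GR_unip 0 Y (Z + X1 * Y) ** GR_unip X1 Y1 Z1"
    by (simp add: GR_unip_mult algebra_simps)
  hence "g ** GR_unip 0 Y Z = (mat h ** GR_unip 0 Y (Z + X1 * Y)) ** GR_unip X1 Y1 Z1"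
    using h(2) by (metis matrix_mul_assoc)
  also have "\<dots> = GR_unip 0 (h * Y * inverse h) (h * (Z + X1 * Y) * inverse h) ** g"
    using mat_mult_GR_unip[OF h(1), of 0 Y] h(2) by (simp add: matrix_mul_assoc)
  finally show "\<exists>Z'. \<exists>h. h \<noteq> 0 \<and> g ** GR_unip 0 Y Z = GR_unip 0 (h * Y * inverse h) Z' ** g" using h(1) by blast
qed

interpretation ext1: equivariant_extension scf V V1 act GR_group "{GR_unip 0 Y Z | Y Z. True}" \<xi>
proof
  show "scf c (v - w) = scf c v - scf c w" for c v w by (auto simp: scf_def vs.scale_right_diff_distrib)
  show "{GR_unip 0 Y Z |Y Z. True} \<subseteq> GR_group" using GR_group_GR_unip by blast
  show "act a (act b v) = act b (act a v)"
    if "a \<in> {GR_unip 0 Y Z |Y Z. True}" "b \<in> {GR_unip 0 Y Z |Y Z. True}" for a b v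
    using that by (auto simp: act_mult[symmetric] GR_unip_inv GR_unip_mult add.commute)
  show "\<exists>a'\<in>{GR_unip 0 Y Z |Y Z. True}. \<xi> a' = \<xi> a \<and> (\<forall>v\<in>V. act g (act a v) = act a' (act g v))"
    if g: "g \<in> GR_group" and a: "a \<in> {GR_unip 0 Y Z |Y Z. True}" for g a
  proof -
    obtain Y Z where a: "a = GR_unip 0 Y Z" using a by blast
    obtain h Z' where h: "h \<noteq> 0" "g ** a = GR_unip 0 (h * Y * inverse h) Z' ** g"
      using GR_group_conj_abelian(2)[OF g] a by blast
    have "act g (act a v) = act (GR_unip 0 (h * Y * inverse h) Z') (act g v)" for v
      using h(2) by (simp add: act_mult[symmetric] GR_group_invertible[OF g] GR_unip_inv)
    moreover have "\<xi> (GR_unip 0 (h * Y * inverse h) Z') = \<xi> a"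
      by (simp add: a \<xi>_GR_unip \<Psi>_conj h(1))
    ultimately show ?thesis by blast
  qed
qed (simp_all add: V_linear V1_linear V1_V V_act GR_group_invertible V1_act act_linear)

interpretation ext0: equivariant_extension scf V1 V0 act GR_group "{GR_unip X 0 Z | X Z. True}" \<xi>
proof
  show "scf c (v - w) = scf c v - scf c w" for c v w by (auto simp: scf_def vs.scale_right_diff_distrib)
  show "{GR_unip X 0 Z |X Z. True} \<subseteq> GR_group" using GR_group_GR_unip by blast
  show "act a (act b v) = act b (act a v)"
    if "a \<in> {GR_unip X 0 Z |X Z. True}" "b \<in> {GR_unip X 0 Z |X Z. True}" for a b v
    using that by (auto simp: act_mult[symmetric] GR_unip_inv GR_unip_mult add.commute)
  show "\<exists>a'\<in>{GR_unip X 0 Z |X Z. True}. \<xi> a' = \<xi> a \<and> (\<forall>v\<in>V1. act g (act a v) = act a' (act g v))"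
    if g: "g \<in> GR_group" and a: "a \<in> {GR_unip X 0 Z |X Z. True}" for g a
  proof -
    obtain X Z where a: "a = GR_unip X 0 Z" using a by blast
    obtain h Z' where h: "h \<noteq> 0" "g ** a = GR_unip (h * X * inverse h) 0 Z' ** g"
      using GR_group_conj_abelian(1)[OF g] a by blast
    have "act g (act a v) = act (GR_unip (h * X * inverse h) 0 Z') (act g v)" for v
      using h(2) by (simp add: act_mult[symmetric] GR_group_invertible[OF g] GR_unip_inv)
    moreover have "\<xi> (GR_unip (h * X * inverse h) 0 Z') = \<xi> a"
      by (simp add: a \<xi>_GR_unip \<Psi>_conj h(1))
    ultimately show ?thesis by blast
  qed
qed (simp_all add: V_linear V1_linear V0_linear V0_V1 V1_act V0_act act_linear)

lemma equiv_form_ext1: "equiv_form X L = ext1.equivariant X L"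
  and equiv_form_ext0: "equiv_form X L = ext0.equivariant X L"
  by (simp_all add: equiv_form_def ext1.equivariant_def ext0.equivariant_def)

text \<open>The stabilizer in \<open>U\<close> of the closed orbit contains \<open>u(0,Y,0)\<close>, which acts trivially on the
  restriction of \<open>f\<close> to \<open>P\<close>, although \<open>\<xi>\<close> is nontrivial on it.\<close>

lemma kill_closed_orbit:
  assumes f: "f \<in> V" shows "\<exists>as. ext1.good as \<and> ext1.diff_ops as f \<in> V1"
proof -
  obtain Y where Y: "\<Psi> Y \<noteq> 1" using trace_character_nontrivial[OF psi] by (auto simp: \<Psi>_def)
  let ?a = "GR_unip 0 Y 0"
  have "act ?a f p = f p" if p: "p \<in> P21" for p
  proof -
    obtain Y' Z' where "p ** ?a ** inv\<^bsub>GL\<^esub> p = GR_unip 0 Y' Z'" using P21_conj_N21[OF p] by blast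
    hence "p ** ?a = GR_unip 0 Y' Z' ** p"
      using p by (metis GL_inv(2) P21_iff matrix_mul_assoc matrix_mul_rid)
    thus ?thesis using p V_left[OF f P21_GR_unip, of p 0 Y' Z'] \<tau>_N V_S[OF f]
      by (simp add: act_def P21_iff)
  qed
  hence "ext1.diff_ops [?a] f \<in> V1" using f by (auto simp: V1_def V_linear V_act GR_unip_inv)
  moreover have "ext1.good [?a]" unfolding ext1.good_def using Y by (auto simp: \<xi>_GR_unip)
  ultimately show ?thesis by blast
qed

text \<open>On the middle orbit the point \<open>wm2 u(0,z,0)\<close> is stabilized by \<open>u(X,0,X z)\<close>. Functions in \<open>V1\<close>
  have compact support in \<open>z\<close>, so finitely many of these elements suffice.\<close>

lemma middle_shift:
  "wm2 ** GR_unip 0 z 0 ** GR_unip X 0 Z = GR_unip (Z - X * z) 0 X ** (wm2 ** GR_unip 0 z 0)"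
proof -
  have "GR_unip 0 z 0 ** GR_unip X 0 Z = GR_unip X 0 (Z - X * z) ** GR_unip 0 z 0"
    by (simp add: GR_unip_mult)
  thus ?thesis by (metis matrix_mul_assoc wm2_GR_unip)
qed

lemma kill_middle_orbit:
  assumes f: "f \<in> V1" shows "\<exists>as. ext0.good as \<and> ext0.diff_ops as f \<in> V0"
proof -
  have fV: "f \<in> V" using f V1_V by blast
  obtain X where X: "\<Psi> X \<noteq> 1" using trace_character_nontrivial[OF psi] by (auto simp: \<Psi>_def)
  obtain r where r: "r > 0" "r < 1" "\<And>x k. invertible x \<Longrightarrow> k \<in> Kc r \<Longrightarrow> f (x ** k) = f x" using V_right[OF fV] by blast
  let ?u = "\<lambda>z::'d. wm2 ** GR_unip 0 z 0"
  have uinv: "invertible (?u z)" for z by (simp add: invertible_matrix_mult GR_unip_inv)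
  \<comment> \<open>The operators act pointwise on the values at the points \<open>?u z\<close>, so
    a zero created at one of these points survives all further operators.\<close>
  have pres1: "(act a f' - f') (?u z) = 0"
    if "f' \<in> V1" "f' (?u z) = 0" "a \<in> {GR_unip X 0 Z | X Z. True}" for f' a z
  proof -
    obtain Xa Z where a: "a = GR_unip Xa 0 Z" using \<open>a \<in> _\<close> by blast
    have "f' \<in> V" using that(1) V1_V by blast
    hence "act a f' (?u z) = \<tau> (GR_unip (Z - Xa * z) 0 Xa) (f' (?u z))"
      using V_left[OF _ P21_GR_unip uinv, of f'] uinv[of z] by (simp add: a act_def middle_shift)
    thus ?thesis using that(2) \<tau>_0[OF P21_GR_unip] by simp
  qed
  have pres: "ext0.diff_ops as f' (?u z) = 0" if "ext0.good as" "f' \<in> V1" "f' (?u z) = 0" for as f' z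
    using that
  proof (induction as)
    case (Cons a as)
    note a = iffD1[OF ext0.good_simps(2) Cons.prems(1)]
    show ?case unfolding ext0.diff_ops_simps
      by (rule pres1) (use a Cons ext0.diff_ops_V[of as f'] in blast)+
  qed simp
  \<comment> \<open>A \<open>z\<close> within distance \<open>d\<close> of \<open>t\<close>
    satisfies \<nu>(X t - X z) \<le> r. Hence the element that stabilizes the point of parameter
    \<open>t\<close> also acts trivially on the value at \<open>z\<close>. The summand 1 keeps the
    denominator positive.\<close>
  define d where "d = r / (1 + \<nu> X)"
  have nX: "1 + \<nu> X > 0" by (simp add: add_pos_nonneg)
  have d: "d > 0" using r nX by (simp add: d_def)
  obtain T where T: "finite T" "cb (1 / r) 0 \<subseteq> (\<Union>x\<in>T. cb d x)" using finite_cover_cb[OF d] by blast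
  obtain zs where zs: "set zs = T" using finite_list[OF T(1)] by blast
  define as where "as = map (\<lambda>z. GR_unip X 0 (X * z)) zs"
  have good: "ext0.good as" unfolding ext0.good_def as_def using X by (auto simp: \<xi>_GR_unip)
  have zero: "ext0.diff_ops as f (?u z) = 0" for z
  proof (cases "\<nu> z \<le> 1 / r")
    case True
    hence "z \<in> cb (1 / r) 0" by (simp add: cb_def)
    then obtain t where t: "t \<in> T" "\<nu> (z - t) \<le> d" using T(2) unfolding cb_def by blast
    let ?a = "GR_unip X 0 (X * t)"
    have "?a \<in> set as" using t zs by (auto simp: as_def)
    \<comment> \<open>Since the operators commute, the one belonging to the net point
      \<open>t\<close> near \<open>z\<close> may be applied first; it already kills the value at
      \<open>z\<close>.\<close>
    then obtain as1 as2 where as12: "as = as1 @ ?a # as2" by (meson split_list)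
    have g12: "ext0.good as1" "ext0.good as2" "ext0.good [?a]" using good unfolding as12 ext0.good_def by auto
    have "ext0.diff_ops as f = ext0.diff_ops as1 (ext0.diff_ops [?a] (ext0.diff_ops as2 f))"
      by (simp add: as12 ext0.diff_ops_append)
    also have "\<dots> = ext0.diff_ops as1 (ext0.diff_ops as2 (ext0.diff_ops [?a] f))"
      by (simp only: ext0.diff_ops_commute[OF g12(3,2) f])
    finally have eq: "ext0.diff_ops as f = ext0.diff_ops (as1 @ as2) (ext0.diff_ops [?a] f)" by (simp only: ext0.diff_ops_append)
    have "\<nu> (X * t - X * z) \<le> r"
    proof -
      have "\<nu> (X * t - X * z) = \<nu> X * \<nu> (z - t)"
        by (simp add: right_diff_distrib[symmetric] nu_mult nu_minus_commute[of t z])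
      also have "\<dots> \<le> (1 + \<nu> X) * d" using t d by (intro mult_mono) auto
      also have "\<dots> = r" using nX by (simp add: d_def)
      finally show ?thesis .
    qed
    hence K: "GR_unip 0 0 (X * t - X * z) \<in> Kc r"
      using r by (auto simp: Kc_def mat_le_def forall_3 mat_nth GR_unip_inv)
    have "?u z ** ?a = GR_unip 0 0 X ** (GR_unip (X * t - X * z) 0 0 ** wm2 ** GR_unip 0 z 0)"
      unfolding middle_shift by (simp add: matrix_mul_assoc GR_unip_mult)
    also have "GR_unip (X * t - X * z) 0 0 ** wm2 ** GR_unip 0 z 0 = ?u z ** GR_unip 0 0 (X * t - X * z)"
      by (simp add: wm2_GR_unip[symmetric] matrix_mul_assoc[symmetric] GR_unip_mult)
    finally have "f (?u z ** ?a) = \<tau> (GR_unip 0 0 X) (f (?u z ** GR_unip 0 0 (X * t - X * z)))"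
      using V_left[OF fV P21_GR_unip] uinv by (simp add: invertible_matrix_mult GR_unip_inv)
    also have "\<dots> = f (?u z)" using r(3)[OF uinv K] \<tau>_N[OF V_S[OF fV uinv]] by simp
    finally have "ext0.diff_ops [?a] f (?u z) = 0" using uinv by (simp add: act_def)
    moreover have "ext0.diff_ops [?a] f \<in> V1" by (rule ext0.diff_ops_V[OF g12(3) f])
    moreover have "ext0.good (as1 @ as2)" using g12 unfolding ext0.good_def by auto
    ultimately show ?thesis unfolding eq using pres by blast
  next
    case False
    hence z0: "z \<noteq> 0" and zr: "\<nu> (inverse z) \<le> r" using nu_inverse_le r(1) by blast+
    \<comment> \<open>For large \<open>z\<close> this is a small matrix, and it turns the third row
      (0,1,z) into (0,0,z). The translated point lies in P, where functions in \<open>V1\<close>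
      vanish.\<close>
    let ?k = "lowu 0 (- inverse z)"
    have "?k \<in> Kc r" using r zr by (auto simp: Kc_def mat_le_def forall_3 mat_nth invertible_lowu)
    hence "f (?u z) = f (?u z ** ?k)" using r(3) uinv by simp
    moreover have "?u z ** ?k \<in> P21"
      using z0 uinv by (simp add: P21_iff invertible_matrix_mult invertible_lowu mult3_nth)
    ultimately have "f (?u z) = 0" using f by (simp add: V1_def)
    thus ?thesis by (rule pres[OF good f])
  qed
  have TV1: "ext0.diff_ops as f \<in> V1" by (rule ext0.diff_ops_V[OF good f])
  have "ext0.diff_ops as f g = 0" if g: "invertible g" "g$3$1 = 0" for g
  proof (cases "g$3$2 = 0")
    case True thus ?thesis using TV1 g by (simp add: V1_def P21_iff)
  next
    case False
    obtain p z where p: "p \<in> P21" "g = p ** wm2 ** GR_unip 0 z 0" using middle_cell_decomp[OF g False] by blast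
    hence "ext0.diff_ops as f g = \<tau> p (ext0.diff_ops as f (?u z))"
      using V_left[of "ext0.diff_ops as f" p "?u z"] TV1 V1_V uinv by (auto simp: matrix_mul_assoc)
    thus ?thesis using zero \<tau>_0 p(1) by simp
  qed
  hence "ext0.diff_ops as f \<in> V0" using TV1 V1_V by (auto simp: V0_def)
  thus ?thesis using good by blast
qed

lemma equiv_form_unique:
  assumes "equiv_form V L" "\<And>f. f \<in> V0 \<Longrightarrow> L f = 0" "f \<in> V"
  shows "L f = 0"
proof (rule ext1.equivariant_unique[OF kill_closed_orbit])
  show "ext1.equivariant V L" using assms(1) equiv_form_ext1 by simp
  have "ext0.equivariant V1 L" using assms(1) V1_V unfolding equiv_form_ext0[symmetric] equiv_form_def by blast
  thus "L f = 0" if "f \<in> V1" for f using ext0.equivariant_unique[OF kill_middle_orbit] assms(2) that by blast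
qed (use assms in auto)

lemma equiv_form_extend:
  assumes "equiv_form V0 L0"
  shows "\<exists>L. equiv_form V L \<and> (\<forall>f\<in>V0. L f = L0 f)"
proof -
  obtain L1 where L1: "equiv_form V1 L1" "\<forall>f\<in>V0. L1 f = L0 f"
    using ext0.equivariant_exists[OF kill_middle_orbit] assms unfolding equiv_form_ext0 by blast
  obtain L where "equiv_form V L" "\<forall>f\<in>V1. L f = L1 f"
    using ext1.equivariant_exists[OF kill_closed_orbit] L1(1) unfolding equiv_form_ext1 by blast
  thus ?thesis using L1(2) V0_V1 by (intro exI[of _ L]) (auto simp: subset_iff)
qed

end

section \<open>The open orbit\<close>

context p_adic_quaternion
begin

definition csum2 :: "real \<Rightarrow> ('d \<Rightarrow> 'd \<Rightarrow> complex) \<Rightarrow> complex" where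
  "csum2 r G = csum r (\<lambda>X. csum r (G X))"

definition schwartz2 :: "real \<Rightarrow> ('d \<Rightarrow> 'd \<Rightarrow> complex) \<Rightarrow> bool" where
  "schwartz2 r G \<longleftrightarrow> 0 < r \<and> (\<forall>X X' Z Z'. \<nu> (X - X') \<le> r \<longrightarrow> \<nu> (Z - Z') \<le> r \<longrightarrow> G X Z = G X' Z') \<and>
     (\<exists>R. \<forall>X Z. G X Z \<noteq> 0 \<longrightarrow> \<nu> X \<le> R \<and> \<nu> Z \<le> R)"

lemma csum_zero: "csum r (\<lambda>x. 0) = 0"
  by (simp add: csum_def)

lemma schwartz2_pos: "schwartz2 r G \<Longrightarrow> 0 < r" by (simp add: schwartz2_def)

lemma schwartz2_inner: assumes "schwartz2 r G" shows "loc_inv r (G X)" "bdd_supp (G X)"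
proof -
  have inv: "\<And>X X' Z Z'. \<nu> (X - X') \<le> r \<Longrightarrow> \<nu> (Z - Z') \<le> r \<Longrightarrow> G X Z = G X' Z'" and r: "0 < r"
    using assms unfolding schwartz2_def by auto
  have "G X x = G X y" if "\<nu> (x - y) \<le> r" for x y using inv[of X X x y] that r by simp
  thus "loc_inv r (G X)" unfolding loc_inv_def by blast
  show "bdd_supp (G X)" using assms unfolding schwartz2_def bdd_supp_def by blast
qed

lemma schwartz2_outer: assumes "schwartz2 r G" shows "loc_inv r (\<lambda>X. csum s (G X))" "bdd_supp (\<lambda>X. csum s (G X))"
proof -
  have inv: "\<And>X X' Z Z'. \<nu> (X - X') \<le> r \<Longrightarrow> \<nu> (Z - Z') \<le> r \<Longrightarrow> G X Z = G X' Z'" and r: "0 < r"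
    using assms unfolding schwartz2_def by auto
  have "G x = G y" if "\<nu> (x - y) \<le> r" for x y
  proof
    fix z show "G x z = G y z" using inv[of x y z z] that r by simp
  qed
  thus "loc_inv r (\<lambda>X. csum s (G X))" unfolding loc_inv_def by metis
  obtain R where R: "\<And>X Z. G X Z \<noteq> 0 \<Longrightarrow> \<nu> X \<le> R" using assms unfolding schwartz2_def by blast
  have "csum s (G X) = 0" if "\<not> \<nu> X \<le> R" for X
  proof -
    have "G X = (\<lambda>z. 0)" using R that by blast
    thus ?thesis by (simp add: csum_zero)
  qed
  thus "bdd_supp (\<lambda>X. csum s (G X))" unfolding bdd_supp_def by blast
qed

lemma csum2_add:
  assumes "schwartz2 r G" "schwartz2 r H"
  shows "csum2 r (\<lambda>X Z. G X Z + H X Z) = csum2 r G + csum2 r H"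
  using assms schwartz2_pos[OF assms(1)]
  by (simp add: csum2_def csum_add schwartz2_inner schwartz2_outer)

lemma csum2_cmult: "csum2 r (\<lambda>X Z. c * G X Z) = c * csum2 r G"
  by (simp add: csum2_def csum_cmult)

lemma csum2_refine:
  assumes "schwartz2 r G" "0 < s" "s \<le> r"
  shows "csum2 s G = (of_nat (ball_idx r s))\<^sup>2 * csum2 r G"
proof -
  have "csum2 s G = csum s (\<lambda>X. of_nat (ball_idx r s) * csum r (G X))"
    unfolding csum2_def using csum_refine[OF assms(2,3)] schwartz2_inner[OF assms(1)] by simp
  also have "\<dots> = of_nat (ball_idx r s) * (of_nat (ball_idx r s) * csum r (\<lambda>X. csum r (G X)))"
    using csum_refine[OF assms(2,3) schwartz2_outer[OF assms(1)]] by (simp add: csum_cmult)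
  finally show ?thesis by (simp add: csum2_def power2_eq_square)
qed

lemma csum2_translate:
  assumes "schwartz2 r G" shows "csum2 r (\<lambda>X Z. G (X + a) (Z + c)) = csum2 r G"
proof -
  have "csum r (\<lambda>Z. G X (Z + c)) = csum r (G X)" for X
    by (rule csum_translate[OF schwartz2_pos[OF assms] schwartz2_inner(1)[OF assms]])
  hence "csum2 r (\<lambda>X Z. G (X + a) (Z + c)) = csum r (\<lambda>X. csum r (G (X + a)))" by (simp add: csum2_def)
  also have "\<dots> = csum2 r G" unfolding csum2_def
    by (rule csum_translate[OF schwartz2_pos[OF assms] schwartz2_outer(1)[OF assms]])
  finally show ?thesis .
qed

text \<open>For fixed \<open>X\<close> the shear is a translation in \<open>Z\<close>, so already
  the inner sums agree. Invariance of the sheared function in \<open>X\<close> does not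
  enter.\<close>

lemma csum2_shear:
  assumes "schwartz2 r G" shows "csum2 r (\<lambda>X Z. G X (Z + X * Y)) = csum2 r G"
proof -
  have "csum r (\<lambda>Z. G X (Z + X * Y)) = csum r (G X)" for X
    by (rule csum_translate[OF schwartz2_pos[OF assms] schwartz2_inner(1)[OF assms]])
  thus ?thesis by (simp add: csum2_def)
qed

lemma csum2_conj:
  assumes "schwartz2 r G" "h \<noteq> 0"
  shows "csum2 r (\<lambda>X Z. G (h * X * inverse h) (h * Z * inverse h)) = csum2 r G"
proof -
  have "csum r (\<lambda>Z. G X (h * Z * inverse h)) = csum r (G X)" for X
    by (rule csum_conj[OF schwartz2_pos[OF assms(1)] schwartz2_inner(1)[OF assms(1)] assms(2)])
  hence "csum2 r (\<lambda>X Z. G (h * X * inverse h) (h * Z * inverse h)) = csum r (\<lambda>X. csum r (G (h * X * inverse h)))"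
    by (simp add: csum2_def)
  also have "\<dots> = csum2 r G" unfolding csum2_def
    by (rule csum_conj[OF schwartz2_pos[OF assms(1)] schwartz2_outer(1)[OF assms(1)] assms(2)])
  finally show ?thesis .
qed

end

section \<open>Functions on the open cell\<close>

lemma wm_lowu: "wm ** GR_unip X 0 Z = lowu X Z ** wm"
  by (simp add: eq3_iff mult3_nth)

text \<open>The decomposition is unique: the third row determines \<open>X\<close> and
  \<open>Z\<close>, and the last formula recovers the factor in P. The definition of
  \<open>Fv\<close> is modelled on these formulas.\<close>

lemma open_cell_nth:
  assumes "p \<in> P21" "g = p ** wm ** GR_unip X 0 Z"
  shows "g$3$1 = p$3$3" "g$3$2 = p$3$3 * X" "g$3$3 = p$3$3 * Z" "g$3$1 \<noteq> 0"
    "inverse (g$3$1) * g$3$2 = X" "inverse (g$3$1) * g$3$3 = Z" "invertible g"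
    "g ** GR_unip (- X) 0 (- Z) ** wmi = p"
proof -
  show 1: "g$3$1 = p$3$3" "g$3$2 = p$3$3 * X" "g$3$3 = p$3$3 * Z"
    using assms by (simp_all add: mult3_nth P21_iff)
  show "g$3$1 \<noteq> 0" using P21_33(1)[OF assms(1)] 1 by simp
  thus "inverse (g$3$1) * g$3$2 = X" "inverse (g$3$1) * g$3$3 = Z" using 1 by (simp_all add: mult.assoc[symmetric])
  show "invertible g" using assms by (simp add: invertible_matrix_mult GR_unip_inv P21_iff)
  have "g ** GR_unip (- X) 0 (- Z) ** wmi = p ** wm ** (GR_unip X 0 Z ** GR_unip (- X) 0 (- Z)) ** wmi"
    by (simp only: assms(2) matrix_mul_assoc)
  also have "\<dots> = p ** (wm ** wmi)"
    by (simp only: GR_unip_mult) (simp add: GR_unip_0 matrix_mul_assoc[symmetric])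
  finally show "g ** GR_unip (- X) 0 (- Z) ** wmi = p" by simp
qed

context GR_setup
begin

abbreviation \<phi> :: "('d^3^3 \<Rightarrow> 'v) \<Rightarrow> 'd \<Rightarrow> 'd \<Rightarrow> 'v" where
  "\<phi> f X Z \<equiv> f (wm ** GR_unip X 0 Z)"

lemma wu_invertible: "invertible (wm ** GR_unip X Y (Z::'d))"
  by (simp add: invertible_matrix_mult GR_unip_inv)

lemma \<phi>_S: "f \<in> V \<Longrightarrow> \<phi> f X Z \<in> S"
  using V_S wu_invertible by blast

lemma V0_V: "V0 \<subseteq> V" by (auto simp: V0_def)

text \<open>By equivariance under P, a function in \<open>V0\<close> is determined by its values on
  the section \<open>wm ** GR_unip X 0 Z\<close> of the open cell.\<close>

lemma V0_eqI:
  assumes f: "f \<in> V0" "f' \<in> V0" and eq: "\<And>X Z. \<phi> f X Z = \<phi> f' X Z" shows "f = f'"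
proof
  fix g show "f g = f' g"
  proof (cases "invertible g \<and> g$3$1 \<noteq> 0")
    case True
    then obtain p X Z where p: "p \<in> P21" "g = p ** wm ** GR_unip X 0 Z" using open_cell_decomp by blast
    have hg: "h g = \<tau> p (\<phi> h X Z)" if "h \<in> V0" for h
      using V_left[of h p "wm ** GR_unip X 0 Z"] that V0_V p wu_invertible by (auto simp: matrix_mul_assoc)
    show ?thesis using hg[OF f(1)] hg[OF f(2)] eq by simp
  next
    case False
    have hz: "h g = 0" if "h \<in> V0" for h
      using False that V_zero[of h g] by (cases "invertible g") (auto simp: V0_def)
    show ?thesis using hz[OF f(1)] hz[OF f(2)] by simp
  qed
qed

lemma \<phi>_act_A: "\<phi> (act (GR_unip a 0 c) f) X Z = \<phi> f (X + a) (Z + c)"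
  using wu_invertible by (simp add: act_def matrix_mul_assoc[symmetric] GR_unip_mult)

lemma \<phi>_act_Y:
  assumes "f \<in> V"
  shows "\<phi> (act (GR_unip 0 Y 0) f) X Z = ract \<pi> (shalika_unip Y) (\<phi> f X (Z + X * Y))"
proof -
  have "wm ** GR_unip X 0 Z ** GR_unip 0 Y 0 = wm ** GR_unip 0 Y 0 ** GR_unip X 0 (Z + X * Y)"
    by (simp add: matrix_mul_assoc[symmetric] GR_unip_mult)
  also have "\<dots> = GR_unip Y 0 0 ** (wm ** GR_unip X 0 (Z + X * Y))"
    by (simp add: wm_GR_unip matrix_mul_assoc)
  finally show ?thesis
    using V_left[OF assms P21_GR_unip wu_invertible] wu_invertible by (simp add: act_def \<tau>_GR_unip)
qed

lemma \<phi>_act_mat: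
  assumes "f \<in> V" "h \<noteq> 0"
  shows "\<phi> (act (mat h) f) X Z = \<tau> (mat h) (\<phi> f (inverse h * X * h) (inverse h * Z * h))"
proof -
  have "GR_unip X 0 Z ** mat h = mat h ** GR_unip (inverse h * X * h) 0 (inverse h * Z * h)"
    using assms(2) by (simp add: mat_mult_GR_unip mult.assoc) (simp add: mult.assoc[symmetric])
  hence "wm ** GR_unip X 0 Z ** mat h = wm ** mat h ** GR_unip (inverse h * X * h) 0 (inverse h * Z * h)"
    by (metis matrix_mul_assoc)
  also have "\<dots> = mat h ** (wm ** GR_unip (inverse h * X * h) 0 (inverse h * Z * h))"
    by (simp add: wm_mat matrix_mul_assoc)
  finally show ?thesis
    using V_left[OF assms(1) P21_mat[OF assms(2)] wu_invertible] wu_invertible by (simp add: act_def)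
qed

text \<open>For \<open>v\<close> in the space of \<pi>_D, the function on the open cell whose
  restriction to the section is \<open>v\<close> times the indicator of the product of the balls of
  radius \<open>r\<close> in \<open>X\<close> and \<open>s\<close> in \<open>Z\<close>. The argument
  of \<open>\<tau>\<close> is the factor of \<open>g\<close> in P.\<close>

definition Fv :: "'v \<Rightarrow> real \<Rightarrow> real \<Rightarrow> 'd^3^3 \<Rightarrow> 'v" where
  "Fv v r s g = (let X = inverse (g$3$1) * g$3$2; Z = inverse (g$3$1) * g$3$3 in
     if invertible g \<and> g$3$1 \<noteq> 0 \<and> \<nu> X \<le> r \<and> \<nu> Z \<le> s then \<tau> (g ** GR_unip (- X) 0 (- Z) ** wmi) v else 0)"

lemma Fv_cell:
  assumes "p \<in> P21"
  shows "Fv v r s (p ** wm ** GR_unip X 0 Z) = (if \<nu> X \<le> r \<and> \<nu> Z \<le> s then \<tau> p v else 0)"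
  using open_cell_nth[OF assms refl, of X Z] unfolding Fv_def Let_def by simp

lemma \<tau>_one: "v \<in> S \<Longrightarrow> \<tau> (mat 1) v = v"
  using \<tau>_N[of v 0 0] by (simp add: GR_unip_0)

lemma \<phi>_Fv: "v \<in> S \<Longrightarrow> \<phi> (Fv v r s) X Z = (if \<nu> X \<le> r \<and> \<nu> Z \<le> s then v else 0)"
  using Fv_cell[OF P21_one, of v r s X Z] by (simp add: \<tau>_one)

text \<open>Moving \<open>k\<close> to the left past \<open>wm ** GR_unip X 0 Z\<close> scales its
  level by at most \<open>M * M\<close>, hence to \<open>e\<close>. The result has a third diagonal
  entry of norm 1, so it factors into some \<open>q\<close> in P close to 1, which fixes
  \<open>v\<close>, and a lower unipotent, which moves \<open>X\<close> and \<open>Z\<close> within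
  their balls.\<close>

lemma Fv_right_translate:
  assumes v: "v \<in> S" and e: "0 < e" "e < 1" "e \<le> r" "e \<le> s"
    and qfix: "\<And>q. q \<in> P21 \<Longrightarrow> q \<in> Kc e \<Longrightarrow> \<tau> q v = v"
    and M: "1 \<le> M" "r \<le> M" "s \<le> M" and k: "k \<in> Kc (e / (M * M))"
    and p: "p \<in> P21" and XZ: "\<nu> X \<le> r" "\<nu> Z \<le> s"
  shows "Fv v r s (p ** wm ** GR_unip X 0 Z ** k) = \<tau> p v"
proof -
  let ?a = "GR_unip X 0 Z"
  have le: "mat_le (GR_unip X' 0 Z') M" if "\<nu> X' \<le> r" "\<nu> Z' \<le> s" for X' Z'
    using that M by (auto simp: mat_le_def forall_3)
  have "?a ** k ** inv\<^bsub>GL\<^esub> ?a \<in> Kc (M * (e / (M * M)) * M)"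
    using le XZ k by (intro Kc_conj) (auto simp: GR_unip_inv)
  moreover have "M * (e / (M * M)) * M = e" using M by simp
  ultimately have k1: "?a ** k ** inv\<^bsub>GL\<^esub> ?a \<in> Kc e" (is "?k1 \<in> _") by simp
  have "mat_le wm 1" "mat_le wmi 1" by (auto simp: mat_le_def forall_3)
  hence k2: "wm ** ?k1 ** wmi \<in> Kc e" (is "?k2 \<in> _") using Kc_conj[of wm 1 1 ?k1 e] k1 by simp
  have b: "\<nu> ((?k2 - mat 1) $ i $ j) \<le> e" for i j using k2 unfolding Kc_def mat_le_def by blast
  have n33: "\<nu> (?k2$3$3) = 1"
  proof -
    have small: "\<nu> (?k2$3$3 - 1) < 1" using b[of 3 3] e(2) by (simp add: mat_nth)
    have "1 \<le> max (\<nu> (?k2$3$3)) (\<nu> (?k2$3$3 - 1))" using nu_diff_le[of "?k2$3$3" "?k2$3$3 - 1"] by simp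
    moreover have "\<nu> (?k2$3$3) \<le> max (\<nu> (?k2$3$3 - 1)) 1" using nu_ultra[of "?k2$3$3 - 1" 1] by simp
    ultimately show ?thesis using small by (auto simp: max_def split: if_splits)
  qed
  hence nz: "?k2$3$3 \<noteq> 0" by auto
  define X1 where "X1 = inverse (?k2$3$3) * ?k2$3$1"
  define Z1 where "Z1 = inverse (?k2$3$3) * ?k2$3$2"
  have XZ1: "\<nu> X1 \<le> e" "\<nu> Z1 \<le> e"
    using b[of 3 1] b[of 3 2] n33 by (simp_all add: X1_def Z1_def nu_mult nu_inverse mat_nth)
  define q where "q = ?k2 ** lowu (- X1) (- Z1)"
  have kinv: "invertible k" "invertible ?k2" using k k2 by (auto simp: Kc_def)
  have "lowu (- X1) (- Z1) \<in> Kc e" using XZ1 e by (auto simp: Kc_def mat_le_def forall_3 mat_nth invertible_lowu)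
  hence qK: "q \<in> Kc e" unfolding q_def by (rule Kc_mult[OF k2 _ e(2)])
  have qP: "q \<in> P21" unfolding q_def P21_iff
    using kinv nz by (simp add: invertible_matrix_mult invertible_lowu mult3_nth X1_def Z1_def mult.assoc[symmetric])
  have "lowu (- X1) (- Z1) ** lowu X1 Z1 = mat 1" by (simp add: eq3_iff mult3_nth mat_nth)
  hence k2q: "?k2 = q ** lowu X1 Z1" by (simp add: q_def matrix_mul_assoc[symmetric])
  have "wm ** ?a ** k = wm ** (?a ** k ** inv\<^bsub>GL\<^esub> ?a) ** ?a"
    by (simp add: matrix_mul_assoc[symmetric] GR_unip_inv GR_unip_mult GR_unip_0)
  also have "wm ** ?k1 = ?k2 ** wm"
    by (simp add: matrix_mul_assoc[symmetric])
  also have "?k2 ** wm ** ?a = q ** (lowu X1 Z1 ** wm) ** ?a" by (subst k2q) (simp only: matrix_mul_assoc)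
  also have "\<dots> = q ** wm ** (GR_unip X1 0 Z1 ** ?a)" by (simp only: wm_lowu[symmetric] matrix_mul_assoc)
  finally have "wm ** ?a ** k = q ** wm ** GR_unip (X1 + X) 0 (Z1 + Z)" by (simp add: GR_unip_mult)
  hence "p ** wm ** ?a ** k = (p ** q) ** wm ** GR_unip (X1 + X) 0 (Z1 + Z)"
    by (simp add: matrix_mul_assoc[symmetric])
  moreover have "\<nu> (X1 + X) \<le> r" "\<nu> (Z1 + Z) \<le> s"
    using nu_ultra[of X1 X] nu_ultra[of Z1 Z] XZ XZ1 e by auto
  ultimately show ?thesis
    using Fv_cell[OF P21_mult[OF p qP]] \<tau>_mult[OF p qP v] qfix[OF qP qK] by simp
qed

lemma Fv_V0: assumes v: "v \<in> S" and rs: "0 < r" "0 < s" shows "Fv v r s \<in> V0"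
proof -
  obtain r1 where r1: "r1 > 0" "r1 < 1" "\<And>q. q \<in> P21 \<Longrightarrow> q \<in> Kc r1 \<Longrightarrow> \<tau> q v = v" using \<tau>_smooth[OF v] by blast
  define e where "e = min r1 (min r s)"
  have e: "0 < e" "e < 1" "e \<le> r" "e \<le> s" "e \<le> r1" using r1 rs by (auto simp: e_def)
  have fix_e: "\<tau> q v = v" if "q \<in> P21" "q \<in> Kc e" for q using r1(3) that Kc_mono[OF e(5)] by blast
  define M where "M = max 1 (max r s)"
  have M: "1 \<le> M" "r \<le> M" "s \<le> M" by (auto simp: M_def)
  have MM: "1 \<le> M * M" using M(1) mult_mono[of 1 M 1 M] by simp
  define d where "d = e / (M * M)"
  have d: "0 < d" "d < 1" using e MM unfolding d_def by (auto simp: divide_less_eq intro: zero_less_divide_iff[THEN iffD2])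
  define supp where "supp g \<longleftrightarrow> (\<exists>p\<in>P21. \<exists>X Z. \<nu> X \<le> r \<and> \<nu> Z \<le> s \<and> g = p ** wm ** GR_unip X 0 Z)" for g
  have supp_K: "Fv v r s (g ** k) = Fv v r s g" if "supp g" "k \<in> Kc d" for g k
  proof -
    obtain p X Z where p: "p \<in> P21" "\<nu> X \<le> r" "\<nu> Z \<le> s" "g = p ** wm ** GR_unip X 0 Z"
      using \<open>supp g\<close> unfolding supp_def by blast
    show ?thesis
      using Fv_right_translate[OF v e(1-4) fix_e M that(2)[unfolded d_def] p(1-3)] Fv_cell[OF p(1)] p by simp
  qed
  have nsupp: "Fv v r s g = 0" if "\<not> supp g" for g
  proof (rule ccontr)
    assume nz: "Fv v r s g \<noteq> 0"
    hence g: "invertible g" "g$3$1 \<noteq> 0" by (auto simp: Fv_def Let_def split: if_splits)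
    then obtain p X Z where p: "p \<in> P21" "g = p ** wm ** GR_unip X 0 Z" using open_cell_decomp by blast
    hence "\<nu> X \<le> r \<and> \<nu> Z \<le> s" using nz Fv_cell[OF p(1)] by (auto split: if_splits)
    thus False using that p unfolding supp_def by blast
  qed
  have K: "Fv v r s (g ** k) = Fv v r s g" if g: "invertible g" and k: "k \<in> Kc d" for g k
  proof (cases "supp g")
    case False
    show ?thesis
    proof (cases "supp (g ** k)")
      \<comment> \<open>\<open>Kc d\<close> is a group, so the translate \<open>g ** k\<close> in
        the support is carried back to \<open>g\<close> by an element of \<open>Kc d\<close>, and
        the previous case applies.\<close>
      case True
      have kinv: "invertible k" using k by (simp add: Kc_def)
      have "Fv v r s (g ** k ** inv\<^bsub>GL\<^esub> k) = Fv v r s (g ** k)"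
        by (rule supp_K[OF True Kc_inv[OF k d(2)]])
      thus ?thesis using kinv by (simp add: matrix_mul_assoc[symmetric])
    qed (use False nsupp in simp)
  qed (use supp_K k in simp)
  have S: "Fv v r s g \<in> S" for g
  proof (cases "supp g")
    case True
    then obtain p X Z where p: "p \<in> P21" "g = p ** wm ** GR_unip X 0 Z" unfolding supp_def by blast
    thus ?thesis using Fv_cell[OF p(1)] \<tau>_S[OF p(1) v] S_0 by simp
  qed (use nsupp S_0 in simp)
  have left: "Fv v r s (q ** g) = \<tau> q (Fv v r s g)" if q: "q \<in> P21" and g: "invertible g" for q g
  proof (cases "g$3$1 = 0")
    case True
    hence "(q ** g)$3$1 = 0" using q by (simp add: mult3_nth P21_iff)
    thus ?thesis using True \<tau>_0[OF q] by (simp add: Fv_def)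
  next
    case False
    obtain p X Z where p: "p \<in> P21" "g = p ** wm ** GR_unip X 0 Z" using open_cell_decomp[OF g False] by blast
    have "q ** g = (q ** p) ** wm ** GR_unip X 0 Z" by (simp add: p(2) matrix_mul_assoc)
    thus ?thesis using Fv_cell[OF p(1)] Fv_cell[OF P21_mult[OF q p(1)]] \<tau>_mult[OF q p(1) v] \<tau>_0[OF q] p(2) by simp
  qed
  have "Fv v r s g = 0" if "\<not> invertible g" for g using that by (simp add: Fv_def)
  hence "Fv v r s \<in> V"
    unfolding V_iff using S left K d by blast
  thus ?thesis by (simp add: V0_def Fv_def)
qed

lemma Fv_add: assumes "v \<in> S" "w \<in> S" "0 < r" "0 < s" shows "Fv (v + w) r s = Fv v r s + Fv w r s"
  by (rule V0_eqI) (use assms in \<open>auto simp: Fv_V0 S_add V0_linear \<phi>_Fv\<close>)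

lemma Fv_scale: assumes "v \<in> S" "0 < r" "0 < s" shows "Fv (sc c v) r s = scf c (Fv v r s)"
proof (rule V0_eqI)
  show "\<phi> (Fv (sc c v) r s) X Z = \<phi> (scf c (Fv v r s)) X Z" for X Z
    using assms by (simp add: \<phi>_Fv S_scale scf_def)
qed (use assms in \<open>auto simp: Fv_V0 S_scale V0_linear\<close>)

lemma act_mat_Fv:
  assumes "v \<in> S" "0 < r" "0 < s" "h \<noteq> 0" shows "act (mat h) (Fv v r s) = Fv (\<tau> (mat h) v) r s"
proof (rule V0_eqI)
  have n: "\<nu> (inverse h * X * h) = \<nu> X" for X using assms(4) nu_conj[of "inverse h" X] by simp
  have "Fv v r s \<in> V" using Fv_V0 assms V0_V by blast
  thus "\<phi> (act (mat h) (Fv v r s)) X Z = \<phi> (Fv (\<tau> (mat h) v) r s) X Z" for X Z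
    using assms by (simp add: \<phi>_act_mat \<phi>_Fv \<tau>_S P21_mat n \<tau>_0)
qed (use assms in \<open>auto simp: Fv_V0 V0_act GR_group_mat \<tau>_S P21_mat\<close>)

text \<open>The action shears \<open>Z\<close> by \<open>X * Y\<close>. The condition relating the
  radii keeps this shear inside the ball for \<open>Z\<close>, so only the value \<open>v\<close>
  changes.\<close>

lemma act_Y_Fv:
  assumes "v \<in> S" "0 < r" "0 < s" "r * \<nu> Y \<le> s"
  shows "act (GR_unip 0 Y 0) (Fv v r s) = Fv (ract \<pi> (shalika_unip Y) v) r s"
proof (rule V0_eqI)
  have shift: "\<nu> (Z + X * Y) \<le> s \<longleftrightarrow> \<nu> Z \<le> s" if "\<nu> X \<le> r" for X Z
  proof -
    have "\<nu> (X * Y) \<le> s" using mult_right_mono[OF that nu_nonneg[of Y]] assms(4) by (simp add: nu_mult)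
    thus ?thesis using nu_ultra[of Z "X * Y"] nu_diff_le[of "Z + X * Y" "X * Y"] by auto
  qed
  have z: "ract \<pi> (shalika_unip Y) 0 = 0"
    using pi_scale[OF invertible_shalika_unip S_0, of Y 0] by simp
  have "Fv v r s \<in> V" using Fv_V0 assms V0_V by blast
  thus "\<phi> (act (GR_unip 0 Y 0) (Fv v r s)) X Z = \<phi> (Fv (ract \<pi> (shalika_unip Y) v) r s) X Z" for X Z
    using assms shift[of X Z] by (auto simp: \<phi>_act_Y \<phi>_Fv pi_S invertible_shalika_unip z)
qed (use assms in \<open>auto simp: Fv_V0 V0_act GR_group_GR_unip pi_S invertible_shalika_unip\<close>)

lemma zero_V0: "0 \<in> V0"
  using V0_linear(2)[OF Fv_V0[OF S_0, of 1 1] Fv_V0[OF S_0, of 1 1]] by simp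

lemma V0_sum: "finite I \<Longrightarrow> (\<And>i. i \<in> I \<Longrightarrow> f i \<in> V0) \<Longrightarrow> sum f I \<in> V0"
  by (induction I rule: finite_induct) (auto simp: zero_V0 V0_linear)

lemma equiv_form_sum:
  assumes L: "equiv_form X L" and X: "V0 \<subseteq> X"
  shows "finite I \<Longrightarrow> (\<And>i. i \<in> I \<Longrightarrow> f i \<in> V0) \<Longrightarrow> L (sum f I) = (\<Sum>i\<in>I. L (f i))"
proof (induction I rule: finite_induct)
  case empty
  have "L (0 + 0) = L 0 + L 0" using L X zero_V0 unfolding equiv_form_def by blast
  hence "L 0 = 0" by simp
  thus ?case by (simp only: sum.empty)
next
  case (insert i I)
  have "f i \<in> X" "sum f I \<in> X" using insert V0_sum[of I f] X by blast+
  hence "L (f i + sum f I) = L (f i) + L (sum f I)" using L unfolding equiv_form_def by blast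
  moreover have "L (sum f I) = (\<Sum>i\<in>I. L (f i))" using insert by blast
  ultimately show ?case by (simp only: sum.insert[OF insert.hyps(1,2)])
qed

lemma sum_fun_apply: "(sum f I) x = (\<Sum>i\<in>I. f i x)" for f :: "'i \<Rightarrow> 'd^3^3 \<Rightarrow> 'v"
  by (induction I rule: infinite_finite_induct) auto

text \<open>On each product of two balls the restriction is constant, so it is a sum of translated
  box functions. \<open>Q\<close> may be any finite family of such products that covers the support;
  products outside it contribute 0.\<close>

lemma V0_decomposition:
  assumes f: "f \<in> V0" and r: "0 < r" and s: "0 < s"
    and inv: "\<And>X Z a c. \<nu> a \<le> r \<Longrightarrow> \<nu> c \<le> s \<Longrightarrow> \<phi> f (X + a) (Z + c) = \<phi> f X Z"
    and Q: "finite Q" "Q \<subseteq> balls r \<times> balls s" "\<And>X Z. \<phi> f X Z \<noteq> 0 \<Longrightarrow> (cb r X, cb s Z) \<in> Q"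
  shows "f = (\<Sum>q\<in>Q. act (GR_unip (- pick (fst q)) 0 (- pick (snd q)))
                (Fv (\<phi> f (pick (fst q)) (pick (snd q))) r s))" (is "f = (\<Sum>q\<in>Q. ?t q)")
proof (rule V0_eqI[OF f])
  have fS: "\<phi> f X Z \<in> S" for X Z using \<phi>_S f V0_V by blast
  show "(\<Sum>q\<in>Q. ?t q) \<in> V0"
    using Q(1) by (intro V0_sum V0_act GR_group_GR_unip Fv_V0 fS r s)
  fix X Z
  have "\<phi> (?t q) X Z = (if q = (cb r X, cb s Z) then \<phi> f X Z else 0)" if q: "q \<in> Q" for q
  proof -
    obtain C E where CE: "q = (C, E)" "C \<in> balls r" "E \<in> balls s" using q Q(2) by auto
    have C: "\<nu> (X - pick C) \<le> r \<longleftrightarrow> C = cb r X"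
      using cb_eq_iff[of r X "pick C"] pick_balls[of r C] CE r by auto
    have E: "\<nu> (Z - pick E) \<le> s \<longleftrightarrow> E = cb s Z"
      using cb_eq_iff[of s Z "pick E"] pick_balls[of s E] CE s by auto
    have "\<phi> (?t q) X Z = (if C = cb r X \<and> E = cb s Z then \<phi> f (pick C) (pick E) else 0)"
      by (simp add: CE \<phi>_act_A \<phi>_Fv fS C[symmetric] E[symmetric])
    moreover have "\<phi> f (pick C) (pick E) = \<phi> f X Z" if "C = cb r X" "E = cb s Z"
      using inv[of "pick C - X" "pick E - Z" X Z] pick_cb[of r X] pick_cb[of s Z] r s that by simp
    ultimately show ?thesis using CE by auto
  qed
  hence "\<phi> (\<Sum>q\<in>Q. ?t q) X Z = (\<Sum>q\<in>Q. if q = (cb r X, cb s Z) then \<phi> f X Z else 0)"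
    unfolding sum_fun_apply by (intro sum.cong) auto
  also have "\<dots> = \<phi> f X Z" using Q(1,3) by (auto simp: sum.delta)
  finally show "\<phi> f X Z = \<phi> (\<Sum>q\<in>Q. ?t q) X Z" by simp
qed

lemma equiv_form_act_A:
  assumes "equiv_form X L" "f \<in> X" shows "L (act (GR_unip a 0 c) f) = \<Psi> a * L f"
  using assms GR_group_GR_unip[of a 0 c] unfolding equiv_form_def by (simp add: \<xi>_GR_unip)

text \<open>A box is a disjoint union of translates of smaller ones. Translations in
  \<open>X\<close> by at most \<open>r0\<close> do not change the value of \<open>L\<close>, and
  those in \<open>Z\<close> never do, so the value is proportional to the volume.\<close>

lemma Fv_rescale:
  assumes L: "equiv_form V L" and v: "v \<in> S" and r: "0 < r'" "r' \<le> r" "r \<le> r0" and s: "0 < s'" "s' \<le> s"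
  shows "L (Fv v r s) = of_nat (ball_idx r r' * ball_idx s s') * L (Fv v r' s')"
proof -
  let ?Q = "{C\<in>balls r'. C \<subseteq> cb r 0} \<times> {E\<in>balls s'. E \<subseteq> cb s 0}"
  have rs: "0 < r" "0 < s" using r s by auto
  have Q: "?Q = {C\<in>balls r'. \<nu> (pick C) \<le> r} \<times> {E\<in>balls s'. \<nu> (pick E) \<le> s}"
    using subballs_eq[OF r(1,2), of 0] subballs_eq[OF s, of 0] by simp
  have fin: "finite ?Q" using finite_subballs[OF r(1,2)] finite_subballs[OF s] by simp
  have shift: "\<nu> (X + a) \<le> t \<longleftrightarrow> \<nu> X \<le> t" if "\<nu> a \<le> t" for X a t
    using nu_ultra[of X a] nu_diff_le[of "X + a" a] that by auto
  have inv: "\<phi> (Fv v r s) (X + a) (Z + c) = \<phi> (Fv v r s) X Z" if "\<nu> a \<le> r'" "\<nu> c \<le> s'" for X Z a c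
    using shift[of a r X] shift[of c s Z] that r s by (simp add: \<phi>_Fv v)
  have cover: "(cb r' X, cb s' Z) \<in> ?Q" if "\<phi> (Fv v r s) X Z \<noteq> 0" for X Z
  proof -
    have "\<nu> X \<le> r" "\<nu> Z \<le> s" using that by (auto simp: \<phi>_Fv v split: if_splits)
    moreover have "cb t' x \<subseteq> cb t 0" if "\<nu> x \<le> t" "t' \<le> t" for x t t'
    proof
      fix y assume "y \<in> cb t' x"
      thus "y \<in> cb t 0" using nu_diff_trans[of y 0 x] that by (auto simp: cb_def)
    qed
    ultimately have "cb r' X \<subseteq> cb r 0" "cb s' Z \<subseteq> cb s 0" using r s by blast+
    thus ?thesis by (simp add: balls_def)
  qed
  have "Fv v r s = (\<Sum>q\<in>?Q. act (GR_unip (- pick (fst q)) 0 (- pick (snd q)))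
      (Fv (\<phi> (Fv v r s) (pick (fst q)) (pick (snd q))) r' s'))"
    by (rule V0_decomposition[OF Fv_V0[OF v rs] r(1) s(1) inv fin _ cover]) auto
  also have "\<dots> = (\<Sum>q\<in>?Q. act (GR_unip (- pick (fst q)) 0 (- pick (snd q))) (Fv v r' s'))"
    by (rule sum.cong[OF refl]) (auto simp: Q \<phi>_Fv v)
  finally have "L (Fv v r s) = L (\<Sum>q\<in>?Q. act (GR_unip (- pick (fst q)) 0 (- pick (snd q))) (Fv v r' s'))"
    by simp
  also have "\<dots> = (\<Sum>q\<in>?Q. L (act (GR_unip (- pick (fst q)) 0 (- pick (snd q))) (Fv v r' s')))"
    using fin by (intro equiv_form_sum[OF L V0_V] V0_act GR_group_GR_unip Fv_V0 v r s)
  also have "\<dots> = (\<Sum>q\<in>?Q. L (Fv v r' s'))"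
  proof (rule sum.cong[OF refl])
    fix q assume "q \<in> ?Q"
    hence "\<nu> (- pick (fst q)) \<le> r0" using Q r by auto
    moreover have "Fv v r' s' \<in> V" using Fv_V0 v r s V0_V by blast
    ultimately show "L (act (GR_unip (- pick (fst q)) 0 (- pick (snd q))) (Fv v r' s')) = L (Fv v r' s')"
      using r0(2) by (simp add: equiv_form_act_A[OF L])
  qed
  finally show ?thesis by (simp add: card_cartesian_product ball_idx_def)
qed

section \<open>The map from forms on the induced representation to Shalika forms\<close>

definition transfer :: "(('d^3^3 \<Rightarrow> 'v) \<Rightarrow> complex) \<Rightarrow> 'v \<Rightarrow> complex" where
  "transfer L v = (if v \<in> S then L (Fv v r0 r0) else 0)"

abbreviation "HH \<equiv> hom_space shalika_group (shalika_char D \<omega> \<psi>) \<pi>"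
abbreviation "HR \<equiv> hom_space GR_group (GR_char D \<psi>) (induced_GL3 absF D \<pi> \<theta>)"

lemma HR_iff: "L \<in> HR \<longleftrightarrow> equiv_form V L \<and> (\<forall>f. f \<notin> V \<longrightarrow> L f = 0)"
  unfolding hom_space_def linear_forms_def equiv_form_def ract_induced rscale_induced V_def[symmetric] \<xi>_def[symmetric]
  by auto

lemma shalika_char_eq: "d \<noteq> 0 \<Longrightarrow> shalika_char D \<omega> \<psi> (mat d ** shalika_unip X) = \<omega> (rnorm D d) * \<Psi> X"
  by (simp add: shalika_char_def mult2_nth mat_nth mult.assoc[symmetric] \<Psi>_def)

lemma HH_D:
  assumes "l \<in> HH"
  shows "v \<in> S \<Longrightarrow> w \<in> S \<Longrightarrow> l (v + w) = l v + l w" "v \<in> S \<Longrightarrow> l (sc c v) = c * l v" "v \<notin> S \<Longrightarrow> l v = 0"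
    "v \<in> S \<Longrightarrow> d \<noteq> 0 \<Longrightarrow> l (ract \<pi> (mat d) v) = \<omega> (rnorm D d) * l v"
    "v \<in> S \<Longrightarrow> l (ract \<pi> (shalika_unip X) v) = \<Psi> X * l v"
proof -
  show "v \<in> S \<Longrightarrow> w \<in> S \<Longrightarrow> l (v + w) = l v + l w" "v \<in> S \<Longrightarrow> l (sc c v) = c * l v" "v \<notin> S \<Longrightarrow> l v = 0"
    using assms unfolding hom_space_def linear_forms_def by auto
  have eq: "l (ract \<pi> (mat d ** shalika_unip X) v) = \<omega> (rnorm D d) * \<Psi> X * l v" if "v \<in> S" "d \<noteq> 0" for v d X
  proof -
    have "mat d ** shalika_unip X \<in> shalika_group" using that(2) unfolding shalika_group_def by blast
    thus ?thesis using assms that shalika_char_eq unfolding hom_space_def by simp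
  qed
  show "v \<in> S \<Longrightarrow> d \<noteq> 0 \<Longrightarrow> l (ract \<pi> (mat d) v) = \<omega> (rnorm D d) * l v"
    using eq[of v d 0] by (simp add: shalika_unip_0)
  have "\<omega> 1 = 1" using \<theta>_1 by (simp add: \<theta>_def)
  thus "v \<in> S \<Longrightarrow> l (ract \<pi> (shalika_unip X) v) = \<Psi> X * l v" using eq[of v 1 X] by simp
qed

text \<open>For the diagonal, the box function is mapped to another one with value
  \<open>\<tau> (mat d) v\<close>, and the character in \<open>\<tau>\<close> moves to the other
  side as \<omega>. For the unipotent part the box must first be made stable under the
  shear.\<close>

lemma transfer_HH: assumes "L \<in> HR" shows "transfer L \<in> HH"
proof -
  have L: "equiv_form V L" using assms HR_iff by blast
  have FV: "Fv v r s \<in> V" if "v \<in> S" "0 < r" "0 < s" for v r s using Fv_V0 that V0_V by blast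
  have add: "transfer L (v + w) = transfer L v + transfer L w" if "v \<in> S" "w \<in> S" for v w
    using L FV that r0(1) unfolding equiv_form_def by (simp add: transfer_def S_add Fv_add)
  have scale: "transfer L (sc c v) = c * transfer L v" if "v \<in> S" for v c
    using L FV that r0(1) unfolding equiv_form_def by (simp add: transfer_def S_scale Fv_scale)
  have mat: "transfer L (ract \<pi> (mat d) v) = \<omega> (rnorm D d) * transfer L v" if v: "v \<in> S" and d: "d \<noteq> 0" for v d
  proof -
    have pS: "ract \<pi> (mat d) v \<in> S" using v d by (simp add: pi_S mat_inv)
    have "L (Fv v r0 r0) = L (act (mat d) (Fv v r0 r0))"
      using L FV[OF v r0(1) r0(1)] GR_group_mat[OF d] \<xi>_mat[OF d] unfolding equiv_form_def by simp
    also have "\<dots> = transfer L (sc (\<theta> d) (ract \<pi> (mat d) v))"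
      using v d r0(1) pS by (simp add: act_mat_Fv transfer_def \<tau>_mat S_scale)
    also have "\<dots> = \<theta> d * transfer L (ract \<pi> (mat d) v)" by (rule scale[OF pS])
    finally have "\<omega> (rnorm D d) * transfer L v = (\<omega> (rnorm D d) * \<theta> d) * transfer L (ract \<pi> (mat d) v)"
      using v by (simp add: transfer_def)
    thus ?thesis using \<theta>_omega[OF d] by simp
  qed
  have unip: "transfer L (ract \<pi> (shalika_unip Y) v) = \<Psi> Y * transfer L v" if v: "v \<in> S" for v Y
  proof -
    \<comment> \<open>The smaller radius in \<open>X\<close> makes the box stable under the shear by
      \<open>Y\<close>. \<open>Fv_rescale\<close> returns to \<open>r0\<close> with the same factor
      for \<open>v\<close> and for its image.\<close>
    define r where "r = r0 / (1 + \<nu> Y)"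
    have Y: "1 + \<nu> Y > 0" by (simp add: add_pos_nonneg)
    have r: "0 < r" "r \<le> r0" "r * \<nu> Y \<le> r0"
      using r0(1) Y by (auto simp: r_def field_simps)
    have pS: "ract \<pi> (shalika_unip Y) v \<in> S" using v by (simp add: pi_S invertible_shalika_unip)
    have "L (Fv (ract \<pi> (shalika_unip Y) v) r r0) = L (act (GR_unip 0 Y 0) (Fv v r r0))"
      using act_Y_Fv[OF v r(1) r0(1) r(3)] by simp
    also have "\<dots> = \<Psi> Y * L (Fv v r r0)"
      using L FV[OF v r(1) r0(1)] GR_group_GR_unip[of 0 Y 0] \<xi>_GR_unip[of 0 Y 0] unfolding equiv_form_def by simp
    finally show ?thesis
      using Fv_rescale[OF L pS r(1,2) order_refl r0(1) order_refl] Fv_rescale[OF L v r(1,2) order_refl r0(1) order_refl] v pS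
      by (simp add: transfer_def)
  qed
  have "transfer L (ract \<pi> h v) = shalika_char D \<omega> \<psi> h * transfer L v" if h: "h \<in> shalika_group" and v: "v \<in> S" for h v
  proof -
    obtain d X where dX: "d \<noteq> 0" "h = mat d ** shalika_unip X" using h unfolding shalika_group_def by blast
    have "ract \<pi> h v = ract \<pi> (mat d) (ract \<pi> (shalika_unip X) v)"
      using dX v by (simp add: pi_mult mat_inv invertible_shalika_unip)
    thus ?thesis using mat[OF _ dX(1)] unip[OF v] pi_S[OF invertible_shalika_unip v] dX by (simp add: shalika_char_eq)
  qed
  thus ?thesis unfolding hom_space_def linear_forms_def using add scale by (auto simp: transfer_def)
qed

text \<open>The bound by \<open>r0\<close> makes the character factor of the integrand locally
  constant at the same radius as the restriction of \<open>f\<close>.\<close>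

definition adm :: "real \<Rightarrow> ('d^3^3 \<Rightarrow> 'v) \<Rightarrow> bool" where
  "adm r f \<longleftrightarrow> 0 < r \<and> r \<le> r0 \<and> (\<forall>X Z a c. \<nu> a \<le> r \<longrightarrow> \<nu> c \<le> r \<longrightarrow> \<phi> f (X + a) (Z + c) = \<phi> f X Z)"

lemma adm_exists: assumes "f \<in> V" shows "\<exists>r. adm r f"
proof -
  obtain r where r: "r > 0" "r < 1" "\<And>g k. invertible g \<Longrightarrow> k \<in> Kc r \<Longrightarrow> f (g ** k) = f g" using V_right[OF assms] by blast
  have "\<phi> f (X + a) (Z + c) = \<phi> f X Z" if "\<nu> a \<le> min r r0" "\<nu> c \<le> min r r0" for X Z a c
  proof -
    have "GR_unip a 0 c \<in> Kc r" using that r by (auto simp: Kc_def mat_le_def forall_3 mat_nth GR_unip_inv)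
    hence "f (wm ** GR_unip X 0 Z ** GR_unip a 0 c) = \<phi> f X Z" using r(3) wu_invertible by blast
    thus ?thesis by (simp add: matrix_mul_assoc[symmetric] GR_unip_mult)
  qed
  thus ?thesis using r r0(1) unfolding adm_def by (intro exI[of _ "min r r0"]) auto
qed

lemma adm_mono: "adm r f \<Longrightarrow> 0 < s \<Longrightarrow> s \<le> r \<Longrightarrow> adm s f"
  unfolding adm_def by (meson order_trans)

text \<open>If \<open>X\<close> or \<open>Z\<close> is large, right translation by a small lower
  unipotent turns the third row (1,X,Z) into one with first entry 0, where functions in
  \<open>V0\<close> vanish. The function itself is fixed by this translation.\<close>

lemma \<phi>_bounded: assumes f: "f \<in> V0" shows "\<exists>R. \<forall>X Z. \<phi> f X Z \<noteq> 0 \<longrightarrow> \<nu> X \<le> R \<and> \<nu> Z \<le> R"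
proof -
  obtain r where r: "r > 0" "r < 1" "\<And>g k. invertible g \<Longrightarrow> k \<in> Kc r \<Longrightarrow> f (g ** k) = f g"
    using V_right f V0_V by blast
  have zero: "f (g ** k) = 0" if "invertible g" "invertible k" "(g ** k)$3$1 = 0" for g k :: "'d^3^3"
    using f that by (simp add: V0_def invertible_matrix_mult)
  have "\<phi> f X Z = 0" if "\<not> \<nu> X \<le> 1 / r" for X Z
  proof -
    have X: "X \<noteq> 0" "\<nu> (inverse X) \<le> r" using that nu_inverse_le r(1) by blast+
    have "lowu21 (- inverse X) \<in> Kc r" using X r by (auto simp: Kc_def mat_le_def forall_3 mat_nth invertible_lowu21)
    hence "\<phi> f X Z = f (wm ** GR_unip X 0 Z ** lowu21 (- inverse X))" using r(3) wu_invertible by simp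
    also have "\<dots> = 0" by (rule zero) (use X in \<open>simp_all add: wu_invertible invertible_lowu21 mult3_nth\<close>)
    finally show ?thesis .
  qed
  moreover have "\<phi> f X Z = 0" if "\<not> \<nu> Z \<le> 1 / r" for X Z
  proof -
    have Z: "Z \<noteq> 0" "\<nu> (inverse Z) \<le> r" using that nu_inverse_le r(1) by blast+
    have "lowu (- inverse Z) 0 \<in> Kc r" using Z r by (auto simp: Kc_def mat_le_def forall_3 mat_nth invertible_lowu)
    hence "\<phi> f X Z = f (wm ** GR_unip X 0 Z ** lowu (- inverse Z) 0)" using r(3) wu_invertible by simp
    also have "\<dots> = 0" by (rule zero) (use Z in \<open>simp_all add: wu_invertible invertible_lowu mult3_nth\<close>)
    finally show ?thesis .
  qed
  ultimately show ?thesis by blast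
qed

text \<open>By \<open>Fv_rescale\<close> and nonzero volume factors, \<open>L\<close> vanishes on
  all small box functions, hence on their translates and on \<open>V0\<close>. Uniqueness of
  extension across the smaller orbits finishes the argument.\<close>

lemma transfer_inj:
  assumes L: "L \<in> HR" and zero: "\<And>v. v \<in> S \<Longrightarrow> transfer L v = 0"
  shows "L f = 0"
proof (cases "f \<in> V")
  case True
  have L': "equiv_form V L" using L HR_iff by blast
  have "L f = 0" if f: "f \<in> V0" for f
  proof -
    obtain r where r: "adm r f" using adm_exists f V0_V by blast
    hence r': "0 < r" "r \<le> r0" by (auto simp: adm_def)
    obtain R where R: "\<And>X Z. \<phi> f X Z \<noteq> 0 \<Longrightarrow> \<nu> X \<le> R \<and> \<nu> Z \<le> R" using \<phi>_bounded[OF f] by blast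
    \<comment> \<open>The chosen point of a ball that meets the support may lie outside the ball of
      radius \<open>R\<close>, but its norm is at most the larger of \<open>R\<close> and
      \<open>r\<close>.\<close>
    define R' where "R' = max R r"
    let ?B = "{C\<in>balls r. \<nu> (pick C) \<le> R'}"
    have fin: "finite (?B \<times> ?B)" using finite_balls_bounded[OF r'(1)] by simp
    have near: "cb r X \<in> ?B" if "\<nu> X \<le> R" for X
      using nu_ultra[of "pick (cb r X) - X" X] pick_cb[of r X] r' that by (auto simp: balls_def R'_def)
    have Lz: "L (Fv v r r) = 0" if v: "v \<in> S" for v
    proof -
      have "of_nat (ball_idx r0 r * ball_idx r0 r) * L (Fv v r r) = 0"
        using Fv_rescale[OF L' v r' order_refl r'] zero[OF v] v by (simp add: transfer_def)
      thus ?thesis using ball_idx_pos[OF r'] by simp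
    qed
    have dec: "f = (\<Sum>q\<in>?B \<times> ?B. act (GR_unip (- pick (fst q)) 0 (- pick (snd q)))
        (Fv (\<phi> f (pick (fst q)) (pick (snd q))) r r))" (is "f = ?sum")
    proof (rule V0_decomposition[OF f r'(1) r'(1) _ fin])
      show "\<phi> f (X + a) (Z + c) = \<phi> f X Z" if "\<nu> a \<le> r" "\<nu> c \<le> r" for X Z a c
        using r that unfolding adm_def by blast
      show "(cb r X, cb r Z) \<in> ?B \<times> ?B" if "\<phi> f X Z \<noteq> 0" for X Z using R[OF that] near by blast
    qed auto
    have "L f = L ?sum" using arg_cong[OF dec, of L] .
    also have "\<dots> = (\<Sum>q\<in>?B \<times> ?B. L (act (GR_unip (- pick (fst q)) 0 (- pick (snd q)))
        (Fv (\<phi> f (pick (fst q)) (pick (snd q))) r r)))"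
      using fin f V0_V by (intro equiv_form_sum[OF L' V0_V] V0_act GR_group_GR_unip Fv_V0 \<phi>_S r'(1)) auto
    also have "\<dots> = 0"
    proof (rule sum.neutral, rule ballI)
      fix q
      have S: "\<phi> f (pick (fst q)) (pick (snd q)) \<in> S" using \<phi>_S f V0_V by blast
      hence "Fv (\<phi> f (pick (fst q)) (pick (snd q))) r r \<in> V" using Fv_V0 r'(1) V0_V by blast
      thus "L (act (GR_unip (- pick (fst q)) 0 (- pick (snd q))) (Fv (\<phi> f (pick (fst q)) (pick (snd q))) r r)) = 0"
        using Lz[OF S] by (simp add: equiv_form_act_A[OF L'])
    qed
    finally show ?thesis .
  qed
  thus ?thesis using equiv_form_unique[OF L' _ True] by blast
next
  case False thus ?thesis using L HR_iff by blast
qed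

section \<open>The form on the induced representation attached to a Shalika form\<close>

context
  fixes l assumes l: "l \<in> HH"
begin

definition integrand :: "('d^3^3 \<Rightarrow> 'v) \<Rightarrow> 'd \<Rightarrow> 'd \<Rightarrow> complex" where
  "integrand f X Z = l (\<phi> f X Z) * \<Psi> (- X)"

lemma l_0: "l 0 = 0"
  using HH_D(2)[OF l S_0, of 0] by simp

lemma schwartz2_integrand:
  assumes f: "f \<in> V0" and r: "adm r f" shows "schwartz2 r (integrand f)"
  unfolding schwartz2_def
proof (intro conjI allI impI)
  show "0 < r" using r by (simp add: adm_def)
  fix X X' Z Z' assume XZ: "\<nu> (X - X') \<le> r" "\<nu> (Z - Z') \<le> r"
  have "\<phi> f (X' + (X - X')) (Z' + (Z - Z')) = \<phi> f X' Z'" using r XZ unfolding adm_def by blast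
  hence "\<phi> f X Z = \<phi> f X' Z'" by simp
  moreover have "\<Psi> (X' - X) = 1" using r0(2) XZ r nu_minus_commute[of X X'] by (auto simp: adm_def)
  hence "\<Psi> (- X) = \<Psi> (- X')" using \<Psi>_add[of "- X'" "X' - X"] by simp
  ultimately show "integrand f X Z = integrand f X' Z'" by (simp add: integrand_def)
next
  obtain R where "\<And>X Z. \<phi> f X Z \<noteq> 0 \<Longrightarrow> \<nu> X \<le> R \<and> \<nu> Z \<le> R" using \<phi>_bounded[OF f] by blast
  moreover have "integrand f X Z = 0" if "\<phi> f X Z = 0" for X Z using that l_0 by (simp add: integrand_def)
  ultimately show "\<exists>R. \<forall>X Z. integrand f X Z \<noteq> 0 \<longrightarrow> \<nu> X \<le> R \<and> \<nu> Z \<le> R"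
    by (intro exI[of _ R]) blast
qed

text \<open>The integral of \<open>integrand f\<close> for the Haar measure on \<open>D\<^sup>2\<close> that gives the ball of radius \<open>r0\<close> in
  each factor volume \<open>1\<close>.\<close>

definition L0 :: "('d^3^3 \<Rightarrow> 'v) \<Rightarrow> complex" where
  "L0 f = (let r = SOME r. adm r f in csum2 r (integrand f) / (of_nat (ball_idx r0 r))\<^sup>2)"

text \<open>Refining the radius multiplies the sum and the squared index by the same nonzero factor.
  Two admissible radii are compared through their minimum.\<close>

lemma L0_eq: assumes f: "f \<in> V0" and r: "adm r f" shows "L0 f = csum2 r (integrand f) / (of_nat (ball_idx r0 r))\<^sup>2"
proof -
  have *: "csum2 s (integrand f) / (of_nat (ball_idx r0 s))\<^sup>2 = csum2 t (integrand f) / (of_nat (ball_idx r0 t))\<^sup>2"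
    if s: "adm s f" and t: "0 < t" "t \<le> s" for s t
  proof -
    have s': "0 < s" "s \<le> r0" using s by (auto simp: adm_def)
    have "(of_nat (ball_idx s t) :: complex) \<noteq> 0" using ball_idx_pos[OF t] by simp
    thus ?thesis
      using csum2_refine[OF schwartz2_integrand[OF f s] t] ball_idx_mult[OF t s'(2)]
      by (simp add: power_mult_distrib)
  qed
  define s where "s = (SOME r. adm r f)"
  have s: "adm s f" unfolding s_def using r by (rule someI)
  have m: "0 < min r s" using r s by (simp add: adm_def)
  have "L0 f = csum2 s (integrand f) / (of_nat (ball_idx r0 s))\<^sup>2" by (simp add: L0_def Let_def s_def)
  thus ?thesis using *[OF s m] *[OF r m] by simp
qed

lemma common_adm:
  assumes "f \<in> V0" "f' \<in> V0" shows "\<exists>r. adm r f \<and> adm r f'"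
proof -
  obtain r s where rs: "adm r f" "adm s f'" using adm_exists assms V0_V by blast
  have "0 < min r s" using rs by (simp add: adm_def)
  thus ?thesis using adm_mono[OF rs(1), of "min r s"] adm_mono[OF rs(2), of "min r s"] by auto
qed

lemma L0_eqI:
  assumes "f \<in> V0" "f' \<in> V0"
    and "\<And>r. schwartz2 r (integrand f) \<Longrightarrow> csum2 r (integrand f') = c * csum2 r (integrand f)"
  shows "L0 f' = c * L0 f"
proof -
  obtain r where r: "adm r f" "adm r f'" using common_adm assms by blast
  thus ?thesis using L0_eq[OF assms(1) r(1)] L0_eq[OF assms(2) r(2)] assms(3)[OF schwartz2_integrand[OF assms(1) r(1)]] by simp
qed

lemma equiv_form_L0: "equiv_form V0 L0"
  unfolding equiv_form_def
proof (intro conjI ballI allI)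
  fix f f' assume f: "f \<in> V0" "f' \<in> V0"
  obtain r where r: "adm r f" "adm r f'" using common_adm f by blast
  hence rs: "adm r (f + f')" by (simp add: adm_def)
  have "integrand (f + f') = (\<lambda>X Z. integrand f X Z + integrand f' X Z)"
    using f V0_V by (intro ext) (auto simp: integrand_def HH_D(1)[OF l] \<phi>_S subset_iff distrib_right)
  hence "csum2 r (integrand (f + f')) = csum2 r (integrand f) + csum2 r (integrand f')"
    using csum2_add[OF schwartz2_integrand[OF f(1) r(1)] schwartz2_integrand[OF f(2) r(2)]] by simp
  thus "L0 (f + f') = L0 f + L0 f'"
    using L0_eq[OF f(1) r(1)] L0_eq[OF f(2) r(2)] L0_eq[OF V0_linear(1)[OF f] rs] by (simp add: add_divide_distrib)
next
  fix c f assume f: "f \<in> V0"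
  have "integrand (scf c f) = (\<lambda>X Z. c * integrand f X Z)"
    using f V0_V by (intro ext) (auto simp: integrand_def scf_def HH_D(2)[OF l] \<phi>_S subset_iff)
  thus "L0 (scf c f) = c * L0 f" using f by (intro L0_eqI V0_linear) (simp_all add: csum2_cmult)
next
  fix g :: "'d^3^3" and f assume g: "g \<in> GR_group" and f: "f \<in> V0"
  obtain h X Y Z where h: "h \<noteq> 0" "g = mat h ** GR_unip X Y Z" using g by (rule GR_groupE)
  have A: "L0 (act (GR_unip a 0 c) f) = \<Psi> a * L0 f" if f: "f \<in> V0" for a c f
  proof (rule L0_eqI[OF f V0_act[OF GR_group_GR_unip f]])
    fix r assume r: "schwartz2 r (integrand f)"
    have "integrand (act (GR_unip a 0 c) f) = (\<lambda>X Z. \<Psi> a * integrand f (X + a) (Z + c))"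
    proof (intro ext)
      fix X Z
      have "\<Psi> (- X) = \<Psi> a * \<Psi> (- (X + a))" using \<Psi>_add[of a "- (X + a)"] by simp
      thus "integrand (act (GR_unip a 0 c) f) X Z = \<Psi> a * integrand f (X + a) (Z + c)"
        by (simp add: integrand_def \<phi>_act_A)
    qed
    thus "csum2 r (integrand (act (GR_unip a 0 c) f)) = \<Psi> a * csum2 r (integrand f)"
      using csum2_translate[OF r] by (simp add: csum2_cmult)
  qed
  have B: "L0 (act (GR_unip 0 Y 0) f) = \<Psi> Y * L0 f" if f: "f \<in> V0" for f
  proof (rule L0_eqI[OF f V0_act[OF GR_group_GR_unip f]])
    fix r assume r: "schwartz2 r (integrand f)"
    have "integrand (act (GR_unip 0 Y 0) f) = (\<lambda>X Z. \<Psi> Y * integrand f X (Z + X * Y))"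
      using f V0_V by (intro ext) (auto simp: integrand_def \<phi>_act_Y \<phi>_S HH_D(5)[OF l] subset_iff)
    thus "csum2 r (integrand (act (GR_unip 0 Y 0) f)) = \<Psi> Y * csum2 r (integrand f)"
      using csum2_shear[OF r] by (simp add: csum2_cmult)
  qed
  \<comment> \<open>The factor \<omega> from the equivariance of \<open>l\<close> cancels the
    inverse character in \<open>\<tau>\<close>. What remains is conjugation by \<open>h\<close> in
    both variables, which preserves the integral.\<close>
  have C: "L0 (act (mat h) f) = 1 * L0 f" if f: "f \<in> V0" for f
  proof (rule L0_eqI[OF f V0_act[OF GR_group_mat[OF h(1)] f]])
    fix r assume r: "schwartz2 r (integrand f)"
    have "integrand (act (mat h) f) =
        (\<lambda>X Z. integrand f (inverse h * X * inverse (inverse h)) (inverse h * Z * inverse (inverse h)))"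
    proof (intro ext)
      fix X Z
      let ?v = "\<phi> f (inverse h * X * h) (inverse h * Z * h)"
      have v: "?v \<in> S" using \<phi>_S f V0_V by blast
      have "l (\<tau> (mat h) ?v) = \<theta> h * l (ract \<pi> (mat h) ?v)"
        using v h(1) HH_D(2)[OF l pi_S[OF mat_inv(1)[OF h(1)] v]] by (simp add: \<tau>_mat)
      also have "\<dots> = (\<omega> (rnorm D h) * \<theta> h) * l ?v" using HH_D(4)[OF l v h(1)] by simp
      finally have "l (\<tau> (mat h) ?v) = l ?v" using \<theta>_omega[OF h(1)] by simp
      moreover have "\<Psi> (- X) = \<Psi> (- (inverse h * X * h))"
        using \<Psi>_conj[of "inverse h" "- X"] h(1) by simp
      ultimately show "integrand (act (mat h) f) X Z =
          integrand f (inverse h * X * inverse (inverse h)) (inverse h * Z * inverse (inverse h))"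
        using f V0_V h(1) by (auto simp: integrand_def \<phi>_act_mat)
    qed
    thus "csum2 r (integrand (act (mat h) f)) = 1 * csum2 r (integrand f)"
      using csum2_conj[OF r, of "inverse h"] h(1) by simp
  qed
  \<comment> \<open>In this order the two unipotent factors multiply without a correction to
    \<open>Z\<close>.\<close>
  have "g = mat h ** (GR_unip 0 Y 0 ** GR_unip X 0 Z)" using h(2) by (simp add: GR_unip_mult)
  hence "act g f = act (mat h) (act (GR_unip 0 Y 0) (act (GR_unip X 0 Z) f))"
    using h(1) by (simp add: act_mult mat_inv GR_unip_inv)
  hence "L0 (act g f) = \<Psi> Y * (\<Psi> X * L0 f)"
    using A B C f by (simp add: V0_act GR_group_GR_unip)
  thus "L0 (act g f) = \<xi> g * L0 f" using h by (simp add: \<xi>_eq)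
qed

text \<open>The character is 1 on the ball of radius \<open>r0\<close>, and the volume of the box
  cancels the normalization in \<open>L0\<close>. So \<open>L0\<close> is a preimage of
  \<open>l\<close> without any constant.\<close>

lemma L0_Fv: assumes v: "v \<in> S" shows "L0 (Fv v r0 r0) = l v"
proof -
  have shift: "\<nu> (X + a) \<le> t \<longleftrightarrow> \<nu> X \<le> t" if "\<nu> a \<le> t" for X a t
    using nu_ultra[of X a] nu_diff_le[of "X + a" a] that by auto
  have adm: "adm r0 (Fv v r0 r0)" using r0(1) shift by (simp add: adm_def \<phi>_Fv v)
  have "csum r0 (integrand (Fv v r0 r0) X) = (if \<nu> X \<le> r0 then of_nat (ball_idx r0 r0) * l v else 0)" for X
  proof (cases "\<nu> X \<le> r0")
    case True
    hence "integrand (Fv v r0 r0) X = (\<lambda>Z. if \<nu> Z \<le> r0 then l v else 0)"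
      using r0(2)[of "- X"] by (intro ext) (simp add: integrand_def \<phi>_Fv v l_0)
    thus ?thesis using csum_indicator[OF r0(1) order_refl] True by simp
  next
    case False
    hence "integrand (Fv v r0 r0) X = (\<lambda>Z. 0)" by (intro ext) (simp add: integrand_def \<phi>_Fv v l_0)
    thus ?thesis using False by (simp add: csum_zero)
  qed
  hence "csum2 r0 (integrand (Fv v r0 r0)) = of_nat (ball_idx r0 r0) * (of_nat (ball_idx r0 r0) * l v)"
    using csum_indicator[OF r0(1) order_refl] by (simp add: csum2_def)
  moreover have "(of_nat (ball_idx r0 r0) :: complex) \<noteq> 0" using ball_idx_pos[OF r0(1) order_refl] by simp
  ultimately show ?thesis using L0_eq[OF Fv_V0[OF v r0(1) r0(1)] adm] by (simp add: power2_eq_square)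
qed

lemma transfer_surj: "\<exists>L\<in>HR. transfer L = l"
proof -
  obtain L where L: "equiv_form V L" "\<And>f. f \<in> V0 \<Longrightarrow> L f = L0 f" using equiv_form_extend[OF equiv_form_L0] by blast
  \<comment> \<open>Elements of \<open>HR\<close> are required to be 0 outside the representation
    space.\<close>
  define L' where "L' f = (if f \<in> V then L f else 0)" for f
  have actV: "act g f \<in> V" if "g \<in> GR_group" "f \<in> V" for g f
    using V_act that GR_group_invertible by blast
  have "equiv_form V L'"
    using L(1) V_linear actV unfolding equiv_form_def L'_def by auto
  hence "L' \<in> HR" unfolding HR_iff by (simp add: L'_def)
  moreover have "transfer L' v = l v" for v
  proof (cases "v \<in> S")
    case True
    have F: "Fv v r0 r0 \<in> V0" using Fv_V0 True r0(1) by blast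
    thus ?thesis using True L(2)[OF F] L0_Fv[OF True] V0_V by (auto simp: transfer_def L'_def)
  qed (simp add: transfer_def HH_D(3)[OF l])
  ultimately show ?thesis by blast
qed

end

section \<open>Equality of the two dimensions\<close>

lemma vector_space_fun: "vector_space (\<lambda>c (l::'w \<Rightarrow> complex) v. c * l v)"
  by unfold_locales (auto simp: fun_eq_iff algebra_simps)

lemma subspace_hom_space:
  fixes \<rho> :: "('g, 'w::ab_group_add) rep"
  shows "module.subspace (\<lambda>c (l::'w \<Rightarrow> complex) v. c * l v) (hom_space H \<eta> \<rho>)"
proof -
  interpret v: vector_space "\<lambda>c (l::'w \<Rightarrow> complex) v. c * l v" by (rule vector_space_fun)
  show ?thesis unfolding v.subspace_def
    by (auto simp: hom_space_def linear_forms_def algebra_simps)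
qed

lemma shalika_mult_eq_GR_mult: "shalika_mult D \<psi> \<pi> \<omega> = GR_mult D \<psi> (induced_GL3 absF D \<pi> \<theta>)"
proof -
  have "bij_betw transfer HR HH"
    unfolding bij_betw_def
  proof
    show "inj_on transfer HR"
    proof (rule inj_onI)
      fix L L' assume LL: "L \<in> HR" "L' \<in> HR" "transfer L = transfer L'"
      interpret v: vector_space "\<lambda>c (l::('d^3^3 \<Rightarrow> 'v) \<Rightarrow> complex) v. c * l v" by (rule vector_space_fun)
      have "L - L' \<in> HR" using v.subspace_diff[OF subspace_hom_space LL(1,2)] .
      moreover have "transfer (L - L') v = 0" for v using fun_cong[OF LL(3), of v] by (auto simp: transfer_def)
      ultimately have "(L - L') f = 0" for f using transfer_inj by blast
      thus "L = L'" by (auto simp: fun_eq_iff)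
    qed
    show "transfer ` HR = HH" using transfer_HH transfer_surj by blast
  qed
  hence "edim (\<lambda>c l v. c * l v) HR = edim (\<lambda>c l v. c * l v) HH"
    by (rule edim_bij_eq[OF vector_space_fun vector_space_fun subspace_hom_space subspace_hom_space])
      (auto simp: transfer_def fun_eq_iff)
  thus ?thesis by (simp add: shalika_mult_def GR_mult_def multiplicity_of_def)
qed

end

theorem theorem6p6:
  fixes p :: nat
    and absF :: "'f::field_char_0 \<Rightarrow> real"
    and D :: "('f, 'd::division_ring) quat"
    and \<psi> \<omega> :: "'f \<Rightarrow> complex"
    and \<pi> :: "('d^2^2, 'v::ab_group_add) rep"
  assumes "p_adic_field p absF"
    and "nonsplit_quaternion_algebra D"
    and "nontrivial_additive_character absF \<psi>"
    and "unitary_character absF \<omega>"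
    and "irreducible_representation GL (GL_top absF D) \<pi>"
    and "tempered GL (GL_top absF D) (GL_centre D) \<pi>"
    and "\<forall>a. a \<noteq> 0 \<longrightarrow> (\<forall>v\<in>rspace \<pi>. ract \<pi> (central D a) v = rscale \<pi> ((\<omega> a)\<^sup>2) v)"
  shows "shalika_mult D \<psi> \<pi> \<omega> = GR_mult D \<psi> (induced_GL3 absF D \<pi> (\<lambda>h. inverse (\<omega> (rnorm D h))))"
proof -
  interpret p_adic_field p absF by fact
  interpret nonsplit_quaternion_algebra D by fact
  interpret GR_setup p absF D \<psi> \<omega> \<pi>
    using assms by unfold_locales (auto simp: irreducible_representation_def)
  show ?thesis using shalika_mult_eq_GR_mult unfolding \<theta>_def[abs_def] .
qed

end
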